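(* Let $R$ be a von Neumann regular right $WV$-ring such that each cyclic right $R$-module satisfies ( * ). Then $R$ is semisimple artinian.
   Context: All rings are associative with identity, and all modules are right modules. A ring $R$ is a right $WV$-ring if every simple right $R$-module is $R/A$-injective for every right ideal $A$ of $R$ such that $R/A\not\cong R$ as right $R$-modules. (For modules $N$, $Q$: $Q$ is $N$-injective if every homomorphism from a submodule of $N$ to $Q$ extends to $N$.) A module is CS if each of its submodules is essential in a direct summand. A module $N$ satisfies ( * ) if $N=A\oplus B$ where $A$ is either a CS module or a noetherian module, and $B$ is a projective module. *)

theory Defs
  imports "HOL-Algebra.AbelCoset"
begin

text \<open>The library's modules are modules over commutative rings.  Here rings are arbitrary
  (associative, with identity) and scalars act on the right.  As for the library's record of modules,
  the record extends the one of rings so that the additive vocabulary of abelian groups applies; its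
  multiplication and unit are ignored.\<close>

record ('a, 'b) rmodule = "'b ring" +
  rsmult :: "'b \<Rightarrow> 'a \<Rightarrow> 'b"  (infixl \<open>\<triangleleft>\<index>\<close> 70)

locale right_module = R?: ring R + M?: abelian_group M
  for R :: "('a, 'm) ring_scheme" (structure) and M :: "('a, 'b, 'n) rmodule_scheme" (structure) +
  assumes rsmult_closed:
      "\<lbrakk>x \<in> carrier M; r \<in> carrier R\<rbrakk> \<Longrightarrow> x \<triangleleft>\<^bsub>M\<^esub> r \<in> carrier M"
    and rsmult_l_distr:
      "\<lbrakk>x \<in> carrier M; y \<in> carrier M; r \<in> carrier R\<rbrakk> \<Longrightarrow>
        (x \<oplus>\<^bsub>M\<^esub> y) \<triangleleft>\<^bsub>M\<^esub> r = x \<triangleleft>\<^bsub>M\<^esub> r \<oplus>\<^bsub>M\<^esub> y \<triangleleft>\<^bsub>M\<^esub> r"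
    and rsmult_r_distr:
      "\<lbrakk>x \<in> carrier M; r \<in> carrier R; s \<in> carrier R\<rbrakk> \<Longrightarrow>
        x \<triangleleft>\<^bsub>M\<^esub> (r \<oplus>\<^bsub>R\<^esub> s) = x \<triangleleft>\<^bsub>M\<^esub> r \<oplus>\<^bsub>M\<^esub> x \<triangleleft>\<^bsub>M\<^esub> s"
    and rsmult_assoc:
      "\<lbrakk>x \<in> carrier M; r \<in> carrier R; s \<in> carrier R\<rbrakk> \<Longrightarrow>
        x \<triangleleft>\<^bsub>M\<^esub> (r \<otimes>\<^bsub>R\<^esub> s) = x \<triangleleft>\<^bsub>M\<^esub> r \<triangleleft>\<^bsub>M\<^esub> s"
    and rsmult_one: "x \<in> carrier M \<Longrightarrow> x \<triangleleft>\<^bsub>M\<^esub> \<one>\<^bsub>R\<^esub> = x"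

definition rsubmodule ::
    "('a, 'm) ring_scheme \<Rightarrow> ('a, 'b, 'n) rmodule_scheme \<Rightarrow> 'b set \<Rightarrow> bool" where
  "rsubmodule R M H \<longleftrightarrow> additive_subgroup H M \<and> (\<forall>x\<in>H. \<forall>r\<in>carrier R. x \<triangleleft>\<^bsub>M\<^esub> r \<in> H)"

text \<open>A submodule \<open>H\<close> of \<open>M\<close> is regarded as a module in its own right as \<open>M\<lparr>carrier := H\<rparr>\<close>.\<close>

definition rmod_hom ::
    "('a, 'm) ring_scheme \<Rightarrow> ('a, 'b, 'n) rmodule_scheme \<Rightarrow> ('a, 'c, 'k) rmodule_scheme
      \<Rightarrow> ('b \<Rightarrow> 'c) set" where
  "rmod_hom R M N = {f. f \<in> carrier M \<rightarrow> carrier N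
     \<and> (\<forall>x\<in>carrier M. \<forall>y\<in>carrier M. f (x \<oplus>\<^bsub>M\<^esub> y) = f x \<oplus>\<^bsub>N\<^esub> f y)
     \<and> (\<forall>x\<in>carrier M. \<forall>r\<in>carrier R. f (x \<triangleleft>\<^bsub>M\<^esub> r) = f x \<triangleleft>\<^bsub>N\<^esub> r)}"

definition rmod_iso ::
    "('a, 'm) ring_scheme \<Rightarrow> ('a, 'b, 'n) rmodule_scheme \<Rightarrow> ('a, 'c, 'k) rmodule_scheme \<Rightarrow> bool" where
  "rmod_iso R M N \<longleftrightarrow> (\<exists>f\<in>rmod_hom R M N. bij_betw f (carrier M) (carrier N))"

definition regular_rmod :: "('a, 'm) ring_scheme \<Rightarrow> ('a, 'a) rmodule" where
  "regular_rmod R = \<lparr>carrier = carrier R, monoid.mult = monoid.mult R, monoid.one = monoid.one R,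
     ring.zero = ring.zero R, ring.add = ring.add R, rsmult = monoid.mult R\<rparr>"

definition right_ideal :: "('a, 'm) ring_scheme \<Rightarrow> 'a set \<Rightarrow> bool" where
  "right_ideal R A \<longleftrightarrow> rsubmodule R (regular_rmod R) A"

definition quot_rmod :: "('a, 'b, 'n) rmodule_scheme \<Rightarrow> 'b set \<Rightarrow> ('a, 'b set) rmodule" where
  "quot_rmod M K = \<lparr>carrier = a_rcosets\<^bsub>M\<^esub> K, monoid.mult = undefined, monoid.one = undefined,
     ring.zero = K, ring.add = set_add M, rsmult = (\<lambda>X r. \<Union>x\<in>X. K +>\<^bsub>M\<^esub> (x \<triangleleft>\<^bsub>M\<^esub> r))\<rparr>"

definition simple_rmod :: "('a, 'm) ring_scheme \<Rightarrow> ('a, 'b, 'n) rmodule_scheme \<Rightarrow> bool" where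
  "simple_rmod R M \<longleftrightarrow> right_module R M \<and> carrier M \<noteq> {\<zero>\<^bsub>M\<^esub>}
     \<and> (\<forall>H. rsubmodule R M H \<longrightarrow> H = {\<zero>\<^bsub>M\<^esub>} \<or> H = carrier M)"

definition cyclic_rmod :: "('a, 'm) ring_scheme \<Rightarrow> ('a, 'b, 'n) rmodule_scheme \<Rightarrow> bool" where
  "cyclic_rmod R M \<longleftrightarrow> right_module R M
     \<and> (\<exists>x\<in>carrier M. carrier M = (\<lambda>r. x \<triangleleft>\<^bsub>M\<^esub> r) ` carrier R)"

definition rel_injective ::
    "('a, 'm) ring_scheme \<Rightarrow> ('a, 'b, 'n) rmodule_scheme \<Rightarrow> ('a, 'c, 'k) rmodule_scheme \<Rightarrow> bool" where
  "rel_injective R N Q \<longleftrightarrow> (\<forall>K. rsubmodule R N K \<longrightarrow>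
     (\<forall>f\<in>rmod_hom R (N\<lparr>carrier := K\<rparr>) Q. \<exists>g\<in>rmod_hom R N Q. \<forall>x\<in>K. g x = f x))"

text \<open>\<open>rel_injective R N Q\<close> says that \<open>Q\<close> is \<open>N\<close>-injective.  In the next definition, simple modules
  with elements of type \<^typ>\<open>'a set\<close> represent all simple modules: each is isomorphic to the
  quotient of the regular module by a maximal right ideal.\<close>

definition right_WV_ring :: "('a, 'm) ring_scheme \<Rightarrow> bool" where
  "right_WV_ring R \<longleftrightarrow> ring R \<and>
     (\<forall>A. right_ideal R A \<and> \<not> rmod_iso R (quot_rmod (regular_rmod R) A) (regular_rmod R) \<longrightarrow>
       (\<forall>S :: ('a, 'a set) rmodule. simple_rmod R S \<longrightarrow>
         rel_injective R (quot_rmod (regular_rmod R) A) S))"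

definition von_neumann_regular :: "('a, 'm) ring_scheme \<Rightarrow> bool" where
  "von_neumann_regular R \<longleftrightarrow>
     ring R \<and> (\<forall>a\<in>carrier R. \<exists>x\<in>carrier R. a = a \<otimes>\<^bsub>R\<^esub> x \<otimes>\<^bsub>R\<^esub> a)"

definition internal_direct_sum ::
    "('a, 'm) ring_scheme \<Rightarrow> ('a, 'b, 'n) rmodule_scheme \<Rightarrow> 'b set \<Rightarrow> 'b set \<Rightarrow> bool" where
  "internal_direct_sum R M A B \<longleftrightarrow> rsubmodule R M A \<and> rsubmodule R M B
     \<and> A <+>\<^bsub>M\<^esub> B = carrier M \<and> A \<inter> B = {\<zero>\<^bsub>M\<^esub>}"

definition direct_summand ::
    "('a, 'm) ring_scheme \<Rightarrow> ('a, 'b, 'n) rmodule_scheme \<Rightarrow> 'b set \<Rightarrow> bool" where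
  "direct_summand R M D \<longleftrightarrow> (\<exists>E. internal_direct_sum R M D E)"

definition essential_in ::
    "('a, 'm) ring_scheme \<Rightarrow> ('a, 'b, 'n) rmodule_scheme \<Rightarrow> 'b set \<Rightarrow> 'b set \<Rightarrow> bool" where
  "essential_in R M K D \<longleftrightarrow> rsubmodule R M K \<and> rsubmodule R M D \<and> K \<subseteq> D
     \<and> (\<forall>L. rsubmodule R M L \<and> L \<subseteq> D \<and> L \<noteq> {\<zero>\<^bsub>M\<^esub>} \<longrightarrow> K \<inter> L \<noteq> {\<zero>\<^bsub>M\<^esub>})"

definition CS_rmod :: "('a, 'm) ring_scheme \<Rightarrow> ('a, 'b, 'n) rmodule_scheme \<Rightarrow> bool" where
  "CS_rmod R M \<longleftrightarrow> right_module R M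
     \<and> (\<forall>K. rsubmodule R M K \<longrightarrow> (\<exists>D. direct_summand R M D \<and> essential_in R M K D))"

definition noetherian_rmod :: "('a, 'm) ring_scheme \<Rightarrow> ('a, 'b, 'n) rmodule_scheme \<Rightarrow> bool" where
  "noetherian_rmod R M \<longleftrightarrow> right_module R M
     \<and> (\<forall>H :: nat \<Rightarrow> 'b set. (\<forall>i. rsubmodule R M (H i)) \<and> (\<forall>i. H i \<subseteq> H (Suc i)) \<longrightarrow>
          (\<exists>n. \<forall>i\<ge>n. H i = H n))"

definition artinian_rmod :: "('a, 'm) ring_scheme \<Rightarrow> ('a, 'b, 'n) rmodule_scheme \<Rightarrow> bool" where
  "artinian_rmod R M \<longleftrightarrow> right_module R M
     \<and> (\<forall>H :: nat \<Rightarrow> 'b set. (\<forall>i. rsubmodule R M (H i)) \<and> (\<forall>i. H (Suc i) \<subseteq> H i) \<longrightarrow>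
          (\<exists>n. \<forall>i\<ge>n. H i = H n))"

text \<open>Projectivity is the lifting property against epimorphisms.  A definition cannot quantify over
  types, so the test modules have elements of type \<^typ>\<open>'b \<Rightarrow> 'a\<close>.  This loses nothing: that
  type holds the free module on the carrier of \<open>P\<close> (finitely supported functions) and an isomorphic
  copy of \<open>P\<close>, so the property below makes \<open>P\<close> a retract of a free module.\<close>

definition projective_rmod :: "('a, 'm) ring_scheme \<Rightarrow> ('a, 'b, 'n) rmodule_scheme \<Rightarrow> bool" where
  "projective_rmod R P \<longleftrightarrow> right_module R P
     \<and> (\<forall>(M :: ('a, 'b \<Rightarrow> 'a) rmodule) (N :: ('a, 'b \<Rightarrow> 'a) rmodule).
          right_module R M \<and> right_module R N \<longrightarrow>
          (\<forall>g\<in>rmod_hom R M N. g ` carrier M = carrier N \<longrightarrow>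
            (\<forall>f\<in>rmod_hom R P N. \<exists>h\<in>rmod_hom R P M. \<forall>x\<in>carrier P. g (h x) = f x)))"

definition star_condition :: "('a, 'm) ring_scheme \<Rightarrow> ('a, 'b, 'n) rmodule_scheme \<Rightarrow> bool" where
  "star_condition R N \<longleftrightarrow> (\<exists>A B. internal_direct_sum R N A B
     \<and> (CS_rmod R (N\<lparr>carrier := A\<rparr>) \<or> noetherian_rmod R (N\<lparr>carrier := A\<rparr>))
     \<and> projective_rmod R (N\<lparr>carrier := B\<rparr>))"

definition rspan ::
    "('a, 'm) ring_scheme \<Rightarrow> ('a, 'b, 'n) rmodule_scheme \<Rightarrow> 'b set \<Rightarrow> 'b set" where
  "rspan R M X = \<Inter>{H. rsubmodule R M H \<and> X \<subseteq> H}"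

text \<open>A module is semisimple if it is the direct sum of a set of simple submodules; the zero module
  is the direct sum of the empty set.\<close>

definition semisimple_rmod :: "('a, 'm) ring_scheme \<Rightarrow> ('a, 'b, 'n) rmodule_scheme \<Rightarrow> bool" where
  "semisimple_rmod R M \<longleftrightarrow> right_module R M
     \<and> (\<exists>\<S>. (\<forall>S\<in>\<S>. rsubmodule R M S \<and> simple_rmod R (M\<lparr>carrier := S\<rparr>))
          \<and> rspan R M (\<Union>\<S>) = carrier M
          \<and> (\<forall>S\<in>\<S>. S \<inter> rspan R M (\<Union>(\<S> - {S})) = {\<zero>\<^bsub>M\<^esub>}))"

definition semisimple_artinian_ring :: "('a, 'm) ring_scheme \<Rightarrow> bool" where
  "semisimple_artinian_ring R \<longleftrightarrow>
     ring R \<and> semisimple_rmod R (regular_rmod R) \<and> artinian_rmod R (regular_rmod R)"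

end

theory Submission
  imports Defs "HOL-Library.Nat_Bijection"
begin

text \<open>Suppose that the regular ring \<open>R\<close> differs from the sum of its minimal right ideals, the socle.

  If each principal right ideal outside the socle is a direct sum of two such right ideals, then \<open>R\<close>
  contains an infinite direct sum of principal right ideals \<open>P n\<close> outside the socle.  Choosing in
  each \<open>P n\<close> a maximal submodule, which can be made essential, gives an essential right ideal \<open>I\<close> for
  which \<open>R / I\<close> contains infinitely many independent simple modules.  Essentiality of \<open>I\<close> makes every
  cyclic submodule of a factor of \<open>R / I\<close> a CS or noetherian module (a regular ring is nonsingular, so the
  projective summand in the star condition vanishes), and the WV condition makes simple submodules of
  \<open>R / I\<close> direct summands.  This is contradictory by an argument in the style of Osofsky and Smith.

  Otherwise some \<open>eR\<close> outside the socle does not split in this way.  It contains an infinite direct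
  sum of right ideals in the socle.  Split that sum into three infinite parts and let \<open>T\<close> be
  the first one.  The star condition for \<open>eR / T\<close>, applied to the closure of the second part,
  decomposes \<open>eR\<close>, and whichever summand lies in the socle has to absorb all but finitely much of the
  second or of the third part, which is impossible.\<close>

text \<open>Every module that occurs is a subfactor \<open>J / I\<close> of \<open>R\<close>, so the
  argument lives in the lattice of right ideals. The star condition for \<open>(xR + I) / I\<close>
  enters through two elements: the projective summand is \<open>(bR + I) / I\<close>, and a
  splitting of the map from \<open>R\<close> onto it sends the class of \<open>b\<close> to some
  \<open>c\<close> with \<open>bc - b\<close> in \<open>I\<close>, where \<open>cr = 0\<close>
  whenever \<open>br\<close> lies in \<open>I\<close>. Over an essential \<open>I\<close> this
  forces \<open>c = 0\<close>. In general \<open>bcR\<close> is a copy of the summand inside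
  \<open>R\<close>, so a decomposition modulo \<open>I\<close> lifts to one of right ideals.

  In the unsplittable case the obstacle is that \<open>eR\<close> is itself projective, so the star
  condition for \<open>eR\<close> alone says nothing. Division by the infinite sum \<open>T\<close>
  forces the CS or noetherian summand out of the socle.

  Largeness is measured by failure of \<open>cpt\<close>. Infinite independent sums fail it, and a
  failure is inherited by the intersection with \<open>B\<close> if the right ideal lies in
  \<open>B\<close> plus a finite sum of simples.\<close>

context ring
begin

section \<open>Right ideals, their sums and the modular law\<close>

abbreviation ri :: "'a set \<Rightarrow> bool" where
  "ri A \<equiv> right_ideal R A"

abbreviation rsum :: "'a set \<Rightarrow> 'a set \<Rightarrow> 'a set" (infixl \<open>\<boxplus>\<close> 65) where
  "A \<boxplus> B \<equiv> set_add R A B"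

definition prin :: "'a \<Rightarrow> 'a set" where
  "prin x = (\<lambda>r. x \<otimes> r) ` carrier R"

text \<open>Negatives come from multiplication by \<open>\<ominus> \<one>\<close>; the four
  remaining conditions are what later goals unfold to.\<close>

lemma ri_iff: "ri A \<longleftrightarrow> A \<subseteq> carrier R \<and> \<zero> \<in> A \<and> (\<forall>x\<in>A. \<forall>y\<in>A. x \<oplus> y \<in> A)
    \<and> (\<forall>x\<in>A. \<forall>r\<in>carrier R. x \<otimes> r \<in> A)" (is "_ \<longleftrightarrow> ?r")
proof
  assume "ri A"
  then have s: "additive_subgroup A (regular_rmod R)" and m: "\<forall>x\<in>A. \<forall>r\<in>carrier R. x \<otimes> r \<in> A"
    by (auto simp: right_ideal_def rsubmodule_def regular_rmod_def)
  from s have "subgroup A (add_monoid (regular_rmod R))"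
    by (simp add: additive_subgroup_def)
  then have "A \<subseteq> carrier R" "\<zero> \<in> A" "\<forall>x\<in>A. \<forall>y\<in>A. x \<oplus> y \<in> A"
    using subgroup.subset subgroup.one_closed subgroup.m_closed
    by (fastforce simp: regular_rmod_def)+
  with m show ?r by blast
next
  assume r: ?r
  have "subgroup A (add_monoid R)"
  proof (rule group.subgroupI)
    show "group (add_monoid R)" by (rule a_group)
    show "A \<subseteq> carrier (add_monoid R)" "A \<noteq> {}" using r by auto
    fix a assume a: "a \<in> A"
    then have "a \<in> carrier R" "a \<otimes> (\<ominus> \<one>) \<in> A" using r by auto
    then have "\<ominus> a \<in> A" by (simp add: r_minus)
    then show "inv\<^bsub>add_monoid R\<^esub> a \<in> A" by (simp add: a_inv_def)
  next
    fix a b assume "a \<in> A" "b \<in> A"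
    then show "a \<otimes>\<^bsub>add_monoid R\<^esub> b \<in> A" using r by auto
  qed
  then have "additive_subgroup A (regular_rmod R)"
    by (auto simp: additive_subgroup_def regular_rmod_def subgroup_def m_inv_def)
  then show "ri A"
    using r by (simp add: right_ideal_def rsubmodule_def regular_rmod_def)
qed

lemma ri_carrier: "ri A \<Longrightarrow> x \<in> A \<Longrightarrow> x \<in> carrier R"
  and ri_zero: "ri A \<Longrightarrow> \<zero> \<in> A"
  and ri_add: "ri A \<Longrightarrow> x \<in> A \<Longrightarrow> y \<in> A \<Longrightarrow> x \<oplus> y \<in> A"
  and ri_mult: "ri A \<Longrightarrow> x \<in> A \<Longrightarrow> r \<in> carrier R \<Longrightarrow> x \<otimes> r \<in> A"
  by (auto simp: ri_iff)

lemma ri_uminus: "ri A \<Longrightarrow> x \<in> A \<Longrightarrow> \<ominus> x \<in> A"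
  using ri_mult[of A x "\<ominus> \<one>"] by (simp add: r_minus ri_carrier)

lemma ri_minus: "ri A \<Longrightarrow> x \<in> A \<Longrightarrow> y \<in> A \<Longrightarrow> x \<ominus> y \<in> A"
  by (simp add: a_minus_def ri_add ri_uminus)

lemma ri_whole: "ri (carrier R)" and ri_null: "ri {\<zero>}"
  by (auto simp: ri_iff)

lemma ri_Int: "ri A \<Longrightarrow> ri B \<Longrightarrow> ri (A \<inter> B)"
  by (auto simp: ri_iff)

lemma ri_prin: "x \<in> carrier R \<Longrightarrow> ri (prin x)"
  unfolding ri_iff prin_def
proof (intro conjI ballI)
  assume x: "x \<in> carrier R"
  show "\<zero> \<in> (\<otimes>) x ` carrier R" using x by (metis image_eqI r_null zero_closed)
  fix u v assume "u \<in> (\<otimes>) x ` carrier R" "v \<in> (\<otimes>) x ` carrier R"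
  then show "u \<oplus> v \<in> (\<otimes>) x ` carrier R"
    using x by (auto simp: r_distr[symmetric])
qed (auto simp: m_assoc)

lemma prin_self: "x \<in> carrier R \<Longrightarrow> x \<in> prin x"
  unfolding prin_def by (metis image_eqI one_closed r_one)

lemma prin_least: "ri A \<Longrightarrow> x \<in> A \<Longrightarrow> prin x \<subseteq> A"
  by (auto simp: prin_def ri_mult)

lemma prin_one: "prin \<one> = carrier R"
  by (auto simp: prin_def image_iff)

lemma mem_rsum: "x \<in> A \<boxplus> B \<longleftrightarrow> (\<exists>a\<in>A. \<exists>b\<in>B. x = a \<oplus> b)"
  by (auto simp: set_add_def')

lemma rsumI: "a \<in> A \<Longrightarrow> b \<in> B \<Longrightarrow> a \<oplus> b \<in> A \<boxplus> B"
  by (auto simp: mem_rsum)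

lemma ri_rsum: assumes A: "ri A" and B: "ri B" shows "ri (A \<boxplus> B)"
  unfolding ri_iff
proof (intro conjI ballI)
  show "A \<boxplus> B \<subseteq> carrier R"
    using A B by (auto simp: mem_rsum ri_carrier)
  show "\<zero> \<in> A \<boxplus> B" using A B rsumI[of \<zero> A \<zero> B] by (simp add: ri_zero)
next
  fix x y assume "x \<in> A \<boxplus> B" "y \<in> A \<boxplus> B"
  then obtain a b c d where *: "a \<in> A" "b \<in> B" "c \<in> A" "d \<in> B" "x = a \<oplus> b" "y = c \<oplus> d"
    by (auto simp: mem_rsum)
  then have "x \<oplus> y = (a \<oplus> c) \<oplus> (b \<oplus> d)"
    using A B by (simp add: ri_carrier a_ac)
  then show "x \<oplus> y \<in> A \<boxplus> B" using * A B by (simp add: rsumI ri_add)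
next
  fix x r assume "x \<in> A \<boxplus> B" and r: "r \<in> carrier R"
  then obtain a b where *: "a \<in> A" "b \<in> B" "x = a \<oplus> b" by (auto simp: mem_rsum)
  then have "x \<otimes> r = a \<otimes> r \<oplus> b \<otimes> r" using A B r by (simp add: ri_carrier l_distr)
  then show "x \<otimes> r \<in> A \<boxplus> B" using * A B r by (simp add: rsumI ri_mult)
qed

lemma rsum_upper1: "ri A \<Longrightarrow> ri B \<Longrightarrow> A \<subseteq> A \<boxplus> B"
  by (metis mem_rsum r_zero ri_carrier ri_zero subsetI)

lemma rsum_upper2: "ri A \<Longrightarrow> ri B \<Longrightarrow> B \<subseteq> A \<boxplus> B"
  by (metis mem_rsum l_zero ri_carrier ri_zero subsetI)

lemma rsum_least: "ri C \<Longrightarrow> A \<subseteq> C \<Longrightarrow> B \<subseteq> C \<Longrightarrow> A \<boxplus> B \<subseteq> C"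
  unfolding mem_rsum subset_iff by (blast intro: ri_add)

lemma rsum_mono: "A \<subseteq> A' \<Longrightarrow> B \<subseteq> B' \<Longrightarrow> A \<boxplus> B \<subseteq> A' \<boxplus> B'"
  unfolding mem_rsum subset_iff by blast

lemma rsum_commute: "ri A \<Longrightarrow> ri B \<Longrightarrow> A \<boxplus> B = B \<boxplus> A"
  by (meson ri_rsum rsum_least rsum_upper1 rsum_upper2 subset_antisym)

lemma rsum_assoc:
  assumes "ri A" "ri B" "ri C" shows "A \<boxplus> B \<boxplus> C = A \<boxplus> (B \<boxplus> C)"
proof (intro subset_antisym rsum_least)
qed (use assms ri_rsum rsum_upper1 rsum_upper2 in \<open>meson subset_trans\<close>)+

lemma rsum_absorb1: "ri A \<Longrightarrow> ri B \<Longrightarrow> A \<subseteq> B \<Longrightarrow> A \<boxplus> B = B"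
  by (simp add: rsum_least rsum_upper2 subset_antisym)

lemma rsum_absorb2: "ri A \<Longrightarrow> ri B \<Longrightarrow> B \<subseteq> A \<Longrightarrow> A \<boxplus> B = A"
  by (simp add: rsum_least rsum_upper1 subset_antisym)

lemma add_minus_cancel: "a \<in> carrier R \<Longrightarrow> b \<in> carrier R \<Longrightarrow> a \<oplus> (b \<ominus> a) = b"
  by (metis a_minus_def a_inv_closed add.m_comm r_neg2)

lemma minus_add_cancel: "a \<in> carrier R \<Longrightarrow> b \<in> carrier R \<Longrightarrow> (a \<oplus> b) \<ominus> a = b"
  and minus_add_cancel2: "a \<in> carrier R \<Longrightarrow> b \<in> carrier R \<Longrightarrow> (a \<oplus> b) \<ominus> b = a"
  and add_minus_cancel2: "a \<in> carrier R \<Longrightarrow> b \<in> carrier R \<Longrightarrow> (b \<ominus> a) \<oplus> a = b"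
  by (metis a_minus_def a_inv_closed add.m_assoc add.m_comm r_neg2 r_neg l_neg r_zero)+

lemma ri_cancel1: "ri C \<Longrightarrow> a \<in> C \<Longrightarrow> b \<in> carrier R \<Longrightarrow> a \<oplus> b \<in> C \<longleftrightarrow> b \<in> C"
  by (metis minus_add_cancel ri_add ri_carrier ri_minus)

lemma ri_cancel2: "ri C \<Longrightarrow> b \<in> C \<Longrightarrow> a \<in> carrier R \<Longrightarrow> a \<oplus> b \<in> C \<longleftrightarrow> a \<in> C"
  by (metis minus_add_cancel2 ri_add ri_carrier ri_minus)

lemma ri_diff_swap: "ri C \<Longrightarrow> a \<in> carrier R \<Longrightarrow> b \<in> carrier R \<Longrightarrow> a \<ominus> b \<in> C \<Longrightarrow> a \<in> C \<longleftrightarrow> b \<in> C"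
  by (metis add_minus_cancel2 ri_cancel1)

lemma modular:
  assumes "ri A" "ri B" "ri C" "A \<subseteq> C" shows "C \<inter> (A \<boxplus> B) = A \<boxplus> (C \<inter> B)"
proof
  show "C \<inter> (A \<boxplus> B) \<subseteq> A \<boxplus> (C \<inter> B)"
  proof
    fix x assume "x \<in> C \<inter> (A \<boxplus> B)"
    then obtain a b where *: "a \<in> A" "b \<in> B" "x = a \<oplus> b" "x \<in> C" by (auto simp: mem_rsum)
    then have "b \<in> C" using assms ri_cancel1[of C a b] by (auto simp: ri_carrier)
    with * show "x \<in> A \<boxplus> (C \<inter> B)" by (auto simp: mem_rsum)
  qed
  show "A \<boxplus> (C \<inter> B) \<subseteq> C \<inter> (A \<boxplus> B)"
    using assms by (auto simp: mem_rsum) (blast intro: ri_add)+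
qed

lemma ri_chain_Union:
  fixes H :: "nat \<Rightarrow> 'a set"
  assumes H: "\<And>n. ri (H n)" and inc: "\<And>n. H n \<subseteq> H (Suc n)"
  shows "ri (\<Union>n. H n)"
proof -
  have mono: "m \<le> n \<Longrightarrow> H m \<subseteq> H n" for m n by (rule lift_Suc_mono_le[of H]) (use inc in auto)
  show ?thesis
    unfolding ri_iff
  proof (intro conjI ballI)
    show "(\<Union>n. H n) \<subseteq> carrier R" "\<zero> \<in> (\<Union>n. H n)" using H ri_carrier ri_zero by blast+
    fix x y assume "x \<in> (\<Union>n. H n)" "y \<in> (\<Union>n. H n)"
    then obtain m n where "x \<in> H m" "y \<in> H n" by auto
    then have "x \<in> H (max m n)" "y \<in> H (max m n)"
      using mono[of m "max m n"] mono[of n "max m n"] by auto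
    then show "x \<oplus> y \<in> (\<Union>n. H n)" using H ri_add by blast
  qed (use H ri_mult in blast)
qed

text \<open>Zorn's lemma for an arbitrary \<open>X\<close>, because it serves twice:
  \<open>X\<close> is a single generator when a maximal submodule is built, and the nonzero part of
  a right ideal when a complement is built.\<close>

lemma ri_maximal_avoiding:
  assumes V: "ri V" and VX: "V \<inter> X = {}"
  obtains M where "ri M" "V \<subseteq> M" "M \<inter> X = {}"
    "\<And>N. ri N \<Longrightarrow> M \<subseteq> N \<Longrightarrow> N \<inter> X = {} \<Longrightarrow> N = M"
proof -
  let ?A = "{N. ri N \<and> V \<subseteq> N \<and> N \<inter> X = {}}"
  have "\<exists>M\<in>?A. \<forall>N\<in>?A. M \<subseteq> N \<longrightarrow> N = M"
  proof (rule subset_Zorn_nonempty)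
    show "?A \<noteq> {}" using V VX by blast
    fix \<C> assume ne: "\<C> \<noteq> {}" and ch: "subset.chain ?A \<C>"
    then have sub: "\<C> \<subseteq> ?A" and tot: "\<And>M N. M \<in> \<C> \<Longrightarrow> N \<in> \<C> \<Longrightarrow> M \<subseteq> N \<or> N \<subseteq> M"
      by (auto simp: subset_chain_def)
    have "ri (\<Union>\<C>)"
      unfolding ri_iff
    proof (intro conjI ballI)
      show "\<Union>\<C> \<subseteq> carrier R" "\<zero> \<in> \<Union>\<C>" using sub ne by (auto simp: ri_iff)
      fix x y assume "x \<in> \<Union>\<C>" "y \<in> \<Union>\<C>"
      then obtain M where "M \<in> \<C>" "x \<in> M" "y \<in> M" using tot by blast
      then show "x \<oplus> y \<in> \<Union>\<C>" using sub ri_add by blast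
    next
      fix x r assume "x \<in> \<Union>\<C>" "r \<in> carrier R"
      then show "x \<otimes> r \<in> \<Union>\<C>" using sub ri_mult by blast
    qed
    then show "\<Union>\<C> \<in> ?A" using sub ne by auto
  qed
  then show ?thesis using that by (smt (verit) mem_Collect_eq order_trans)
qed

subsection \<open>Right ideals above a given one\<close>

text \<open>Modules \<open>J / I\<close> are studied through the right ideals between \<open>I\<close> and \<open>J\<close>: \<open>ess I V J\<close> says that
  \<open>V / I\<close> is essential in \<open>J / I\<close>, \<open>atom I T\<close> that \<open>T / I\<close> is simple, \<open>fsum I F\<close> that \<open>F / I\<close> is semisimple
  of finite length; \<open>cs I J\<close> and \<open>noeth I J\<close> say that \<open>J / I\<close> is CS or noetherian.  \<open>cpt I K\<close>, a weak
  form of finite generation, holds if no ascending sequence exhausts \<open>K / I\<close> properly.\<close>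

definition ess :: "'a set \<Rightarrow> 'a set \<Rightarrow> 'a set \<Rightarrow> bool" where
  "ess I V J \<longleftrightarrow> V \<subseteq> J \<and> (\<forall>x\<in>J - I. \<exists>r\<in>carrier R. x \<otimes> r \<in> V - I)"

definition atom :: "'a set \<Rightarrow> 'a set \<Rightarrow> bool" where
  "atom I T \<longleftrightarrow> ri T \<and> I \<subseteq> T \<and> T \<noteq> I \<and> (\<forall>y\<in>T - I. T \<subseteq> prin y \<boxplus> I)"

inductive fsum :: "'a set \<Rightarrow> 'a set \<Rightarrow> bool" for I where
  fsum_base: "fsum I I"
| fsum_step: "fsum I F \<Longrightarrow> atom I T \<Longrightarrow> fsum I (F \<boxplus> T)"

definition cpt :: "'a set \<Rightarrow> 'a set \<Rightarrow> bool" where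
  "cpt I K \<longleftrightarrow> (\<forall>H :: nat \<Rightarrow> 'a set. (\<forall>n. ri (H n) \<and> I \<subseteq> H n \<and> H n \<subseteq> H (Suc n)) \<longrightarrow>
     K \<subseteq> (\<Union>n. H n) \<longrightarrow> (\<exists>n. K \<subseteq> H n))"

definition cs :: "'a set \<Rightarrow> 'a set \<Rightarrow> bool" where
  "cs I J \<longleftrightarrow> (\<forall>K. ri K \<and> I \<subseteq> K \<and> K \<subseteq> J \<longrightarrow>
     (\<exists>D D'. ri D \<and> ri D' \<and> D \<boxplus> D' = J \<and> D \<inter> D' = I \<and> ess I K D))"

definition noeth :: "'a set \<Rightarrow> 'a set \<Rightarrow> bool" where
  "noeth I J \<longleftrightarrow> (\<forall>H :: nat \<Rightarrow> 'a set. (\<forall>n. ri (H n) \<and> I \<subseteq> H n \<and> H n \<subseteq> J \<and> H n \<subseteq> H (Suc n)) \<longrightarrow>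
     (\<exists>n. \<forall>m\<ge>n. H m = H n))"

lemma essD: "ess I V J \<Longrightarrow> x \<in> J \<Longrightarrow> x \<notin> I \<Longrightarrow> \<exists>r\<in>carrier R. x \<otimes> r \<in> V \<and> x \<otimes> r \<notin> I"
  by (auto simp: ess_def)

lemma ess_subset: "ess I V J \<Longrightarrow> V \<subseteq> J"
  by (simp add: ess_def)

lemma ess_refl: "ri V \<Longrightarrow> ess I V V"
  unfolding ess_def by (metis DiffD1 DiffD2 DiffI one_closed order_refl r_one ri_carrier)

lemma ess_trans: "ri J \<Longrightarrow> ess I U V \<Longrightarrow> ess I V J \<Longrightarrow> ess I U J"
  unfolding ess_def
proof (intro conjI ballI; elim conjE)
  fix x assume J: "ri J" and U: "\<forall>x\<in>V - I. \<exists>r\<in>carrier R. x \<otimes> r \<in> U - I"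
    and V: "\<forall>x\<in>J - I. \<exists>r\<in>carrier R. x \<otimes> r \<in> V - I" and x: "x \<in> J - I"
  from V x obtain r where r: "r \<in> carrier R" "x \<otimes> r \<in> V - I" by blast
  with U obtain t where "t \<in> carrier R" "x \<otimes> r \<otimes> t \<in> U - I" by blast
  then show "\<exists>r\<in>carrier R. x \<otimes> r \<in> U - I"
    using r x J by (metis DiffD1 m_assoc m_closed ri_carrier)
qed auto

lemma ess_mono: "ess I V J \<Longrightarrow> V \<subseteq> W \<Longrightarrow> W \<subseteq> J \<Longrightarrow> ess I W J"
  unfolding ess_def by blast

text \<open>One multiplier brings \<open>x\<close> into \<open>U\<close>, a second one brings the
  product into \<open>V\<close>; \<open>U\<close>, being a right ideal, retains it.\<close>

lemma ess_Int:
  assumes "ri V" "ri M" "ri N" "ess I U M" "ess I V N" "ri U"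
  shows "ess I (U \<inter> V) (M \<inter> N)"
  unfolding ess_def
proof (intro conjI ballI)
  show "U \<inter> V \<subseteq> M \<inter> N" using assms by (auto simp: ess_def)
  fix x assume x: "x \<in> M \<inter> N - I"
  then obtain r where r: "r \<in> carrier R" "x \<otimes> r \<in> U" "x \<otimes> r \<notin> I" using assms essD by blast
  have "x \<otimes> r \<in> N" using x r assms ri_mult by blast
  then obtain t where t: "t \<in> carrier R" "x \<otimes> r \<otimes> t \<in> V" "x \<otimes> r \<otimes> t \<notin> I"
    using r assms essD by blast
  have "x \<otimes> r \<otimes> t \<in> U" using r t assms ri_mult by blast
  then show "\<exists>r\<in>carrier R. x \<otimes> r \<in> U \<inter> V - I"
    using r t x assms by (intro bexI[of _ "r \<otimes> t"]) (auto simp: m_assoc ri_carrier)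
qed

text \<open>Multiply so that the \<open>J\<close>-part falls into \<open>V\<close>, then so that the
  \<open>J'\<close>-part falls into \<open>V'\<close>. Neither product enters \<open>I\<close>:
  otherwise a part known to be outside \<open>I\<close> would belong to both \<open>J\<close> and
  \<open>J'\<close>, hence to \<open>I\<close>.\<close>

lemma ess_rsum:
  assumes "ri I" "ri J" "ri J'" "ri V" "ri V'" and J: "ess I V J" and J': "ess I V' J'"
    and Int: "J \<inter> J' \<subseteq> I" "I \<subseteq> V" "I \<subseteq> V'"
  shows "ess I (V \<boxplus> V') (J \<boxplus> J')"
  unfolding ess_def
proof (intro conjI ballI)
  show "V \<boxplus> V' \<subseteq> J \<boxplus> J'" by (intro rsum_mono ess_subset[OF J] ess_subset[OF J'])
  fix x assume x: "x \<in> J \<boxplus> J' - I"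
  then obtain a b where ab: "a \<in> J" "b \<in> J'" "x = a \<oplus> b" by (auto simp: mem_rsum)
  have c: "a \<in> carrier R" "b \<in> carrier R" using ab assms ri_carrier by blast+
  obtain r where r: "r \<in> carrier R" "a \<otimes> r \<in> V" "x \<otimes> r \<notin> I"
  proof (cases "a \<in> I")
    case True
    then show ?thesis using that[of \<one>] Int c x ab by auto
  next
    case False
    then obtain r where r: "r \<in> carrier R" "a \<otimes> r \<in> V" "a \<otimes> r \<notin> I" using essD[OF J] ab by blast
    have "x \<otimes> r \<notin> I"
    proof
      assume I: "x \<otimes> r \<in> I"
      have e: "x \<otimes> r = a \<otimes> r \<oplus> b \<otimes> r" using ab c r by (simp add: l_distr)
      have "b \<otimes> r \<in> J'" using ab r assms ri_mult by blast
      moreover have "x \<otimes> r \<in> J'" using I Int J' by (auto simp: ess_def)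
      ultimately have "a \<otimes> r \<in> J'" using e ri_cancel2[OF \<open>ri J'\<close>] c r by auto
      then show False using r Int J by (auto simp: ess_def)
    qed
    then show ?thesis using that r by blast
  qed
  obtain t where t: "t \<in> carrier R" "b \<otimes> r \<otimes> t \<in> V'" "x \<otimes> r \<otimes> t \<notin> I"
  proof (cases "b \<otimes> r \<in> I")
    case True
    then show ?thesis using that[of \<one>] Int c x ab r by auto
  next
    case False
    have bJ: "b \<otimes> r \<in> J'" using ab r assms ri_mult by blast
    then obtain t where t: "t \<in> carrier R" "b \<otimes> r \<otimes> t \<in> V'" "b \<otimes> r \<otimes> t \<notin> I"
      using essD[OF J' bJ False] by blast
    have "x \<otimes> r \<otimes> t \<notin> I"
    proof
      assume I: "x \<otimes> r \<otimes> t \<in> I"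
      have e: "x \<otimes> r \<otimes> t = a \<otimes> r \<otimes> t \<oplus> b \<otimes> r \<otimes> t" using ab c r t by (simp add: l_distr)
      have "a \<otimes> r \<otimes> t \<in> V" using r t assms ri_mult by blast
      moreover have "x \<otimes> r \<otimes> t \<in> V" using I Int by auto
      ultimately have "b \<otimes> r \<otimes> t \<in> V" using e ri_cancel1[OF \<open>ri V\<close>] c r t by auto
      then show False using t Int J J' by (auto simp: ess_def)
    qed
    then show ?thesis using that t by blast
  qed
  have "x \<otimes> (r \<otimes> t) = a \<otimes> r \<otimes> t \<oplus> b \<otimes> r \<otimes> t"
    using ab c r t by (simp add: l_distr m_assoc)
  moreover have "a \<otimes> r \<otimes> t \<in> V" using r t assms ri_mult by blast
  ultimately have "x \<otimes> (r \<otimes> t) \<in> V \<boxplus> V'" using t by (simp add: rsumI)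
  then show "\<exists>r\<in>carrier R. x \<otimes> r \<in> V \<boxplus> V' - I"
    using r t ab c by (intro bexI[of _ "r \<otimes> t"]) (auto simp: m_assoc)
qed

text \<open>The \<open>D\<close>-component \<open>d\<close> of the generator generates
  \<open>D\<close> modulo \<open>I\<close>: for \<open>y = xr + i\<close> in \<open>D\<close>, the
  difference \<open>y - dr\<close> lies in \<open>D\<close> and in \<open>D'\<close>.\<close>

lemma summand_prin:
  assumes "ri I" "ri D" "ri D'" "x \<in> carrier R" and sum: "D \<boxplus> D' = prin x \<boxplus> I" and int: "D \<inter> D' = I"
  obtains d d' where "d \<in> D" "d' \<in> D'" "D = prin d \<boxplus> I" "x = d \<oplus> d'"
proof -
  have "x \<in> prin x \<boxplus> I"
    using assms prin_self rsum_upper1[OF ri_prin[OF \<open>x \<in> carrier R\<close>] \<open>ri I\<close>] by blast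
  then obtain d d' where d: "d \<in> D" "d' \<in> D'" "x = d \<oplus> d'" by (auto simp: sum[symmetric] mem_rsum)
  then have c: "d \<in> carrier R" "d' \<in> carrier R" using assms ri_carrier by blast+
  have "D = prin d \<boxplus> I"
  proof
    show "prin d \<boxplus> I \<subseteq> D" using d assms by (intro rsum_least prin_least) auto
    show "D \<subseteq> prin d \<boxplus> I"
    proof
      fix y assume y: "y \<in> D"
      then have "y \<in> prin x \<boxplus> I"
        using rsum_upper1[OF \<open>ri D\<close> \<open>ri D'\<close>] sum by auto
      then obtain r i where r: "r \<in> carrier R" "i \<in> I" "y = x \<otimes> r \<oplus> i"
        by (auto simp: mem_rsum prin_def)
      then have ic: "i \<in> carrier R" using assms ri_carrier by blast
      have e: "y = d \<otimes> r \<oplus> (d' \<otimes> r \<oplus> i)" using r d c ic by (simp add: l_distr a_assoc)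
      have "d' \<otimes> r \<oplus> i \<in> D'" using r d int assms by (auto intro!: ri_add ri_mult)
      moreover have "d' \<otimes> r \<oplus> i \<in> D"
        using y e ri_cancel1[OF \<open>ri D\<close>, of "d \<otimes> r" "d' \<otimes> r \<oplus> i"] d c r ic ri_mult[OF \<open>ri D\<close>] by auto
      ultimately have "d' \<otimes> r \<oplus> i \<in> I" using int by auto
      then show "y \<in> prin d \<boxplus> I" using e r by (auto simp: prin_def intro!: rsumI)
    qed
  qed
  with d show ?thesis using that by blast
qed

lemma rsum_prin: "ri B \<Longrightarrow> y \<in> carrier R \<Longrightarrow> B \<subseteq> B \<boxplus> prin y \<and> y \<in> B \<boxplus> prin y"
  using rsum_upper1[of B "prin y"] rsum_upper2[of B "prin y"] ri_prin prin_self by auto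

lemma prin_rsum: "ri B \<Longrightarrow> y \<in> carrier R \<Longrightarrow> B \<subseteq> prin y \<boxplus> B \<and> y \<in> prin y \<boxplus> B"
  using rsum_prin rsum_commute ri_prin by auto

lemma atom_ri: "atom I T \<Longrightarrow> ri T" and atom_supset: "atom I T \<Longrightarrow> I \<subseteq> T"
  by (auto simp: atom_def)

text \<open>Exchange property of a simple module: in \<open>y = b + t\<close> the part
  \<open>t\<close> is outside \<open>I\<close>, because \<open>I \<subseteq> B\<close>, so it
  generates \<open>T\<close> modulo \<open>I\<close>; and \<open>t\<close> is recovered from
  \<open>b\<close> and \<open>y\<close>. It takes the place of arguments by composition
  length.\<close>

lemma atom_exchange:
  assumes B: "ri B" and T: "atom I T" "I \<subseteq> B" and y: "y \<in> B \<boxplus> T" "y \<notin> B"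
  shows "B \<boxplus> T \<subseteq> B \<boxplus> prin y"
proof -
  have yc: "y \<in> carrier R" using ri_carrier[OF ri_rsum[OF B atom_ri[OF T(1)]] y(1)] .
  obtain b t where bt: "b \<in> B" "t \<in> T" "y = b \<oplus> t" using y(1) by (auto simp: mem_rsum)
  have c: "b \<in> carrier R" "t \<in> carrier R"
    using ri_carrier[OF B bt(1)] ri_carrier[OF atom_ri[OF T(1)] bt(2)] .
  have "t \<notin> I" using bt y(2) T(2) ri_add[OF B] by blast
  then have Tt: "T \<subseteq> prin t \<boxplus> I" using T(1) bt(2) by (auto simp: atom_def)
  have By: "ri (B \<boxplus> prin y)" "B \<subseteq> B \<boxplus> prin y" "y \<in> B \<boxplus> prin y"
    using ri_rsum[OF B ri_prin[OF yc]] rsum_prin[OF B yc] by auto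
  have "t \<in> B \<boxplus> prin y" using ri_cancel1[OF By(1), of b t] bt c By by blast
  then have "prin t \<boxplus> I \<subseteq> B \<boxplus> prin y"
    using rsum_least[OF By(1) prin_least[OF By(1)]] By(2) T(2) by blast
  then show ?thesis using rsum_least[OF By(1,2)] Tt by blast
qed

lemma fsum_ri: "fsum I F \<Longrightarrow> ri I \<Longrightarrow> ri F"
  by (induction rule: fsum.induct) (auto simp: ri_rsum atom_ri)

lemma fsum_supset: "fsum I F \<Longrightarrow> ri I \<Longrightarrow> I \<subseteq> F"
proof (induction rule: fsum.induct)
  case (fsum_step F T)
  then show ?case using rsum_upper1[of F T] fsum_ri[of I F] atom_ri by blast
qed simp

lemma fsum_rsum:
  assumes "ri I" "fsum I F" "fsum I G" shows "fsum I (F \<boxplus> G)"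
  using assms(3)
proof (induction rule: fsum.induct)
  case fsum_base
  then show ?case using assms fsum_supset[of I F] fsum_ri[of I F] by (simp add: rsum_absorb2)
next
  case (fsum_step G T)
  then have "F \<boxplus> G \<boxplus> T = F \<boxplus> (G \<boxplus> T)"
    using assms fsum_ri atom_ri by (intro rsum_assoc) blast+
  then show ?case using fsum_step fsum.fsum_step by metis
qed

lemma fsum_atom: "ri I \<Longrightarrow> atom I T \<Longrightarrow> fsum I T"
  using fsum.fsum_step[OF fsum.fsum_base, of I T] rsum_absorb1[of I T] by (simp add: atom_ri atom_supset)

text \<open>Either some multiple of \<open>w\<close> outside \<open>I\<close> already lies in
  \<open>F\<close>, and induction applies, or \<open>(wR + I) / I\<close> meets \<open>F / I\<close>
  trivially. In the latter case it embeds in \<open>(F + T) / F\<close>, a factor of the simple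
  module \<open>T / I\<close>, and is itself simple.\<close>

lemma fsum_contains_atom:
  assumes "ri I" "fsum I F" "w \<in> F" "w \<notin> I"
  shows "\<exists>r\<in>carrier R. atom I (prin (w \<otimes> r) \<boxplus> I)"
  using assms(2-)
proof (induction arbitrary: w rule: fsum.induct)
  case (fsum_step F T)
  have F: "ri F" and T: "ri T" "I \<subseteq> F"
    using fsum_step assms fsum_ri atom_ri fsum_supset by blast+
  have w: "w \<in> carrier R" using fsum_step.prems F T ri_rsum ri_carrier by blast
  show ?case
  proof (cases "\<exists>r\<in>carrier R. w \<otimes> r \<in> F \<and> w \<otimes> r \<notin> I")
    case True
    then obtain r where r: "r \<in> carrier R" "w \<otimes> r \<in> F" "w \<otimes> r \<notin> I" by blast
    then obtain t where t: "t \<in> carrier R" "atom I (prin (w \<otimes> r \<otimes> t) \<boxplus> I)"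
      using fsum_step.IH by blast
    then show ?thesis using r w by (metis m_assoc m_closed)
  next
    case False
    let ?W = "prin w \<boxplus> I"
    have W: "ri ?W" using w assms ri_prin ri_rsum by blast
    have WI: "I \<subseteq> ?W" "w \<in> ?W" using prin_rsum[OF \<open>ri I\<close> w] by auto
    have WF: "y \<in> I" if yW: "y \<in> ?W" "y \<in> F" for y
    proof -
      obtain r i where r: "r \<in> carrier R" "i \<in> I" "y = w \<otimes> r \<oplus> i" using yW
        by (auto simp: mem_rsum prin_def)
      then have "w \<otimes> r \<in> F" using that ri_cancel2[OF F, of i "w \<otimes> r"] T w by auto
      then have "w \<otimes> r \<in> I" using False r by blast
      then show ?thesis using r assms ri_add by blast
    qed
    have WFT: "?W \<subseteq> F \<boxplus> T"
      using fsum_step.prems F T rsum_upper1[of F T] by (intro rsum_least prin_least ri_rsum) auto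
    have "?W \<subseteq> prin y \<boxplus> I" if y: "y \<in> ?W" "y \<notin> I" for y
    proof -
      have yc: "y \<in> carrier R" using y W ri_carrier by blast
      have "y \<in> F \<boxplus> T" "y \<notin> F" using y WFT WF by blast+
      then have sub: "F \<boxplus> T \<subseteq> F \<boxplus> prin y" using atom_exchange[OF F fsum_step.hyps(2) T(2)] by blast
      show ?thesis
      proof
        fix z assume z: "z \<in> ?W"
        then have "z \<in> F \<boxplus> prin y" using sub WFT by blast
        then obtain g v where gv: "g \<in> F" "v \<in> prin y" "z = g \<oplus> v" by (auto simp: mem_rsum)
        have c: "g \<in> carrier R" "v \<in> carrier R" using gv F yc ri_prin ri_carrier by blast+
        have "v \<in> ?W" using gv y W prin_least by blast
        then have "g \<in> ?W" using z gv c ri_cancel2[OF W, of v g] by blast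
        then have "g \<in> I" using gv WF by blast
        then show "z \<in> prin y \<boxplus> I" using gv c by (metis a_comm rsumI)
      qed
    qed
    moreover have "?W \<noteq> I" using WI fsum_step.prems by blast
    ultimately have "atom I ?W" using W WI unfolding atom_def by blast
    then show ?thesis using w by (intro bexI[of _ \<one>]) auto
  qed
qed simp

text \<open>With \<open>C\<close> a complement of \<open>F\<close>, the modular law makes
  \<open>(F \<boxplus> T) \<inter> C\<close> a complement of \<open>F\<close> in
  \<open>F \<boxplus> T\<close>, hence simple over \<open>I\<close> unless
  \<open>T \<subseteq> F\<close>. Intersecting \<open>C\<close> with a complement of this simple
  piece gives the new complement.\<close>

lemma complement_fsum:
  assumes "ri I" and compl: "\<And>T. atom I T \<Longrightarrow> \<exists>C. ri C \<and> T \<boxplus> C = carrier R \<and> T \<inter> C = I"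
    and "fsum I F"
  shows "\<exists>C. ri C \<and> F \<boxplus> C = carrier R \<and> F \<inter> C = I"
  using assms(3)
proof (induction rule: fsum.induct)
  case fsum_base
  then show ?case using \<open>ri I\<close> rsum_absorb1[of I "carrier R"] ri_whole ri_carrier by blast
next
  case (fsum_step F T)
  then obtain C where C: "ri C" "F \<boxplus> C = carrier R" "F \<inter> C = I" by blast
  have F: "ri F" "ri T" "I \<subseteq> F" "I \<subseteq> T"
    using fsum_step.hyps assms(1) by (auto dest: fsum_ri fsum_supset simp: atom_def)
  show ?case
  proof (cases "T \<subseteq> F")
    case True
    then show ?thesis using C F by (metis rsum_absorb2)
  next
    case False
    let ?U = "(F \<boxplus> T) \<inter> C"
    have FT: "ri (F \<boxplus> T)" "F \<subseteq> F \<boxplus> T" "T \<subseteq> F \<boxplus> T" using F ri_rsum rsum_upper1 rsum_upper2 by blast+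
    have U: "ri ?U" using FT C ri_Int by blast
    have FU: "F \<boxplus> ?U = F \<boxplus> T"
      using modular[OF F(1) C(1) FT(1,2)] C(2) FT(1) ri_carrier by blast
    have "?U \<subseteq> prin y \<boxplus> I" if y: "y \<in> ?U" "y \<notin> I" for y
    proof
      fix z assume z: "z \<in> ?U"
      have yc: "y \<in> carrier R" using y U ri_carrier by blast
      have "y \<notin> F" using y C(3) by blast
      then have "z \<in> F \<boxplus> prin y" using z y atom_exchange[OF F(1) fsum_step.hyps(2) F(3), of y] by blast
      then obtain g v where gv: "g \<in> F" "v \<in> prin y" "z = g \<oplus> v" by (auto simp: mem_rsum)
      have c: "g \<in> carrier R" "v \<in> carrier R" using gv F yc ri_prin ri_carrier by blast+
      have "v \<in> C" using gv y C prin_least by blast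
      then have "g \<in> C" using z gv c ri_cancel2[OF C(1), of v g] by blast
      then have "g \<in> I" using gv C by blast
      then show "z \<in> prin y \<boxplus> I" using gv c by (metis a_comm rsumI)
    qed
    moreover have "I \<subseteq> ?U" using C FT F by blast
    moreover have "?U \<noteq> I"
    proof
      assume "?U = I"
      then have "F \<boxplus> T = F" using FU F \<open>ri I\<close> by (simp add: rsum_absorb2)
      then show False using FT False by blast
    qed
    ultimately have "atom I ?U" using U unfolding atom_def by blast
    then obtain C' where C': "ri C'" "?U \<boxplus> C' = carrier R" "?U \<inter> C' = I" using compl by blast
    let ?C = "C \<inter> C'"
    have rC: "ri ?C" using C C' ri_Int by blast
    have C2: "?U \<boxplus> ?C = C"
      using modular[OF U C'(1) C(1)] C'(2) C(1) ri_carrier by blast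
    have "F \<boxplus> T \<boxplus> ?C = F \<boxplus> (?U \<boxplus> ?C)"
      using FU rsum_assoc[OF F(1) U rC] by simp
    then have "F \<boxplus> T \<boxplus> ?C = carrier R" using C2 C by simp
    moreover have "(F \<boxplus> T) \<inter> ?C = I" using C'(3) by blast
    ultimately show ?thesis using rC by blast
  qed
qed

text \<open>A complement of \<open>P\<close> meets \<open>M\<close> only in \<open>I\<close> because
  \<open>P\<close> is essential in \<open>M\<close>; so the complemented \<open>P\<close> has no
  proper essential extension.\<close>

lemma ess_fsum_eq:
  assumes "ri I" and compl: "\<And>T. atom I T \<Longrightarrow> \<exists>C. ri C \<and> T \<boxplus> C = carrier R \<and> T \<inter> C = I"
    and P: "fsum I P" and e: "ess I P M" and M: "ri M"
  shows "M \<subseteq> P"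
proof
  fix x assume x: "x \<in> M"
  obtain C where C: "ri C" "P \<boxplus> C = carrier R" "P \<inter> C = I"
    using complement_fsum[OF assms(1) compl P] by blast
  have "x \<in> P \<boxplus> C" using C x M ri_carrier by blast
  then obtain p c where pc: "p \<in> P" "c \<in> C" "x = p \<oplus> c" by (auto simp: mem_rsum)
  have c: "c \<in> carrier R" using pc C ri_carrier by blast
  have PM: "P \<subseteq> M" using e ess_subset by blast
  have "c \<in> M" using ri_cancel1[OF M, of p c] pc c x PM by blast
  have "c \<in> I"
  proof (rule ccontr)
    assume "c \<notin> I"
    then obtain r where "r \<in> carrier R" "c \<otimes> r \<in> P" "c \<otimes> r \<notin> I" using essD[OF e \<open>c \<in> M\<close>] by blast
    then show False using C pc ri_mult by blast
  qed
  then show "x \<in> P" using pc C fsum_ri[OF P \<open>ri I\<close>] ri_add by blast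
qed

section \<open>Compactness against ascending sequences\<close>

lemma cptD: "cpt I K \<Longrightarrow> (\<And>n. ri (H n)) \<Longrightarrow> (\<And>n. I \<subseteq> H n) \<Longrightarrow> (\<And>n. H n \<subseteq> H (Suc n))
    \<Longrightarrow> K \<subseteq> (\<Union>n. H n) \<Longrightarrow> \<exists>n::nat. K \<subseteq> H n"
  unfolding cpt_def by blast

lemma cpt_refl: "cpt I I"
  by (auto simp: cpt_def)

text \<open>Intersecting an exhausting sequence with \<open>K\<close> moves it inside
  \<open>J\<close>, where it becomes stationary.\<close>

lemma cpt_noeth:
  assumes n: "noeth I J" and K: "ri K" "I \<subseteq> K" "K \<subseteq> J"
  shows "cpt I K"
  unfolding cpt_def
proof (intro allI impI)
  fix H :: "nat \<Rightarrow> 'a set"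
  assume H: "\<forall>n. ri (H n) \<and> I \<subseteq> H n \<and> H n \<subseteq> H (Suc n)" and sub: "K \<subseteq> (\<Union>n. H n)"
  then have "\<forall>n. ri (H n \<inter> K) \<and> I \<subseteq> H n \<inter> K \<and> H n \<inter> K \<subseteq> J \<and> H n \<inter> K \<subseteq> H (Suc n) \<inter> K"
    using K ri_Int by blast
  then obtain n where n: "\<forall>m\<ge>n. H m \<inter> K = H n \<inter> K"
    using n[unfolded noeth_def, THEN spec[of _ "\<lambda>n. H n \<inter> K"]] by blast
  have "K \<subseteq> H n"
  proof
    fix x assume "x \<in> K"
    then obtain m where "x \<in> H m" using sub by blast
    moreover have "H m \<subseteq> H (max m n)" by (rule lift_Suc_mono_le[of H]) (use H in auto)
    ultimately have "x \<in> H (max m n) \<inter> K" using \<open>x \<in> K\<close> by blast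
    moreover have "H (max m n) \<inter> K = H n \<inter> K" using n max.cobounded2 by blast
    ultimately show "x \<in> H n" by blast
  qed
  then show "\<exists>n. K \<subseteq> H n" ..
qed

text \<open>By exchange, one element \<open>x\<close> of \<open>K\<close> outside \<open>B\<close>
  generates \<open>K\<close> modulo \<open>K \<inter> B\<close>, so the later of two stages, one
  containing \<open>K \<inter> B\<close> and one containing \<open>x\<close>, contains
  \<open>K\<close>. The base \<open>I'\<close> of the simple module is kept apart from
  \<open>I\<close>: \<open>T\<close> may be simple over zero while compactness is measured over a
  larger right ideal.\<close>

lemma cpt_atom_extension:
  assumes K: "ri K" and B: "ri B" and T: "atom I' T" "I' \<subseteq> B"
    and sub: "K \<subseteq> B \<boxplus> T" and c: "cpt I (K \<inter> B)"
  shows "cpt I K"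
  unfolding cpt_def
proof (intro allI impI)
  fix H :: "nat \<Rightarrow> 'a set"
  assume H: "\<forall>n. ri (H n) \<and> I \<subseteq> H n \<and> H n \<subseteq> H (Suc n)" and KH: "K \<subseteq> (\<Union>n. H n)"
  have mono: "m \<le> n \<Longrightarrow> H m \<subseteq> H n" for m n by (rule lift_Suc_mono_le[of H]) (use H in auto)
  obtain n where n: "K \<inter> B \<subseteq> H n" using cptD[OF c, of H] H KH by blast
  show "\<exists>n. K \<subseteq> H n"
  proof (cases "K \<subseteq> B")
    case False
    then obtain x where x: "x \<in> K" "x \<notin> B" by blast
    obtain m where m: "x \<in> H m" using x KH by blast
    have xc: "x \<in> carrier R" using x K ri_carrier by blast
    have "x \<in> B \<boxplus> T" using x(1) sub by blast
    then have Kx: "K \<subseteq> B \<boxplus> prin x" using sub atom_exchange[OF B T _ x(2)] by blast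
    have "K \<subseteq> H (max m n)"
    proof
      fix z assume z: "z \<in> K"
      then obtain g v where gv: "g \<in> B" "v \<in> prin x" "z = g \<oplus> v" using Kx by (force simp: mem_rsum)
      have cc: "g \<in> carrier R" "v \<in> carrier R" using gv B xc ri_prin ri_carrier by blast+
      have "v \<in> K" using gv x K prin_least by blast
      then have "g \<in> K" using z gv cc ri_cancel2[OF K, of v g] by blast
      then have "g \<in> H (max m n)" using gv n mono[of n "max m n"] by auto
      moreover have "v \<in> H (max m n)" using gv prin_least[of "H (max m n)" x] H m mono[of m "max m n"] by auto
      ultimately show "z \<in> H (max m n)" using gv H ri_add by blast
    qed
    then show ?thesis ..
  qed (use n in auto)
qed

text \<open>A semisimple piece of finite length absorbs only finitely much: if \<open>K\<close>
  fails \<open>cpt I\<close> and lies in \<open>B \<boxplus> T\<close>, then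
  \<open>K \<inter> B\<close> fails it as well.\<close>

lemma cpt_fsum_extension:
  assumes B: "ri B" "ri I'" "I' \<subseteq> B" and T: "fsum I' T"
    and "ri K" "K \<subseteq> B \<boxplus> T" "cpt I (K \<inter> B)"
  shows "cpt I K"
  using T assms(5-)
proof (induction arbitrary: K rule: fsum.induct)
  case fsum_base
  then show ?case using B by (metis inf.absorb1 rsum_absorb2)
next
  case (fsum_step F T)
  have F: "ri F" "ri T" using fsum_step B fsum_ri atom_ri by blast+
  have BF: "ri (B \<boxplus> F)" "B \<subseteq> B \<boxplus> F" using F B ri_rsum rsum_upper1 by blast+
  let ?K = "K \<inter> (B \<boxplus> F)"
  have "?K \<inter> B = K \<inter> B" using BF by blast
  then have "cpt I ?K" using fsum_step.IH[of ?K] fsum_step.prems BF ri_Int by auto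
  moreover have "K \<subseteq> B \<boxplus> F \<boxplus> T" using fsum_step.prems rsum_assoc[OF B(1) F] by simp
  ultimately show ?case
    using cpt_atom_extension[OF fsum_step.prems(1) BF(1) fsum_step.hyps(2)] B BF by blast
qed

subsection \<open>Independent families\<close>

text \<open>\<open>s A / I\<close> is the direct sum of the nonzero modules \<open>s {i} / I\<close> over \<open>i \<in> A\<close>.\<close>

definition indep :: "'a set \<Rightarrow> (nat set \<Rightarrow> 'a set) \<Rightarrow> bool" where
  "indep I s \<longleftrightarrow> (\<forall>A. ri (s A)) \<and> s {} = I \<and> (\<forall>A B. s (A \<union> B) = s A \<boxplus> s B)
     \<and> (\<forall>A B. s (A \<inter> B) = s A \<inter> s B)
     \<and> (\<forall>A. \<forall>x\<in>s A. \<exists>F. finite F \<and> F \<subseteq> A \<and> x \<in> s F) \<and> (\<forall>i. s {i} \<noteq> I)"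

lemma indepD:
  assumes "indep I s"
  shows "ri (s A)" "s {} = I" "s (A \<union> B) = s A \<boxplus> s B" "s (A \<inter> B) = s A \<inter> s B"
    "x \<in> s A \<Longrightarrow> \<exists>F. finite F \<and> F \<subseteq> A \<and> x \<in> s F" "s {i} \<noteq> I"
  using assms unfolding indep_def by blast+

lemma indep_mono: "indep I s \<Longrightarrow> A \<subseteq> B \<Longrightarrow> s A \<subseteq> s B"
  by (metis indepD(4) inf.absorb_iff1 inf.cobounded2)

lemma indep_base: "indep I s \<Longrightarrow> I \<subseteq> s A"
  by (metis indepD(2) indep_mono empty_subsetI)

text \<open>The sums over initial segments of \<open>A\<close> exhaust \<open>s A\<close>, but the
  segment below \<open>n\<close> meets \<open>s {i}\<close> only in \<open>I\<close> for every
  \<open>i \<ge> n\<close>.\<close>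

lemma indep_not_cpt:
  assumes s: "indep I s" and A: "infinite A"
  shows "\<not> cpt I (s A)"
proof
  assume c: "cpt I (s A)"
  let ?H = "\<lambda>n. s (A \<inter> {..<n})"
  have "s A \<subseteq> (\<Union>n. ?H n)"
  proof
    fix x assume "x \<in> s A"
    then obtain F where F: "finite F" "F \<subseteq> A" "x \<in> s F" using indepD(5)[OF s] by blast
    then obtain n where "\<forall>i\<in>F. i < n" using finite_nat_set_iff_bounded by blast
    then have "F \<subseteq> A \<inter> {..<n}" using F by auto
    then show "x \<in> (\<Union>n. ?H n)" using indep_mono[OF s] F by blast
  qed
  moreover have "?H n \<subseteq> ?H (Suc n)" for n by (rule indep_mono[OF s]) auto
  ultimately obtain n where n: "s A \<subseteq> ?H n"
    using cptD[OF c, of ?H] indepD(1)[OF s] indep_base[OF s] by blast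
  obtain i where i: "i \<in> A" "i \<ge> n" using A by (meson finite_nat_set_iff_bounded not_le)
  then have "s {i} \<subseteq> ?H n" using indep_mono[OF s, of "{i}" A] n by blast
  then have "s {i} = s ({i} \<inter> (A \<inter> {..<n}))" using indepD(4)[OF s, of "{i}"] by blast
  also have "{i} \<inter> (A \<inter> {..<n}) = {}" using i by auto
  finally show False using indepD(2,6)[OF s] by metis
qed

lemma indep_fsum:
  assumes s: "indep I s" and a: "\<And>i. i \<in> F \<Longrightarrow> atom I (s {i})" and "finite F"
  shows "fsum I (s F)"
  using assms(3) a
proof (induction rule: finite_induct)
  case empty
  then show ?case using indepD(2)[OF s] fsum_base by simp
next
  case (insert i F)
  have "s (insert i F) = s F \<boxplus> s {i}" using indepD(3)[OF s, of F "{i}"] by simp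
  then show ?case using insert fsum_step by simp
qed

text \<open>The index set is cut into infinitely many infinite blocks \<open>K j\<close>.  Closures of the sums of
  initial blocks give an ascending chain \<open>G\<close>, whose union has a closure over \<open>E = s UNIV\<close> that is
  generated by one element \<open>x\<close>.  Each block is too large to avoid \<open>xR + I\<close>, and picking one atom in
  \<open>K j \<inter> (xR + I)\<close> for each \<open>j\<close> gives a submodule with a closure \<open>N\<close> in \<open>xR + I\<close>.  As \<open>N\<close> meets
  each \<open>G k\<close> in finitely many of these atoms, it cannot be principal.\<close>

lemma no_independent_atoms:
  assumes I: "ri I"
    and compl: "\<And>T. atom I T \<Longrightarrow> \<exists>C. ri C \<and> T \<boxplus> C = carrier R \<and> T \<inter> C = I"
    and alt: "\<And>E x. ri E \<Longrightarrow> I \<subseteq> E \<Longrightarrow> x \<in> carrier R \<Longrightarrow>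
      cs E (prin x \<boxplus> E) \<or> noeth E (prin x \<boxplus> E)"
    and s: "indep I s" and at: "\<And>i. atom I (s {i})"
  shows False
proof -
  \<comment> \<open>Block \<open>j\<close> consists of the codes of pairs with first coordinate
    \<open>j\<close>, so every block is infinite.\<close>
  let ?c = "\<lambda>i. fst (prod_decode i)"
  define K where "K j = s {i. ?c i = j}" for j
  define S where "S k = s {i. ?c i < k}" for k
  note ris = indepD(1)[OF s] and bs = indep_base[OF s] and mono = indep_mono[OF s]
  have riK: "ri (K j)" and riS: "ri (S j)" and IK: "I \<subseteq> K j" and IS: "I \<subseteq> S j" for j
    using ris bs by (auto simp: K_def S_def)
  have inf: "infinite {i. ?c i = j}" for j
  proof
    assume "finite {i. ?c i = j}"
    moreover have "range (\<lambda>n. prod_encode (j, n)) \<subseteq> {i. ?c i = j}" by auto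
    ultimately have "finite (range (\<lambda>n. prod_encode (j, n)))" by (rule rev_finite_subset)
    then show False by (simp add: finite_image_iff inj_on_def)
  qed
  have ncK: "\<not> cpt I (K j)" for j using indep_not_cpt[OF s inf] by (simp add: K_def)
  have SK: "S k \<inter> K k = I" for k
  proof -
    have "{i. ?c i < k} \<inter> {i. ?c i = k} = {}" by auto
    then show ?thesis unfolding S_def K_def using indepD(2,4)[OF s] by metis
  qed
  have SSuc: "S (Suc k) = S k \<boxplus> K k" for k
  proof -
    have "{i. ?c i < Suc k} = {i. ?c i < k} \<union> {i. ?c i = k}" by auto
    then show ?thesis unfolding S_def K_def using indepD(3)[OF s] by metis
  qed
  have Smono: "j \<le> k \<Longrightarrow> S j \<subseteq> S k" for j k unfolding S_def by (rule mono) auto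
  have top: "prin \<one> \<boxplus> E = carrier R" if "ri E" for E
    unfolding prin_one using that ri_carrier by (intro rsum_absorb2 ri_whole) blast+
  \<comment> \<open>A block fails \<open>cpt I\<close>, so \<open>R / I\<close> is not noetherian;
    what remains is CS.\<close>
  have "\<not> noeth I (carrier R)"
    using cpt_noeth[OF _ riK IK] ncK riK ri_carrier by blast
  then have csR: "cs I (carrier R)" using alt[OF I order_refl one_closed] top I by auto
  \<comment> \<open>The closure of \<open>K\<close> is a summand of the cyclic module
    \<open>R / I\<close> and therefore generated by one element modulo \<open>I\<close>.\<close>
  have "\<exists>D. ri D \<and> K \<subseteq> D \<and> ess I K D \<and> (\<exists>d\<in>carrier R. D = prin d \<boxplus> I)" if K: "ri K" "I \<subseteq> K" for K
  proof -
    have "K \<subseteq> carrier R" using K ri_carrier by blast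
    then obtain D D' where D: "ri D" "ri D'" "D \<boxplus> D' = carrier R" "D \<inter> D' = I" "ess I K D"
      using csR K unfolding cs_def by blast
    have "D \<boxplus> D' = prin \<one> \<boxplus> I" using D top I by simp
    then obtain d where d: "d \<in> D" "D = prin d \<boxplus> I" using summand_prin[OF I D(1,2) one_closed _ D(4)] by blast
    have "d \<in> carrier R" using d(1) D(1) ri_carrier by blast
    then show ?thesis using D(1,5) ess_subset[OF D(5)] d(2) by blast
  qed
  then obtain cl where cl: "\<And>K. ri K \<Longrightarrow> I \<subseteq> K \<Longrightarrow> ri (cl K) \<and> K \<subseteq> cl K \<and> ess I K (cl K)
      \<and> (\<exists>d\<in>carrier R. cl K = prin d \<boxplus> I)" by metis
  \<comment> \<open>Closures are chosen, not canonical. Closing the preceding closure together with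
    a new block secures an ascending chain.\<close>
  define G where "G = rec_nat I (\<lambda>k g. cl (g \<boxplus> K k))"
  have G0: "G 0 = I" and GSuc: "G (Suc k) = cl (G k \<boxplus> K k)" for k by (auto simp: G_def)
  have G: "ri (G k) \<and> I \<subseteq> G k" for k
  proof (induction k)
    case (Suc k)
    then show ?case unfolding GSuc
      using cl[of "G k \<boxplus> K k"] rsum_upper1[of "G k" "K k"] riK[of k] ri_rsum by blast
  qed (use I G0 in auto)
  have Gcl: "ri (G k \<boxplus> K k)" "I \<subseteq> G k \<boxplus> K k" "G k \<subseteq> G k \<boxplus> K k" "K k \<subseteq> G k \<boxplus> K k" for k
    using G[of k] rsum_upper1[of "G k" "K k"] rsum_upper2[of "G k" "K k"] riK[of k] ri_rsum by auto
  have Gmono: "G k \<subseteq> G (Suc k)" and KG: "K k \<subseteq> G (Suc k)" for k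
    unfolding GSuc using cl[OF Gcl(1,2)] Gcl(3,4) by blast+
  have Gp: "\<exists>d\<in>carrier R. G k = prin d \<boxplus> I" for k
  proof (cases k)
    case 0
    have "prin \<zero> \<boxplus> I = I" using I ri_zero by (intro rsum_absorb1 ri_prin prin_least) auto
    then show ?thesis using 0 G0 by force
  next
    case (Suc j)
    then show ?thesis using cl[OF Gcl(1,2)] by (simp add: GSuc)
  qed
  have SG: "ess I (S k) (G k)" for k
  proof (induction k)
    case 0
    have "S 0 = I" using indepD(2)[OF s] by (simp add: S_def)
    then show ?case using ess_refl I G0 by simp
  next
    case (Suc k)
    \<comment> \<open>Independence of the next block passes from \<open>S k\<close> to its essential
      extension \<open>G k\<close>.\<close>
    have "G k \<inter> K k \<subseteq> I"
    proof (rule ccontr)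
      assume "\<not> G k \<inter> K k \<subseteq> I"
      then obtain x where x: "x \<in> G k" "x \<in> K k" "x \<notin> I" by blast
      then obtain r where r: "r \<in> carrier R" "x \<otimes> r \<in> S k" "x \<otimes> r \<notin> I" using essD[OF Suc] by blast
      then show False using SK ri_mult[OF riK x(2)] by blast
    qed
    then have "ess I (S k \<boxplus> K k) (G k \<boxplus> K k)"
      using ess_rsum[OF I _ riK riS riK Suc ess_refl[OF riK] _ IS IK] G by blast
    then show ?case
      unfolding SSuc GSuc using ess_trans cl[OF Gcl(1,2)] by blast
  qed
  define E where "E = s UNIV"
  have E: "ri E" "I \<subseteq> E" using ris bs by (auto simp: E_def)
  define Y where "Y = (\<Union>k. G k)"
  have Y: "ri Y" unfolding Y_def using ri_chain_Union[of G] G Gmono by blast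
  have fin_S: "\<exists>k. s F \<subseteq> S k" if fin: "finite F" for F
  proof -
    obtain k where "\<forall>i\<in>F. ?c i < k" using finite_nat_set_iff_bounded[of "?c ` F"] fin by auto
    then have "s F \<subseteq> S k" unfolding S_def by (intro mono) auto
    then show ?thesis ..
  qed
  have EY: "E \<subseteq> Y"
  proof
    fix x assume "x \<in> E"
    then obtain F where "finite F" "x \<in> s F" using indepD(5)[OF s] unfolding E_def by blast
    then obtain k where "x \<in> S k" using fin_S by blast
    then show "x \<in> Y" unfolding Y_def using ess_subset[OF SG] by blast
  qed
  have SE: "S k \<subseteq> E" for k unfolding S_def E_def by (rule mono) auto
  \<comment> \<open>If \<open>R / E\<close> is noetherian, \<open>Y\<close> equals some
    \<open>G k \<boxplus> E\<close> and inherits its generator; if it is CS, a closure of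
    \<open>Y\<close> over \<open>E\<close> is a cyclic summand. Either way \<open>Y / E\<close> is
    essential in a cyclic module.\<close>
  obtain x where x: "x \<in> carrier R" "ess E Y (prin x \<boxplus> E)"
  proof (cases "noeth E (carrier R)")
    case True
    moreover have "Y \<subseteq> carrier R" using Y ri_carrier by blast
    ultimately have cE: "cpt E Y" by (rule cpt_noeth[OF _ Y EY])
    have GE: "ri (G k \<boxplus> E)" "E \<subseteq> G k \<boxplus> E" "G k \<boxplus> E \<subseteq> G (Suc k) \<boxplus> E" "G k \<subseteq> G k \<boxplus> E" for k
      using G[of k] E(1) ri_rsum[of "G k" E] rsum_upper1[of "G k" E] rsum_upper2[of "G k" E]
        rsum_mono[OF Gmono order_refl, of k E] by simp_all
    have "Y \<subseteq> (\<Union>k. G k \<boxplus> E)" unfolding Y_def using GE(4) by blast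
    with cE GE(1-3) have "\<exists>k. Y \<subseteq> G k \<boxplus> E" by (rule cptD)
    then obtain k where k: "Y \<subseteq> G k \<boxplus> E" ..
    obtain d where d: "d \<in> carrier R" "G k = prin d \<boxplus> I" using Gp by blast
    have "prin d \<boxplus> I \<boxplus> E = prin d \<boxplus> E"
      using d E I by (simp add: rsum_assoc ri_prin rsum_absorb1)
    moreover have "G k \<boxplus> E \<subseteq> Y" using rsum_least[OF Y] EY unfolding Y_def by blast
    ultimately have "prin d \<boxplus> E = Y" using k d by auto
    then show ?thesis using that d ess_refl[OF Y] by auto
  next
    case False
    then have "cs E (carrier R)" using alt[OF E one_closed] top E by auto
    then obtain D D' where D: "ri D" "ri D'" "D \<boxplus> D' = carrier R" "D \<inter> D' = E" "ess E Y D"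
      using Y EY ri_carrier unfolding cs_def by blast
    have "D \<boxplus> D' = prin \<one> \<boxplus> E" using D top E by simp
    then obtain d where "d \<in> D" "D = prin d \<boxplus> E" using summand_prin[OF E(1) D(1,2) one_closed _ D(4)] by blast
    then show ?thesis using that D ri_carrier by blast
  qed
  define B where "B = prin x \<boxplus> I"
  have B: "ri B" "I \<subseteq> B" "x \<in> B" using x prin_rsum[OF I] ri_rsum ri_prin I by (auto simp: B_def)
  have BX: "B \<subseteq> prin x \<boxplus> E" unfolding B_def using E by (intro rsum_mono) auto
  \<comment> \<open>The generator of \<open>G (Suc j)\<close> lies in \<open>xR + E\<close>, and its
    \<open>E\<close>-part involves finitely many indices. So \<open>K j\<close> is contained in
    \<open>B\<close> plus a finite sum of simples and, failing \<open>cpt I\<close>, must meet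
    \<open>B\<close> outside \<open>I\<close>.\<close>
  have "\<exists>a. atom I a \<and> a \<subseteq> K j \<and> a \<subseteq> B" for j
  proof -
    obtain g where g: "g \<in> carrier R" "G (Suc j) = prin g \<boxplus> I" using Gp by blast
    have "g \<in> G (Suc j)" using g prin_rsum[OF I] by auto
    then have "g \<in> prin x \<boxplus> E" using ess_subset[OF x(2)] unfolding Y_def by blast
    then obtain u e where ue: "u \<in> prin x" "e \<in> E" "g = u \<oplus> e" by (auto simp: mem_rsum)
    then obtain F where F: "finite F" "e \<in> s F" using indepD(5)[OF s] unfolding E_def by blast
    have BF: "ri (B \<boxplus> s F)" "B \<subseteq> B \<boxplus> s F" "s F \<subseteq> B \<boxplus> s F"
      using B ris ri_rsum rsum_upper1[OF B(1) ris] rsum_upper2[OF B(1) ris] by auto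
    have "u \<in> B" using ue prin_least[OF B(1,3)] by blast
    then have "g \<in> B \<boxplus> s F" using ue F rsumI by auto
    then have "G (Suc j) \<subseteq> B \<boxplus> s F"
      using g BF B by (auto intro!: rsum_least prin_least del: subsetI)
    then have "K j \<subseteq> B \<boxplus> s F" using KG by blast
    then have "\<not> cpt I (K j \<inter> B)"
      using cpt_fsum_extension[OF B(1) I B(2) indep_fsum[OF s at F(1)] riK] ncK by blast
    then have "K j \<inter> B \<noteq> I" using cpt_refl by metis
    then obtain w where w: "w \<in> K j" "w \<in> B" "w \<notin> I" using IK[of j] B by blast
    then obtain F' where "finite F'" "w \<in> s F'" using indepD(5)[OF s] unfolding K_def by blast
    then obtain r where r: "r \<in> carrier R" "atom I (prin (w \<otimes> r) \<boxplus> I)"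
      using fsum_contains_atom[OF I indep_fsum[OF s at]] w by blast
    moreover have "prin (w \<otimes> r) \<boxplus> I \<subseteq> K j"
      using w r riK IK by (intro rsum_least prin_least ri_mult) auto
    moreover have "prin (w \<otimes> r) \<boxplus> I \<subseteq> B"
      using w r B by (intro rsum_least prin_least ri_mult) auto
    ultimately show ?thesis by blast
  qed
  then obtain a where a: "\<And>j. atom I (a j)" "\<And>j. a j \<subseteq> K j" "\<And>j. a j \<subseteq> B" by metis
  define P where "P = rec_nat I (\<lambda>k p. p \<boxplus> a k)"
  have P0: "P 0 = I" and PSuc: "P (Suc k) = P k \<boxplus> a k" for k by (auto simp: P_def)
  have fP: "fsum I (P k)" for k
    by (induction k) (use P0 PSuc fsum_base fsum_step a in auto)
  have riP: "ri (P k)" and IP: "I \<subseteq> P k" for k using fP fsum_ri I fsum_supset by blast+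
  have PP: "P k \<subseteq> P (Suc k)" "a k \<subseteq> P (Suc k)" for k
    unfolding PSuc using rsum_upper1[OF riP atom_ri[OF a(1)]] rsum_upper2[OF riP atom_ri[OF a(1)]]
    by auto
  have PS: "P k \<subseteq> S k" for k
  proof (induction k)
    case (Suc k)
    then show ?case unfolding PSuc SSuc by (intro rsum_mono a)
  qed (use P0 IS in auto)
  have PB: "P k \<subseteq> B" for k
    by (induction k) (use P0 PSuc B a in \<open>auto intro!: rsum_least del: subsetI\<close>)
  have aP: "\<not> a k \<subseteq> P k" for k
  proof
    assume "a k \<subseteq> P k"
    then have "a k \<subseteq> I" using PS[of k] a(2)[of k] SK[of k] by blast
    then show False using a(1)[of k] by (auto simp: atom_def)
  qed
  define PU where "PU = (\<Union>k. P k)"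
  have PU: "ri PU" unfolding PU_def by (intro ri_chain_Union riP PP)
  have IPU: "I \<subseteq> PU" "PU \<subseteq> B" unfolding PU_def using IP[of 0] PB by blast+
  \<comment> \<open>The strictly ascending \<open>P n\<close> leave only CS for
    \<open>B / I\<close>; this provides the closure \<open>N\<close> of \<open>PU\<close>.\<close>
  have "\<not> noeth I B"
  proof
    assume "noeth I B"
    then have c: "cpt I PU" by (rule cpt_noeth[OF _ PU IPU])
    have "\<exists>n. PU \<subseteq> P n" by (rule cptD[where H = P, OF c riP IP PP(1)]) (simp add: PU_def)
    then obtain n where "PU \<subseteq> P n" ..
    then show False using aP[of n] PP(2)[of n] unfolding PU_def by blast
  qed
  then have "cs I B" using alt[OF I order_refl x(1)] by (simp add: B_def)
  then obtain N N' where N: "ri N" "ri N'" "N \<boxplus> N' = B" "N \<inter> N' = I" "ess I PU N"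
    using PU IPU unfolding cs_def by blast
  obtain w where w: "w \<in> N" "N = prin w \<boxplus> I"
    using summand_prin[OF I N(1,2) x(1) N(3)[unfolded B_def] N(4)] by blast
  have NB: "N \<subseteq> B" using N rsum_upper1 by blast
  \<comment> \<open>Simple pieces chosen in block \<open>k\<close> or later contribute nothing
    inside the first \<open>k\<close> blocks.\<close>
  have PmS: "P m \<inter> S k \<subseteq> P k" for m k
  proof (induction m)
    case 0
    then show ?case using P0 IP by blast
  next
    case (Suc m)
    show ?case
    proof (cases "Suc m \<le> k")
      case True
      then have "P (Suc m) \<subseteq> P k" by (rule lift_Suc_mono_le[of P, rotated]) (rule PP)
      then show ?thesis by blast
    next
      case False
      then have Skm: "S k \<subseteq> S m" by (intro Smono) auto
      show ?thesis
      proof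
        fix z assume z: "z \<in> P (Suc m) \<inter> S k"
        then obtain p b where pb: "p \<in> P m" "b \<in> a m" "z = p \<oplus> b"
          unfolding PSuc by (auto simp: mem_rsum)
        have "b \<in> K m" using pb a by blast
        have "b \<in> S m" using ri_cancel1[OF riS, of p m b] pb PS[of m] z Skm
            ri_carrier[OF riK \<open>b \<in> K m\<close>] by blast
        then have "b \<in> P m" using \<open>b \<in> K m\<close> SK[of m] IP[of m] by blast
        then have "z \<in> P m" using pb riP ri_add by blast
        then show "z \<in> P k" using z Suc by blast
      qed
    qed
  qed
  \<comment> \<open>\<open>PU \<inter> S k\<close> is essential in \<open>N \<inter> G k\<close> and
    lies in \<open>P k\<close>, which is complemented and so admits no proper essential
    extension.\<close>
  have NG: "N \<inter> G k \<subseteq> P k" for k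
  proof -
    have "ess I (PU \<inter> S k) (N \<inter> G k)"
      using ess_Int[OF riS N(1) _ N(5) SG PU] G by blast
    moreover have "PU \<inter> S k \<subseteq> P k" using PmS unfolding PU_def by blast
    moreover have "P k \<subseteq> N \<inter> G k"
      using PS[of k] ess_subset[OF SG] ess_subset[OF N(5)] unfolding PU_def by blast
    ultimately have "ess I (P k) (N \<inter> G k)" using ess_mono by blast
    then show ?thesis using ess_fsum_eq[OF I compl fP] ri_Int N(1) G by blast
  qed
  \<comment> \<open>An element of \<open>N\<close> outside \<open>E\<close> would have a multiple in
    \<open>Y\<close> outside \<open>E\<close>, but that multiple lies in
    \<open>N \<inter> G k \<subseteq> P k \<subseteq> E\<close> for some \<open>k\<close>.\<close>
  have "N \<subseteq> E"
  proof (rule ccontr)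
    assume "\<not> N \<subseteq> E"
    then obtain y where y: "y \<in> N" "y \<notin> E" by blast
    then obtain r where r: "r \<in> carrier R" "y \<otimes> r \<in> Y" "y \<otimes> r \<notin> E"
      using essD[OF x(2), of y] NB BX by blast
    then obtain k where "y \<otimes> r \<in> G k" unfolding Y_def by blast
    then have "y \<otimes> r \<in> P k" using NG ri_mult[OF N(1) y(1) r(1)] by blast
    then show False using r PS SE by blast
  qed
  \<comment> \<open>As \<open>N \<subseteq> E \<subseteq> Y\<close>, the single generator of
    \<open>N\<close> sits in one \<open>G k\<close>. Then \<open>N \<subseteq> P k\<close>, although
    \<open>N\<close> contains every \<open>a j\<close>.\<close>
  then obtain k where "w \<in> G k" using w EY unfolding Y_def by blast
  then have "w \<in> P k" using NG w by blast
  then have "N \<subseteq> P k" using w(2) riP IP by (auto intro!: rsum_least prin_least del: subsetI)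
  then have "PU \<subseteq> P k" using ess_subset[OF N(5)] by blast
  then show False using aP[of k] PP(2)[of k] unfolding PU_def by blast
qed

section \<open>Sums of sequences of right ideals\<close>

primrec psum :: "(nat \<Rightarrow> 'a set) \<Rightarrow> nat \<Rightarrow> 'a set" where
  "psum Q 0 = {\<zero>}"
| "psum Q (Suc m) = psum Q m \<boxplus> Q m"

definition dsum :: "(nat \<Rightarrow> 'a set) \<Rightarrow> 'a set" where
  "dsum Q = (\<Union>m. psum Q m)"

lemma psum_ri: "(\<And>i. ri (Q i)) \<Longrightarrow> ri (psum Q m)"
  by (induction m) (auto simp: ri_null ri_rsum)

lemma psum_Suc_mono: "(\<And>i. ri (Q i)) \<Longrightarrow> psum Q m \<subseteq> psum Q (Suc m)"
  by (simp add: rsum_upper1 psum_ri)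

lemma psum_mono: "(\<And>i. ri (Q i)) \<Longrightarrow> m \<le> n \<Longrightarrow> psum Q m \<subseteq> psum Q n"
  by (rule lift_Suc_mono_le[of "psum Q"]) (use psum_Suc_mono in blast)+

lemma psum_le: "(\<And>i. Q i \<subseteq> Q' i) \<Longrightarrow> psum Q m \<subseteq> psum Q' m"
  by (induction m) (auto intro!: rsum_mono del: subsetI)

lemma psum_cong: "(\<And>i. i < m \<Longrightarrow> Q i = Q' i) \<Longrightarrow> psum Q m = psum Q' m"
  by (induction m) auto

lemma psum_component: "(\<And>i. ri (Q i)) \<Longrightarrow> i < m \<Longrightarrow> Q i \<subseteq> psum Q m"
  using rsum_upper2[OF psum_ri[of Q i]] psum_mono[of Q "Suc i" m] by (metis Suc_leI psum.simps(2) subset_trans)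

lemma psum_least: "ri C \<Longrightarrow> (\<And>i. Q i \<subseteq> C) \<Longrightarrow> psum Q m \<subseteq> C"
  by (induction m) (auto intro!: rsum_least ri_zero del: subsetI)

lemma dsum_ri: "(\<And>i. ri (Q i)) \<Longrightarrow> ri (dsum Q)"
  unfolding dsum_def by (intro ri_chain_Union psum_ri psum_Suc_mono)

lemma dsum_le: "(\<And>i. Q i \<subseteq> Q' i) \<Longrightarrow> dsum Q \<subseteq> dsum Q'"
  unfolding dsum_def using psum_le[of Q Q'] by blast

lemma dsum_component: "(\<And>i. ri (Q i)) \<Longrightarrow> Q i \<subseteq> dsum Q"
  unfolding dsum_def using psum_component[of Q i "Suc i"] by blast

lemma dsum_least: "ri C \<Longrightarrow> (\<And>i. Q i \<subseteq> C) \<Longrightarrow> dsum Q \<subseteq> C"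
  unfolding dsum_def using psum_least[of C Q] by blast

lemma dsum_rsum:
  assumes "\<And>i. ri (Q i)" "\<And>i. ri (Q' i)"
  shows "dsum (\<lambda>i. Q i \<boxplus> Q' i) = dsum Q \<boxplus> dsum Q'"
proof (intro subset_antisym rsum_least dsum_le)
  have r: "ri (Q i \<boxplus> Q' i)" for i using assms ri_rsum by blast
  show "ri (dsum (\<lambda>i. Q i \<boxplus> Q' i))" using r by (rule dsum_ri)
  show "Q i \<subseteq> Q i \<boxplus> Q' i" "Q' i \<subseteq> Q i \<boxplus> Q' i" for i
    using assms by (simp_all add: rsum_upper1 rsum_upper2)
  show "dsum (\<lambda>i. Q i \<boxplus> Q' i) \<subseteq> dsum Q \<boxplus> dsum Q'"
    using assms by (intro dsum_least ri_rsum dsum_ri rsum_mono dsum_component)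
qed

text \<open>A descending sequence \<open>W\<close> with \<open>W (n + 1)\<close> avoiding \<open>P n \<subseteq> W n\<close> witnesses that the \<open>P n\<close> are
  independent.\<close>

definition peeled :: "(nat \<Rightarrow> 'a set) \<Rightarrow> (nat \<Rightarrow> 'a set) \<Rightarrow> bool" where
  "peeled P W \<longleftrightarrow> (\<forall>n. ri (P n) \<and> ri (W n) \<and> P n \<subseteq> W n \<and> W (Suc n) \<subseteq> W n \<and> P n \<inter> W (Suc n) = {\<zero>})"

lemma peeledD:
  assumes "peeled P W"
  shows "ri (P n)" "ri (W n)" "P n \<subseteq> W n" "W (Suc n) \<subseteq> W n" "P n \<inter> W (Suc n) = {\<zero>}"
  using assms unfolding peeled_def by blast+

text \<open>In \<open>x = a + b\<close> the tail \<open>W m\<close> contains \<open>x\<close> and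
  \<open>b\<close>, hence \<open>a\<close>, which vanishes by induction; what is left lies in
  \<open>P m \<inter> W (Suc m)\<close>.\<close>

lemma peeled_psum_Int:
  assumes "peeled P W" shows "psum P m \<inter> W m \<subseteq> {\<zero>}"
proof (induction m)
  case (Suc m)
  note p = peeledD[OF assms]
  have S: "ri (psum P m)" using p(1) by (rule psum_ri)
  show ?case
  proof
    fix x assume x: "x \<in> psum P (Suc m) \<inter> W (Suc m)"
    then obtain a b where ab: "a \<in> psum P m" "b \<in> P m" "x = a \<oplus> b" by (auto simp: mem_rsum)
    have c: "a \<in> carrier R" "b \<in> carrier R" using ab p(1) S ri_carrier by blast+
    have "a \<in> W m" using ri_cancel2[OF p(2), of b m a] ab c x p(3)[of m] p(4)[of m] by blast
    then have "a = \<zero>" using ab Suc by blast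
    then show "x \<in> {\<zero>}" using ab c x p(5)[of m] by auto
  qed
qed simp

text \<open>Components are unique: comparing two decompositions of one element gives
  \<open>a - a' = b' - b\<close>, an element of \<open>psum P m \<inter> W m\<close>.\<close>

lemma psum_Int:
  assumes pe: "peeled P W" and Q: "\<And>i. ri (Q i)" "\<And>i. Q i \<subseteq> P i"
    and Q': "\<And>i. ri (Q' i)" "\<And>i. Q' i \<subseteq> P i"
  shows "psum Q m \<inter> psum Q' m \<subseteq> psum (\<lambda>i. Q i \<inter> Q' i) m"
proof (induction m)
  case (Suc m)
  note p = peeledD[OF pe]
  have S: "ri (psum P m)" using p(1) by (rule psum_ri)
  have SQ: "psum Q m \<subseteq> psum P m" "psum Q' m \<subseteq> psum P m" using Q(2) Q'(2) psum_le by blast+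
  show ?case
  proof
    fix x assume x: "x \<in> psum Q (Suc m) \<inter> psum Q' (Suc m)"
    then obtain a b a' b' where ab: "a \<in> psum Q m" "b \<in> Q m" "x = a \<oplus> b"
      "a' \<in> psum Q' m" "b' \<in> Q' m" "x = a' \<oplus> b'" by (auto simp: mem_rsum)
    have P: "a \<in> psum P m" "a' \<in> psum P m" "b \<in> P m" "b' \<in> P m" using ab SQ Q(2)[of m] Q'(2)[of m] by blast+
    then have c: "a \<in> carrier R" "b \<in> carrier R" "a' \<in> carrier R" "b' \<in> carrier R"
      using p(1) S ri_carrier by blast+
    have "a \<ominus> a' = b' \<ominus> b"
    proof -
      have "a = (a' \<oplus> b') \<ominus> b" using ab c by (metis minus_add_cancel2)
      then have "a = a' \<oplus> (b' \<ominus> b)" using c by (simp add: a_minus_def a_assoc)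
      then show ?thesis using c minus_add_cancel by simp
    qed
    moreover have "a \<ominus> a' \<in> psum P m" using P S ri_minus by blast
    moreover have "b' \<ominus> b \<in> W m" using P p(1)[of m] p(3)[of m] ri_minus by blast
    ultimately have "a \<ominus> a' = \<zero>" "b' \<ominus> b = \<zero>" using peeled_psum_Int[OF pe] by auto
    then have "a = a'" "b' = b" using c by (metis add_minus_cancel2 l_zero)+
    then have "a \<in> psum (\<lambda>i. Q i \<inter> Q' i) m" "b \<in> Q m \<inter> Q' m" using ab Suc by auto
    then show "x \<in> psum (\<lambda>i. Q i \<inter> Q' i) (Suc m)" using ab(3) by (simp add: rsumI)
  qed
qed simp

lemma dsum_Int:
  assumes pe: "peeled P W" and Q: "\<And>i. ri (Q i)" "\<And>i. Q i \<subseteq> P i"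
    and Q': "\<And>i. ri (Q' i)" "\<And>i. Q' i \<subseteq> P i"
  shows "dsum (\<lambda>i. Q i \<inter> Q' i) = dsum Q \<inter> dsum Q'"
proof (intro subset_antisym Int_greatest dsum_le)
  show "dsum Q \<inter> dsum Q' \<subseteq> dsum (\<lambda>i. Q i \<inter> Q' i)"
  proof
    fix x assume "x \<in> dsum Q \<inter> dsum Q'"
    then obtain m n where "x \<in> psum Q m" "x \<in> psum Q' n" by (auto simp: dsum_def)
    then have "x \<in> psum Q (max m n) \<inter> psum Q' (max m n)"
      using psum_mono[of Q m "max m n"] psum_mono[of Q' n "max m n"] Q Q' by auto
    then show "x \<in> dsum (\<lambda>i. Q i \<inter> Q' i)"
      using psum_Int[OF assms] unfolding dsum_def by blast
  qed
qed auto

lemma dsum_single: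
  assumes "ri T" shows "dsum (\<lambda>j. if j = i then T else {\<zero>}) = T" (is "dsum ?Z = T")
proof
  have Z: "ri (?Z j)" for j using assms ri_null by simp
  show "dsum ?Z \<subseteq> T" using assms ri_zero by (intro dsum_least) auto
  show "T \<subseteq> dsum ?Z" using dsum_component[of ?Z i] Z by simp
qed

text \<open>Since \<open>L\<close> avoids \<open>D\<close>, the \<open>D\<close>-component of an
  element of \<open>L \<boxplus> D\<close> is unique, so adding \<open>L\<close> preserves
  intersections inside \<open>D\<close>.\<close>

lemma rsum_Int_complement:
  assumes "ri L" "ri D" "ri A" "ri B" "A \<subseteq> D" "B \<subseteq> D" "L \<inter> D \<subseteq> {\<zero>}"
  shows "L \<boxplus> (A \<inter> B) = (L \<boxplus> A) \<inter> (L \<boxplus> B)"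
proof
  show "L \<boxplus> (A \<inter> B) \<subseteq> (L \<boxplus> A) \<inter> (L \<boxplus> B)" by (intro Int_greatest rsum_mono) auto
  show "(L \<boxplus> A) \<inter> (L \<boxplus> B) \<subseteq> L \<boxplus> (A \<inter> B)"
  proof
    fix x assume "x \<in> (L \<boxplus> A) \<inter> (L \<boxplus> B)"
    then obtain l a l' b where x: "l \<in> L" "a \<in> A" "x = l \<oplus> a" "l' \<in> L" "b \<in> B" "x = l' \<oplus> b"
      by (auto simp: mem_rsum)
    then have c: "l \<in> carrier R" "a \<in> carrier R" "l' \<in> carrier R" "b \<in> carrier R"
      using assms ri_carrier by blast+
    have "a \<ominus> b = l' \<ominus> l"
    proof -
      have "a = (l' \<oplus> b) \<ominus> l" using x c by (metis minus_add_cancel)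
      then have "a = b \<oplus> (l' \<ominus> l)" using c by (simp add: a_minus_def a_ac)
      then show ?thesis using c minus_add_cancel by simp
    qed
    moreover have "a \<ominus> b \<in> D" "l' \<ominus> l \<in> L" using x assms ri_minus by blast+
    ultimately have "a \<ominus> b = \<zero>" using assms by auto
    then have "a = b" using c by (metis add_minus_cancel2 l_zero)
    then show "x \<in> L \<boxplus> (A \<inter> B)" using x by (auto intro: rsumI)
  qed
qed

text \<open>Modulo the base, \<open>s A\<close> is the direct sum of the modules
  \<open>P i / V i\<close> over \<open>i \<in> A\<close>. Putting \<open>V i\<close> at the other
  indices lets unions and intersections be computed componentwise. The summand \<open>L\<close> is
  present so that the base can be made essential.\<close>

lemma indep_dsum:
  assumes pe: "peeled P W" and V: "\<And>i. ri (V i)" "\<And>i. V i \<subseteq> P i" "\<And>i. V i \<noteq> P i"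
    and L: "ri L" "L \<inter> dsum P \<subseteq> {\<zero>}"
  shows "indep (L \<boxplus> dsum V) (\<lambda>A. L \<boxplus> dsum (\<lambda>i. if i \<in> A then P i else V i))" (is "indep ?I ?s")
    and "L \<boxplus> dsum (\<lambda>j. if j \<in> {i} then P j else V j) = P i \<boxplus> (L \<boxplus> dsum V)"
proof -
  let ?Q = "\<lambda>A i. if i \<in> A then P i else V i"
  note p = peeledD[OF pe]
  have riQ: "ri (?Q A i)" and QP: "?Q A i \<subseteq> P i" for A i using p V by auto
  have riD: "ri (dsum (?Q A))" for A using riQ by (rule dsum_ri)
  have riV: "ri (dsum V)" and riP: "ri (dsum P)" using V p by (simp_all add: dsum_ri)
  have s0: "?s {} = ?I" by simp
  have un: "?s (A \<union> B) = ?s A \<boxplus> ?s B" for A B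
  proof -
    have "?Q (A \<union> B) i = ?Q A i \<boxplus> ?Q B i" for i
      using p V by (auto simp: rsum_absorb1 rsum_absorb2)
    then have "dsum (?Q (A \<union> B)) = dsum (?Q A) \<boxplus> dsum (?Q B)"
      using dsum_rsum[of "?Q A" "?Q B"] riQ by presburger
    then have e: "?s (A \<union> B) = L \<boxplus> (dsum (?Q A) \<boxplus> dsum (?Q B))" by simp
    have r: "ri (?s A)" "ri (?s B)" "ri (?s A \<boxplus> ?s B)" using L riD ri_rsum by meson+
    show ?thesis
    proof
      show "?s (A \<union> B) \<subseteq> ?s A \<boxplus> ?s B" unfolding e
        using rsum_upper1[OF r(1,2)] rsum_upper1[OF L(1) riD[of A]]
        by (intro rsum_least[OF r(3)] rsum_mono rsum_upper2 L riD) blast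
      show "?s A \<boxplus> ?s B \<subseteq> ?s (A \<union> B)" unfolding e
        by (intro rsum_least rsum_mono ri_rsum L riD order_refl rsum_upper1 rsum_upper2)
    qed
  qed
  have int: "?s (A \<inter> B) = ?s A \<inter> ?s B" for A B
  proof -
    have "?Q (A \<inter> B) i = ?Q A i \<inter> ?Q B i" for i using V by auto
    then have "dsum (?Q (A \<inter> B)) = dsum (?Q A) \<inter> dsum (?Q B)"
      using dsum_Int[OF pe, of "?Q A" "?Q B"] riQ QP by presburger
    then show ?thesis
      using rsum_Int_complement[OF L(1) riP riD riD dsum_le[OF QP] dsum_le[OF QP] L(2)] by presburger
  qed
  have fin: "\<exists>F. finite F \<and> F \<subseteq> A \<and> x \<in> ?s F" if x: "x \<in> ?s A" for A x
  proof -
    obtain l a where la: "l \<in> L" "a \<in> dsum (?Q A)" "x = l \<oplus> a" using x unfolding mem_rsum by blast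
    then obtain m where m: "a \<in> psum (?Q A) m" unfolding dsum_def by blast
    have "psum (?Q A) m = psum (?Q (A \<inter> {..<m})) m" by (rule psum_cong) auto
    then have "a \<in> dsum (?Q (A \<inter> {..<m}))" using m unfolding dsum_def by blast
    then have "x \<in> ?s (A \<inter> {..<m})" using la rsumI by blast
    then show ?thesis by (intro exI[of _ "A \<inter> {..<m}"]) auto
  qed
  have single: "?s {i} = P i \<boxplus> ?I" for i
  proof -
    let ?Z = "\<lambda>j. if j = i then P j else {\<zero>}"
    have Z: "ri (?Z j)" for j using p ri_null by simp
    have "?Q {i} j = ?Z j \<boxplus> V j" for j
      using rsum_absorb2[OF p(1) V(1,2)] rsum_absorb1[OF ri_null V(1)] ri_zero[OF V(1)] by auto
    then have "dsum (?Q {i}) = dsum ?Z \<boxplus> dsum V" using dsum_rsum[of ?Z V] Z V(1) by presburger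
    also have "?Z = (\<lambda>j. if j = i then P i else {\<zero>})" by (auto simp: fun_eq_iff)
    finally have "dsum (?Q {i}) = P i \<boxplus> dsum V" using dsum_single[OF p(1)] by simp
    then have "?s {i} = L \<boxplus> (P i \<boxplus> dsum V)" by simp
    also have "\<dots> = P i \<boxplus> ?I"
      using L riV p(1) by (metis rsum_assoc rsum_commute)
    finally show ?thesis .
  qed
  show "?s {i} = P i \<boxplus> ?I" for i by (rule single)
  \<comment> \<open>If \<open>P i\<close> were inside the base, the modular law would remove
    \<open>L\<close>, and comparing components in \<open>dsum P\<close> would give
    \<open>P i \<subseteq> V i\<close>.\<close>
  have ne: "?s {i} \<noteq> ?I" for i
  proof
    assume eq: "?s {i} = ?I"
    have "P i \<subseteq> ?I" using eq single rsum_upper1[OF p(1) ri_rsum[OF L(1) riV]] by metis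
    moreover have "P i \<subseteq> dsum P" using dsum_component p(1) by blast
    moreover have VP: "dsum V \<subseteq> dsum P" using V(2) by (rule dsum_le)
    have "dsum P \<inter> (dsum V \<boxplus> L) = dsum V \<boxplus> (dsum P \<inter> L)"
      by (rule modular[OF riV L(1) riP VP])
    moreover have "dsum P \<inter> L \<subseteq> dsum V" using L ri_zero[OF riV] by blast
    moreover have "?I = dsum V \<boxplus> L" by (rule rsum_commute[OF L(1) riV])
    ultimately have sub: "P i \<subseteq> dsum V" using rsum_least[OF riV order_refl] by blast
    let ?Z = "\<lambda>j. if j = i then P i else {\<zero>}"
    have Z: "ri (?Z j)" "?Z j \<subseteq> P j" for j using p ri_null ri_zero[OF p(1)] by auto
    have "(\<lambda>j. ?Z j \<inter> V j) = (\<lambda>j. if j = i then V i else {\<zero>})"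
      using V(2)[of i] ri_zero[OF V(1)] by (auto simp: fun_eq_iff)
    then have "dsum (\<lambda>j. ?Z j \<inter> V j) = V i" using dsum_single[OF V(1)] by simp
    then have "P i \<inter> dsum V = V i"
      using dsum_Int[OF pe Z V(1,2)] dsum_single[OF p(1), of i i] by simp
    then show False using sub V(2,3)[of i] by blast
  qed
  show "indep ?I ?s"
    unfolding indep_def
    by (intro conjI allI ballI; (rule ri_rsum[OF L(1) riD] s0 un int ne | erule fin))
qed

lemma ess_dsum:
  assumes pe: "peeled P W" and V: "\<And>i. ri (V i)" and e: "\<And>i. ess {\<zero>} (V i) (P i)"
  shows "ess {\<zero>} (dsum V) (dsum P)"
proof -
  note p = peeledD[OF pe]
  have "ess {\<zero>} (psum V m) (psum P m)" for m
  proof (induction m)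
    case 0
    then show ?case using ess_refl[OF ri_null] by simp
  next
    case (Suc m)
    have "psum P m \<inter> P m \<subseteq> {\<zero>}" using peeled_psum_Int[OF pe, of m] p(3)[of m] by blast
    then have "ess {\<zero>} (psum V m \<boxplus> V m) (psum P m \<boxplus> P m)"
      by (rule ess_rsum[OF ri_null psum_ri[OF p(1)] p(1) psum_ri[OF V] V Suc.IH e])
        (simp_all add: ri_zero[OF psum_ri[OF V]] ri_zero[OF V])
    then show ?case by simp
  qed
  then show ?thesis unfolding ess_def dsum_def by blast
qed

subsection \<open>The socle of a regular ring\<close>

text \<open>The sum of the minimal right ideals, written as a directed union of semisimple right
  ideals of finite length. An element of the socle, and with it the principal right ideal that it
  generates, lies in one of them.\<close>

definition soc :: "'a set" where
  "soc = {x. \<exists>F. fsum {\<zero>} F \<and> x \<in> F}"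

lemma ri_soc: "ri soc"
  unfolding ri_iff
proof (intro conjI ballI)
  show "soc \<subseteq> carrier R" using fsum_ri[OF _ ri_null] ri_carrier unfolding soc_def by blast
  show "\<zero> \<in> soc" using fsum_base unfolding soc_def by blast
next
  fix x y assume "x \<in> soc" "y \<in> soc"
  then obtain F G where FG: "fsum {\<zero>} F" "x \<in> F" "fsum {\<zero>} G" "y \<in> G" unfolding soc_def by blast
  then show "x \<oplus> y \<in> soc" using fsum_rsum[OF ri_null FG(1,3)] rsumI unfolding soc_def by blast
next
  fix x r assume "x \<in> soc" "r \<in> carrier R"
  then show "x \<otimes> r \<in> soc" using fsum_ri[OF _ ri_null] ri_mult unfolding soc_def by blast
qed

lemma fsum_subset_soc: "fsum {\<zero>} F \<Longrightarrow> F \<subseteq> soc"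
  by (auto simp: soc_def)

lemma prin_subset_soc:
  assumes "x \<in> carrier R" "prin x \<subseteq> soc" obtains F where "fsum {\<zero>} F" "prin x \<subseteq> F"
proof -
  obtain F where "fsum {\<zero>} F" "x \<in> F" using assms prin_self unfolding soc_def by blast
  then show ?thesis using that prin_least fsum_ri[OF _ ri_null] by blast
qed

lemma rsum_null: "ri A \<Longrightarrow> A \<boxplus> {\<zero>} = A" "ri A \<Longrightarrow> {\<zero>} \<boxplus> A = A"
  by (simp_all add: rsum_absorb1 rsum_absorb2 ri_null ri_zero)

lemma summand_prin_null:
  assumes "ri D" "ri D'" "x \<in> carrier R" "D \<boxplus> D' = prin x" "D \<inter> D' = {\<zero>}"
  obtains d where "d \<in> carrier R" "D = prin d"
proof -
  have e: "D \<boxplus> D' = prin x \<boxplus> {\<zero>}" using assms by (simp add: rsum_null ri_prin)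
  obtain d d' where d: "d \<in> D" "d' \<in> D'" "D = prin d \<boxplus> {\<zero>}" "x = d \<oplus> d'"
    using summand_prin[OF ri_null assms(1,2,3) e assms(5)] .
  have "d \<in> carrier R" using d assms(1) ri_carrier by blast
  then show ?thesis using that d by (simp add: rsum_null ri_prin)
qed

text \<open>Regrouping of a direct sum of \<open>F\<close>, \<open>A\<close> and \<open>B\<close>:
  the \<open>F\<close>-part of an element of \<open>B\<close> is a difference of elements of
  \<open>W\<close>, hence zero.\<close>

lemma Int_rsum_null:
  assumes "ri F" "ri A" "ri B" "ri W" and "F \<inter> W \<subseteq> {\<zero>}" "A \<subseteq> W" "B \<subseteq> W" "A \<inter> B \<subseteq> {\<zero>}"
  shows "(F \<boxplus> A) \<inter> B = {\<zero>}"
proof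
  show "(F \<boxplus> A) \<inter> B \<subseteq> {\<zero>}"
  proof
    fix x assume x: "x \<in> (F \<boxplus> A) \<inter> B"
    then obtain f a where fa: "f \<in> F" "a \<in> A" "x = f \<oplus> a" by (auto simp: mem_rsum)
    have c: "f \<in> carrier R" "a \<in> carrier R" using fa assms ri_carrier by blast+
    have "f \<in> W" using ri_cancel2[OF assms(4), of a f] fa x c assms by blast
    then have "f = \<zero>" using fa assms by blast
    then show "x \<in> {\<zero>}" using fa x c assms by auto
  qed
  show "{\<zero>} \<subseteq> (F \<boxplus> A) \<inter> B" using ri_zero ri_rsum assms by blast
qed

text \<open>Repeated splitting by choice: \<open>\<Phi>\<close> is the invariant of the remainder,
  \<open>\<Psi>\<close> the property of the piece split off.\<close>

lemma peeling:
  assumes "\<Phi> W0" and step: "\<And>W. \<Phi> W \<Longrightarrow>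
      \<exists>P W'. ri P \<and> ri W' \<and> \<Psi> P \<and> \<Phi> W' \<and> P \<boxplus> W' = W \<and> P \<inter> W' = {\<zero>}"
  obtains P W where "peeled P W" "W 0 = W0" "\<And>n. \<Psi> (P n)"
proof -
  obtain p w where pw: "\<And>W. \<Phi> W \<Longrightarrow> ri (p W) \<and> ri (w W) \<and> \<Psi> (p W) \<and> \<Phi> (w W)
      \<and> p W \<boxplus> w W = W \<and> p W \<inter> w W = {\<zero>}" using step by metis
  define W where "W n = (w ^^ n) W0" for n
  have \<Phi>: "\<Phi> (W n)" for n by (induction n) (use assms pw W_def in auto)
  have W: "W (Suc n) = w (W n)" for n by (simp add: W_def)
  have "peeled (\<lambda>n. p (W n)) W"
    unfolding peeled_def
  proof (intro allI conjI)
    fix n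
    note q = pw[OF \<Phi>[of n]]
    show "ri (p (W n))" using q by blast
    show "ri (W n)" using q ri_rsum by metis
    show "p (W n) \<subseteq> W n" using q rsum_upper1[of "p (W n)" "w (W n)"] by auto
    show "W (Suc n) \<subseteq> W n" using q rsum_upper2[of "p (W n)" "w (W n)"] W by auto
    show "p (W n) \<inter> W (Suc n) = {\<zero>}" using q W by auto
  qed
  then show ?thesis using that[of "\<lambda>n. p (W n)" W] pw \<Phi> by (auto simp: W_def)
qed

text \<open>Starting Zorn's lemma from the socle makes the maximal submodule essential: if
  \<open>yR\<close> met \<open>M\<close> trivially for a nonzero \<open>y\<close> in
  \<open>xR\<close>, maximality would make \<open>yR\<close> simple, hence part of
  \<open>soc \<subseteq> M\<close>.\<close>

lemma maximal_in_prin: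
  assumes x: "x \<in> carrier R" "x \<notin> soc"
  obtains V where "ri V" "V \<subseteq> prin x" "V \<noteq> prin x" "ess {\<zero>} V (prin x)"
    "\<And>y. y \<in> prin x \<Longrightarrow> y \<notin> V \<Longrightarrow> prin x \<subseteq> prin y \<boxplus> V"
proof -
  obtain M where M: "ri M" "soc \<subseteq> M" "M \<inter> {x} = {}"
    "\<And>N. ri N \<Longrightarrow> M \<subseteq> N \<Longrightarrow> N \<inter> {x} = {} \<Longrightarrow> N = M"
    using ri_maximal_avoiding[OF ri_soc, of "{x}"] x(2) by (metis Int_insert_right_if0 Int_empty_right)
  let ?V = "M \<inter> prin x"
  have px: "ri (prin x)" using x ri_prin by blast
  have V: "ri ?V" using M px ri_Int by blast
  have ne: "?V \<noteq> prin x" using M prin_self x by blast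
  have mx: "prin x \<subseteq> prin y \<boxplus> ?V" if y: "y \<in> prin x" "y \<notin> ?V" for y
  proof -
    have yc: "y \<in> carrier R" using y px ri_carrier by blast
    have ry: "ri (M \<boxplus> prin y)" using M yc ri_prin ri_rsum by blast
    have "M \<boxplus> prin y \<noteq> M" using rsum_prin[OF M(1) yc] y by blast
    then have "x \<in> M \<boxplus> prin y" using M(4)[OF ry] rsum_prin[OF M(1) yc] by blast
    then obtain m v where mv: "m \<in> M" "v \<in> prin y" "x = m \<oplus> v" by (auto simp: mem_rsum)
    have c: "m \<in> carrier R" "v \<in> carrier R"
      using ri_carrier[OF M(1) mv(1)] ri_carrier[OF ri_prin[OF yc] mv(2)] .
    have "v \<in> prin x" using mv y px prin_least by blast
    then have "m \<in> prin x" using ri_cancel2[OF px, of v m] mv c prin_self x by blast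
    then have "x \<in> prin y \<boxplus> ?V" using mv c by (metis IntI a_comm rsumI)
    then show ?thesis using prin_least ri_rsum ri_prin yc V by blast
  qed
  have "ess {\<zero>} ?V (prin x)"
    unfolding ess_def
  proof (intro conjI ballI)
    fix y assume y: "y \<in> prin x - {\<zero>}"
    then have yc: "y \<in> carrier R" using px ri_carrier by blast
    have py: "ri (prin y)" "y \<in> prin y" "prin y \<subseteq> prin x"
      using yc ri_prin prin_self prin_least px y by blast+
    show "\<exists>r\<in>carrier R. y \<otimes> r \<in> ?V - {\<zero>}"
    proof (rule ccontr)
      assume "\<not> ?thesis"
      then have dis: "prin y \<inter> M \<subseteq> {\<zero>}" using py by (auto simp: prin_def)
      have "prin y \<subseteq> prin z \<boxplus> {\<zero>}" if z: "z \<in> prin y" "z \<noteq> \<zero>" for z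
      proof -
        have zc: "z \<in> carrier R" using z py ri_carrier by blast
        have "z \<notin> ?V" "z \<in> prin x" using z dis py by blast+
        then have "y \<in> prin z \<boxplus> ?V" using mx py by blast
        then obtain u v where uv: "u \<in> prin z" "v \<in> ?V" "y = u \<oplus> v" by (auto simp: mem_rsum)
        have c: "u \<in> carrier R" "v \<in> carrier R"
          using ri_carrier[OF ri_prin[OF zc] uv(1)] ri_carrier[OF V uv(2)] .
        have "u \<in> prin y" using uv z py prin_least by blast
        then have "v \<in> prin y" using ri_cancel1[OF py(1), of u v] uv c py by blast
        then have "v = \<zero>" using uv dis by blast
        then have "y \<in> prin z" using uv c by simp
        then show ?thesis using zc ri_prin prin_least by (simp add: rsum_null)
      qed
      then have "atom {\<zero>} (prin y)" using py y ri_zero unfolding atom_def by blast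
      then have "prin y \<subseteq> soc" using fsum_atom[OF ri_null] fsum_subset_soc by blast
      then show False using py dis M y by blast
    qed
  qed simp
  then show ?thesis using that[of ?V] V ne mx by blast
qed

text \<open>\<open>L\<close> is maximal among the right ideals that meet \<open>D\<close> trivially;
  an \<open>xR\<close> independent of \<open>L \<boxplus> D\<close> could be added to it.\<close>

lemma complement_ess:
  assumes D: "ri D"
  obtains L where "ri L" "L \<inter> D \<subseteq> {\<zero>}" "ess {\<zero>} (L \<boxplus> D) (carrier R)"
proof -
  obtain L where L: "ri L" "L \<inter> (D - {\<zero>}) = {}"
    "\<And>N. ri N \<Longrightarrow> L \<subseteq> N \<Longrightarrow> N \<inter> (D - {\<zero>}) = {} \<Longrightarrow> N = L"
    using ri_maximal_avoiding[OF ri_null, of "D - {\<zero>}"] by (metis Diff_disjoint)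
  have LD: "ri (L \<boxplus> D)" "L \<subseteq> L \<boxplus> D" "D \<subseteq> L \<boxplus> D"
    using L D ri_rsum rsum_upper1[OF L(1) D] rsum_upper2[OF L(1) D] by blast+
  have "ess {\<zero>} (L \<boxplus> D) (carrier R)"
    unfolding ess_def
  proof (intro conjI ballI)
    show "L \<boxplus> D \<subseteq> carrier R" using LD ri_carrier by blast
    fix x assume x: "x \<in> carrier R - {\<zero>}"
    show "\<exists>r\<in>carrier R. x \<otimes> r \<in> L \<boxplus> D - {\<zero>}"
    proof (rule ccontr)
      assume "\<not> ?thesis"
      then have dis: "prin x \<inter> (L \<boxplus> D) \<subseteq> {\<zero>}" by (auto simp: prin_def)
      have xc: "x \<in> carrier R" using x by blast
      have Lx: "ri (L \<boxplus> prin x)" "L \<subseteq> L \<boxplus> prin x" "x \<in> L \<boxplus> prin x"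
        using rsum_prin[OF L(1) xc] ri_rsum[OF L(1) ri_prin[OF xc]] by auto
      have "y = \<zero>" if y: "y \<in> L \<boxplus> prin x" "y \<in> D" for y
      proof -
        obtain l v where lv: "l \<in> L" "v \<in> prin x" "y = l \<oplus> v" using y by (auto simp: mem_rsum)
        have c: "l \<in> carrier R" "v \<in> carrier R"
          using ri_carrier[OF L(1) lv(1)] ri_carrier[OF ri_prin[OF xc] lv(2)] .
        have "v \<in> L \<boxplus> D" using ri_cancel1[OF LD(1), of l v] lv c y LD by blast
        then have "v = \<zero>" using lv dis by blast
        then have "y \<in> L" using lv c by simp
        then show ?thesis using y L by blast
      qed
      then have "L \<boxplus> prin x = L" using L(3)[OF Lx(1,2)] by blast
      then have "x \<in> L \<boxplus> D" using Lx LD by blast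
      then show False using dis x prin_self[OF xc] by blast
    qed
  qed
  then show ?thesis using that[of L] L(1,2) by blast
qed

section \<open>The case in which all principal right ideals outside the socle split\<close>

lemma not_all_split:
  assumes compl: "\<And>I T. ri I \<Longrightarrow> ess {\<zero>} I (carrier R) \<Longrightarrow> atom I T \<Longrightarrow>
      \<exists>C. ri C \<and> T \<boxplus> C = carrier R \<and> T \<inter> C = I"
    and alt: "\<And>E x. ri E \<Longrightarrow> ess {\<zero>} E (carrier R) \<Longrightarrow> x \<in> carrier R \<Longrightarrow>
      cs E (prin x \<boxplus> E) \<or> noeth E (prin x \<boxplus> E)"
    and split: "\<And>u. u \<in> carrier R \<Longrightarrow> \<not> prin u \<subseteq> soc \<Longrightarrow> \<exists>P Q. ri P \<and> ri Q \<and> P \<boxplus> Q = prin u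
      \<and> P \<inter> Q = {\<zero>} \<and> \<not> P \<subseteq> soc \<and> \<not> Q \<subseteq> soc"
    and one: "\<one> \<notin> soc"
  shows False
proof -
  let ?\<Phi> = "\<lambda>W. (\<exists>u\<in>carrier R. W = prin u) \<and> \<not> W \<subseteq> soc"
  obtain P W where pe: "peeled P W" and P: "\<And>n. ?\<Phi> (P n)"
  proof (rule peeling[of ?\<Phi> "prin \<one>" ?\<Phi>])
    show "?\<Phi> (prin \<one>)" using one prin_self by blast
    fix W assume "?\<Phi> W"
    then obtain u where u: "u \<in> carrier R" "W = prin u" "\<not> prin u \<subseteq> soc" by blast
    obtain P Q where PQ: "ri P" "ri Q" "P \<boxplus> Q = prin u" "P \<inter> Q = {\<zero>}" "\<not> P \<subseteq> soc" "\<not> Q \<subseteq> soc"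
      using split[OF u(1,3)] by metis
    have QP: "Q \<boxplus> P = prin u" "Q \<inter> P = {\<zero>}" using PQ rsum_commute by auto
    \<comment> \<open>Both halves are summands of \<open>uR\<close>, hence principal, so the
      remainder can be split again.\<close>
    obtain p where "p \<in> carrier R" "P = prin p" using summand_prin_null[OF PQ(1,2) u(1) PQ(3,4)] .
    moreover obtain q where "q \<in> carrier R" "Q = prin q"
      using summand_prin_null[OF PQ(2,1) u(1) QP] .
    ultimately show "\<exists>P W'. ri P \<and> ri W' \<and> ?\<Phi> P \<and> ?\<Phi> W' \<and> P \<boxplus> W' = W \<and> P \<inter> W' = {\<zero>}"
      using PQ u by blast
  qed blast
  note p = peeledD[OF pe]
  have "\<exists>V. ri V \<and> V \<subseteq> P n \<and> V \<noteq> P n \<and> ess {\<zero>} V (P n)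
      \<and> (\<forall>y\<in>P n. y \<notin> V \<longrightarrow> P n \<subseteq> prin y \<boxplus> V)" for n
  proof -
    obtain x where x: "x \<in> carrier R" "P n = prin x" "\<not> prin x \<subseteq> soc" using P[of n] by blast
    then have "x \<notin> soc" using prin_least[OF ri_soc] by blast
    then show ?thesis using maximal_in_prin[OF x(1)] x(2) by metis
  qed
  then obtain V where V: "\<And>n. ri (V n)" "\<And>n. V n \<subseteq> P n" "\<And>n. V n \<noteq> P n"
    "\<And>n. ess {\<zero>} (V n) (P n)" "\<And>n y. y \<in> P n \<Longrightarrow> y \<notin> V n \<Longrightarrow> P n \<subseteq> prin y \<boxplus> V n"
    by metis
  have riD: "ri (dsum P)" "ri (dsum V)" by (rule dsum_ri, rule p(1) V(1))+
  \<comment> \<open>\<open>compl\<close> and \<open>alt\<close> apply only over essential right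
    ideals; adding \<open>L\<close> makes \<open>?I\<close> essential, and with it every right ideal
    above \<open>?I\<close>.\<close>
  obtain L where L: "ri L" "L \<inter> dsum P \<subseteq> {\<zero>}" "ess {\<zero>} (L \<boxplus> dsum P) (carrier R)"
    using complement_ess[OF riD(1)] .
  let ?I = "L \<boxplus> dsum V"
  let ?s = "\<lambda>A. L \<boxplus> dsum (\<lambda>i. if i \<in> A then P i else V i)"
  have I: "ri ?I" "dsum V \<subseteq> ?I" using ri_rsum[OF L(1) riD(2)] rsum_upper2[OF L(1) riD(2)] .
  have "ess {\<zero>} ?I (L \<boxplus> dsum P)"
    using ess_rsum[OF ri_null L(1) riD(1) L(1) riD(2) ess_refl[OF L(1)] ess_dsum[OF pe V(1,4)] L(2)]
      ri_zero[OF L(1)] ri_zero[OF riD(2)] by simp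
  then have eI: "ess {\<zero>} ?I (carrier R)" using ess_trans[OF ri_whole _ L(3)] by blast
  have eE: "ess {\<zero>} E (carrier R)" if "ri E" "?I \<subseteq> E" for E
    using ess_mono[OF eI that(2)] that(1) ri_carrier by blast
  note ind = indep_dsum[OF pe V(1,2,3) L(1,2)]
  \<comment> \<open>The maximality of \<open>V i\<close> in \<open>P i\<close> carries over, since
    \<open>(P i + I) / I\<close> is a factor of \<open>P i / V i\<close>.\<close>
  have "atom ?I (?s {i})" for i
  proof -
    have T: "ri (P i \<boxplus> ?I)" "?I \<subseteq> P i \<boxplus> ?I" using ri_rsum[OF p(1) I(1)] rsum_upper2[OF p(1) I(1)] .
    have "P i \<boxplus> ?I \<noteq> ?I" using indepD(6)[OF ind(1), of i] ind(2)[of i] by simp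
    moreover have "P i \<boxplus> ?I \<subseteq> prin y \<boxplus> ?I" if y: "y \<in> P i \<boxplus> ?I" "y \<notin> ?I" for y
    proof -
      obtain q j where qj: "q \<in> P i" "j \<in> ?I" "y = q \<oplus> j" using y(1) unfolding mem_rsum[of y "P i"] by blast
      have c: "q \<in> carrier R" "j \<in> carrier R" "y \<in> carrier R"
        using ri_carrier[OF p(1) qj(1)] ri_carrier[OF I(1) qj(2)] ri_carrier[OF T(1) y(1)] .
      have VI: "V i \<subseteq> ?I" using dsum_component[OF V(1)] I(2) by (rule subset_trans)
      have yI: "ri (prin y \<boxplus> ?I)" "?I \<subseteq> prin y \<boxplus> ?I" "y \<in> prin y \<boxplus> ?I"
        using prin_rsum[OF I(1) c(3)] ri_rsum[OF ri_prin[OF c(3)] I(1)] by blast+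
      have "q \<notin> V i" using ri_add[OF I(1) _ qj(2), of q] qj(3) y(2) VI by blast
      then have "P i \<subseteq> prin q \<boxplus> V i" using V(5)[OF qj(1)] by blast
      moreover have "q \<in> prin y \<boxplus> ?I" using ri_cancel2[OF yI(1), of j q] yI(2,3) qj(2,3) c(1) by blast
      then have "prin q \<subseteq> prin y \<boxplus> ?I" by (rule prin_least[OF yI(1)])
      ultimately have "P i \<subseteq> prin y \<boxplus> ?I" using rsum_least[OF yI(1), of "prin q" "V i"] VI yI(2) by blast
      then show ?thesis using rsum_least[OF yI(1) _ yI(2)] by blast
    qed
    ultimately show ?thesis using T ind(2)[of i] unfolding atom_def by auto
  qed
  moreover have "cs E (prin x \<boxplus> E) \<or> noeth E (prin x \<boxplus> E)"
    if "ri E" "?I \<subseteq> E" "x \<in> carrier R" for E x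
    using alt[OF that(1) eE[OF that(1,2)] that(3)] .
  ultimately show False
    using no_independent_atoms[OF I(1) compl[OF I(1) eI] _ ind(1)] by blast
qed

section \<open>The unsplittable case\<close>

text \<open>Dividing by the partial sum \<open>s A0\<close> leaves the members outside
  \<open>A0\<close> independent, and \<open>g\<close> renumbers such members. It serves to split a
  family further once its first part has become the base.\<close>

lemma indep_shift:
  assumes s: "indep I s" and g: "inj g" and d: "range g \<inter> A0 = {}"
  shows "indep (s A0) (\<lambda>A. s (A0 \<union> g ` A))"
  unfolding indep_def
proof (intro conjI allI ballI)
  show "ri (s (A0 \<union> g ` A))" for A using indepD(1)[OF s] .
  show "s (A0 \<union> g ` {}) = s A0" by simp
  show "s (A0 \<union> g ` (A \<union> B)) = s (A0 \<union> g ` A) \<boxplus> s (A0 \<union> g ` B)" for A B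
    unfolding indepD(3)[OF s, symmetric] by (rule arg_cong[of _ _ s]) auto
  show "s (A0 \<union> g ` (A \<inter> B)) = s (A0 \<union> g ` A) \<inter> s (A0 \<union> g ` B)" for A B
    unfolding indepD(4)[OF s, symmetric] using image_Int[OF g, of A B] d
    by (intro arg_cong[of _ _ s]) blast
next
  fix A x assume "x \<in> s (A0 \<union> g ` A)"
  then obtain F where F: "finite F" "F \<subseteq> A0 \<union> g ` A" "x \<in> s F" using indepD(5)[OF s] by blast
  have "finite (A \<inter> g -` F)" using F(1) g by (simp add: finite_vimageI)
  moreover have "F \<subseteq> A0 \<union> g ` (A \<inter> g -` F)" using F(2) by blast
  then have "x \<in> s (A0 \<union> g ` (A \<inter> g -` F))" using F(3) indep_mono[OF s] by blast
  ultimately show "\<exists>F. finite F \<and> F \<subseteq> A \<and> x \<in> s (A0 \<union> g ` F)" by blast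
next
  fix i
  show "s (A0 \<union> g ` {i}) \<noteq> s A0"
  proof
    assume "s (A0 \<union> g ` {i}) = s A0"
    then have "s {g i} \<subseteq> s A0" using indep_mono[OF s, of "{g i}" "A0 \<union> g ` {i}"] by auto
    then have "s {g i} = s ({g i} \<inter> A0)" using indepD(4)[OF s] by blast
    also have "{g i} \<inter> A0 = {}" using d by blast
    finally show False using indepD(2,6)[OF s] by metis
  qed
qed

text \<open>The three parts have separate duties. \<open>T\<close> keeps \<open>A\<close> out of the
  socle. \<open>K\<close> excludes the noetherian alternative for \<open>A / T\<close> and a closure
  \<open>D\<close> generated by a socle element. \<open>V\<close>, which meets \<open>D\<close> only
  in \<open>T\<close>, excludes that the complement of \<open>dR\<close> lies in the socle.\<close>

lemma not_unsplittable:
  assumes compl: "\<And>x. x \<in> carrier R \<Longrightarrow> \<exists>C. ri C \<and> prin x \<boxplus> C = carrier R \<and> prin x \<inter> C = {\<zero>}"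
    and star: "\<And>I x. ri I \<Longrightarrow> x \<in> carrier R \<Longrightarrow> \<exists>A b c. ri A \<and> b \<in> carrier R \<and> c \<in> carrier R
      \<and> A \<boxplus> (prin b \<boxplus> I) = prin x \<boxplus> I \<and> A \<inter> (prin b \<boxplus> I) = I \<and> (cs I A \<or> noeth I A)
      \<and> b \<otimes> c \<ominus> b \<in> I \<and> (\<forall>r\<in>carrier R. b \<otimes> r \<in> I \<longrightarrow> c \<otimes> r = \<zero>)"
    and e: "e \<in> carrier R" "\<not> prin e \<subseteq> soc"
    and unsplit: "\<And>P Q. ri P \<Longrightarrow> ri Q \<Longrightarrow> P \<boxplus> Q = prin e \<Longrightarrow> P \<inter> Q = {\<zero>} \<Longrightarrow> P \<subseteq> soc \<or> Q \<subseteq> soc"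
  shows False
proof -
  have pe: "ri (prin e)" using e ri_prin by blast
  have rel_compl: "\<exists>C. ri C \<and> prin y \<boxplus> C = W \<and> prin y \<inter> C = {\<zero>}"
    if W: "ri W" and y: "y \<in> W" for W y
  proof -
    have yc: "y \<in> carrier R" using W y ri_carrier by blast
    obtain C where C: "ri C" "prin y \<boxplus> C = carrier R" "prin y \<inter> C = {\<zero>}" using compl[OF yc] by blast
    have "prin y \<subseteq> W" using prin_least W y by blast
    then have "prin y \<boxplus> (W \<inter> C) = W"
      using modular[OF ri_prin[OF yc] C(1) W] C(2) W ri_carrier by blast
    moreover have "prin y \<inter> (W \<inter> C) = {\<zero>}" using C(3) ri_zero[OF W] by blast
    ultimately show ?thesis using ri_Int[OF W C(1)] by blast
  qed
  \<comment> \<open>The invariant carries a complement \<open>F\<close> of \<open>W\<close> inside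
    the socle; through it a decomposition of \<open>W\<close> becomes one of \<open>eR\<close>, to
    which \<open>unsplit\<close> applies.\<close>
  let ?\<Phi> = "\<lambda>W. ri W \<and> \<not> W \<subseteq> soc \<and> (\<exists>F. ri F \<and> F \<subseteq> soc \<and> F \<boxplus> W = prin e \<and> F \<inter> W = {\<zero>})"
  let ?\<Psi> = "\<lambda>P. P \<subseteq> soc \<and> P \<noteq> {\<zero>}"
  obtain P W where peel: "peeled P W" and W0: "W 0 = prin e" and P: "\<And>n. ?\<Psi> (P n)"
  proof (rule peeling[of ?\<Phi> "prin e" ?\<Psi>])
    show "?\<Phi> (prin e)"
      using pe e rsum_null[OF pe] ri_null ri_zero[OF pe] ri_zero[OF ri_soc] by blast
    fix W assume W: "?\<Phi> W"
    then obtain F where F: "ri F" "F \<subseteq> soc" "F \<boxplus> W = prin e" "F \<inter> W = {\<zero>}" by blast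
    have rW: "ri W" "\<not> W \<subseteq> soc" using W by auto
    have "\<not> atom {\<zero>} W" using rW fsum_atom[OF ri_null] fsum_subset_soc by blast
    moreover have "W \<noteq> {\<zero>}" using rW ri_zero[OF ri_soc] by blast
    ultimately obtain y where y: "y \<in> W" "y \<noteq> \<zero>" "\<not> W \<subseteq> prin y \<boxplus> {\<zero>}"
      using rW ri_zero unfolding atom_def by blast
    have yc: "y \<in> carrier R" using y rW ri_carrier by blast
    obtain C where C: "ri C" "prin y \<boxplus> C = W" "prin y \<inter> C = {\<zero>}"
      using rel_compl[OF rW(1) y(1)] by blast
    have key: "\<exists>P W'. ri P \<and> ri W' \<and> ?\<Psi> P \<and> ?\<Phi> W' \<and> P \<boxplus> W' = W \<and> P \<inter> W' = {\<zero>}"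
      if A: "ri A" "ri B" "A \<boxplus> B = W" "A \<inter> B = {\<zero>}" "A \<subseteq> soc" "A \<noteq> {\<zero>}" for A B
    proof -
      have AB: "A \<subseteq> W" "B \<subseteq> W" using A rsum_upper1[OF A(1,2)] rsum_upper2[OF A(1,2)] by auto
      have "\<not> B \<subseteq> soc" using rsum_least[OF ri_soc A(5)] A(3) rW by blast
      moreover have "F \<boxplus> A \<boxplus> B = prin e" using rsum_assoc[OF F(1) A(1,2)] A(3) F(3) by simp
      moreover have "(F \<boxplus> A) \<inter> B = {\<zero>}"
        using F A AB rW by (intro Int_rsum_null[of F A B W]) auto
      moreover have "F \<boxplus> A \<subseteq> soc" using rsum_least[OF ri_soc F(2) A(5)] .
      ultimately show ?thesis using A ri_rsum[OF F(1) A(1)] by blast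
    qed
    show "\<exists>P W'. ri P \<and> ri W' \<and> ?\<Psi> P \<and> ?\<Phi> W' \<and> P \<boxplus> W' = W \<and> P \<inter> W' = {\<zero>}"
    proof (cases "prin y \<subseteq> soc")
      case True
      moreover have "prin y \<noteq> {\<zero>}" using prin_self[OF yc] y by blast
      ultimately show ?thesis using key[OF ri_prin[OF yc] C] by blast
    next
      \<comment> \<open>Here \<open>eR\<close> is the direct sum of \<open>F \<boxplus> C\<close>
        and \<open>yR\<close>, so \<open>C\<close> lies in the socle and is split off in place of
        \<open>yR\<close>.\<close>
      case False
      have CW: "C \<subseteq> W" "prin y \<subseteq> W"
        using C rsum_upper1[OF ri_prin[OF yc] C(1)] rsum_upper2[OF ri_prin[OF yc] C(1)] by auto
      have CC: "C \<boxplus> prin y = W" "C \<inter> prin y = {\<zero>}"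
        using C rsum_commute[OF C(1) ri_prin[OF yc]] by auto
      have "F \<boxplus> C \<boxplus> prin y = prin e"
        using rsum_assoc[OF F(1) C(1) ri_prin[OF yc]] CC F(3) by simp
      moreover have "(F \<boxplus> C) \<inter> prin y = {\<zero>}"
        using F C CW CC rW ri_prin[OF yc] by (intro Int_rsum_null[of F C "prin y" W]) auto
      ultimately have "F \<boxplus> C \<subseteq> soc"
        using unsplit[OF ri_rsum[OF F(1) C(1)] ri_prin[OF yc]] False by blast
      then have "C \<subseteq> soc" using rsum_upper2[OF F(1) C(1)] by blast
      moreover have "C \<noteq> {\<zero>}" using C(2) y(3) by blast
      ultimately show ?thesis using key[OF C(1) ri_prin[OF yc] CC] by blast
    qed
  qed blast
  note p = peeledD[OF peel]
  define s where "s A = {\<zero>} \<boxplus> dsum (\<lambda>i. if i \<in> A then P i else {\<zero>})" for A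
  have "{\<zero>} \<noteq> P i" "{\<zero>} \<subseteq> P i" for i using P[of i] ri_zero[OF p(1)] by auto
  then have "indep ({\<zero>} \<boxplus> dsum (\<lambda>_. {\<zero>})) s"
    unfolding s_def
    by (intro indep_dsum(1)[OF peel, where V = "\<lambda>_. {\<zero>}"] ri_null) blast+
  moreover have "dsum (\<lambda>_. {\<zero>}) = {\<zero>}" using dsum_single[OF ri_null] by simp
  ultimately have s: "indep {\<zero>} s" using rsum_null[OF ri_null] by simp
  have We: "W n \<subseteq> prin e" for n
    by (induction n) (use W0 p(4) in auto)
  have se: "s A \<subseteq> prin e" for A
    unfolding s_def using p(3) We ri_zero[OF pe]
    by (intro rsum_least[OF pe] dsum_least[OF pe]) (auto split: if_splits)
  \<comment> \<open>The even indices make up the base \<open>T\<close>; the odd ones are renumbered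
    and divided by parity once more, into \<open>K\<close> and \<open>V\<close>.\<close>
  define t where "t A = s ({i. even i} \<union> (\<lambda>n. 2 * n + 1) ` A)" for A
  define T where "T = s {i. even i}"
  have t: "indep T t" unfolding t_def T_def
    by (rule indep_shift[OF s]) (auto simp: inj_on_def)
  have infE: "infinite {i::nat. even i}" "infinite {i::nat. odd i}"
  proof -
    have "even (2 * n)" "odd (2 * n + 1)" "\<not> 2 * n < n" "\<not> 2 * n + 1 < n" for n :: nat by auto
    then show "infinite {i::nat. even i}" "infinite {i::nat. odd i}"
      unfolding finite_nat_set_iff_bounded by blast+
  qed
  have T: "ri T" "T \<subseteq> prin e" "\<not> cpt {\<zero>} T"
    using indepD(1)[OF s] se indep_not_cpt[OF s infE(1)] unfolding T_def by blast+
  define K where "K = t {i. even i}"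
  define V where "V = t {i. odd i}"
  have K: "ri K" "T \<subseteq> K" "K \<subseteq> prin e" "\<not> cpt T K"
    using indepD(1)[OF t] indep_base[OF t] indep_not_cpt[OF t infE(1)] se unfolding K_def by (auto simp: t_def)
  have V: "ri V" "T \<subseteq> V" "V \<subseteq> prin e" "\<not> cpt T V"
    using indepD(1)[OF t] indep_base[OF t] indep_not_cpt[OF t infE(2)] se unfolding V_def by (auto simp: t_def)
  have "{i::nat. even i} \<inter> {i. odd i} = {}" by auto
  then have KV: "K \<inter> V = T" unfolding K_def V_def using indepD(2,4)[OF t] by metis
  obtain A b c where A: "ri A" "b \<in> carrier R" "c \<in> carrier R" "A \<boxplus> (prin b \<boxplus> T) = prin e \<boxplus> T"
      "A \<inter> (prin b \<boxplus> T) = T" "cs T A \<or> noeth T A" "b \<otimes> c \<ominus> b \<in> T"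
      "\<And>r. r \<in> carrier R \<Longrightarrow> b \<otimes> r \<in> T \<Longrightarrow> c \<otimes> r = \<zero>"
    using star[OF T(1) e(1)] by blast
  have TA: "T \<subseteq> A" using A by blast
  \<comment> \<open>\<open>bc\<close> agrees with \<open>b\<close> modulo \<open>T\<close>, and
    \<open>bcr \<in> T\<close> forces \<open>cr = 0\<close>. So \<open>B\<close> is a lift of
    \<open>(bR + T) / T\<close> that avoids \<open>T\<close>, and \<open>eR\<close> is the direct
    sum of \<open>A\<close> and \<open>B\<close>.\<close>
  define B where "B = prin (b \<otimes> c)"
  have bc: "b \<otimes> c \<in> carrier R" using A by simp
  have B: "ri B" unfolding B_def using bc ri_prin by blast
  have bT: "ri (prin b \<boxplus> T)" "T \<subseteq> prin b \<boxplus> T" "b \<in> prin b \<boxplus> T"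
    using prin_rsum[OF T(1) A(2)] ri_rsum[OF ri_prin[OF A(2)] T(1)] by blast+
  have BbT: "B \<subseteq> prin b \<boxplus> T" unfolding B_def
    using prin_least[OF bT(1)] ri_mult[OF bT(1,3) A(3)] by blast
  have AB0: "A \<inter> B = {\<zero>}"
  proof
    show "A \<inter> B \<subseteq> {\<zero>}"
    proof
      fix y assume y: "y \<in> A \<inter> B"
      then have yT: "y \<in> T" using BbT A(5) by blast
      obtain r where r: "r \<in> carrier R" "y = b \<otimes> c \<otimes> r" using y by (auto simp: B_def prin_def)
      have "(b \<otimes> c \<ominus> b) \<otimes> r \<in> T" using ri_mult[OF T(1) A(7) r(1)] .
      moreover have "(b \<otimes> c \<ominus> b) \<otimes> r = y \<ominus> b \<otimes> r"
        using r A by (simp add: a_minus_def l_distr l_minus)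
      ultimately have "b \<otimes> r \<in> T"
        using ri_diff_swap[OF T(1), of y "b \<otimes> r"] r A yT bc by simp
      then have "c \<otimes> r = \<zero>" using A(8) r by blast
      then show "y \<in> {\<zero>}" using r A by (simp add: m_assoc)
    qed
    show "{\<zero>} \<subseteq> A \<inter> B" using ri_zero A B by blast
  qed
  have AB: "A \<boxplus> B = prin e"
  proof
    have eT: "prin e \<boxplus> T = prin e" using rsum_absorb2[OF pe T(1,2)] .
    have rAB: "ri (A \<boxplus> B)" "A \<subseteq> A \<boxplus> B" "B \<subseteq> A \<boxplus> B"
      using rsum_upper1[OF A(1) B] rsum_upper2[OF A(1) B] ri_rsum[OF A(1) B] by auto
    show "A \<boxplus> B \<subseteq> prin e" using rsum_mono[OF order_refl BbT, of A] A(4) eT by simp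
    have "b \<otimes> c \<in> A \<boxplus> B" using rAB prin_self[OF bc] unfolding B_def by blast
    then have "b \<in> A \<boxplus> B"
      using ri_diff_swap[OF rAB(1) bc A(2)] A(7) TA rAB by blast
    then have "prin b \<boxplus> T \<subseteq> A \<boxplus> B"
      using TA rAB by (intro rsum_least prin_least) auto
    then have "A \<boxplus> (prin b \<boxplus> T) \<subseteq> A \<boxplus> B" using rsum_least[OF rAB(1,2)] by blast
    then show "prin e \<subseteq> A \<boxplus> B" using A(4) eT by simp
  qed
  obtain a where a: "a \<in> carrier R" "A = prin a" using summand_prin_null[OF A(1) B e(1) AB AB0] .
  \<comment> \<open>A principal right ideal inside the socle has finite length, too small for
    \<open>T \<subseteq> A\<close>.\<close>
  have "\<not> A \<subseteq> soc"
  proof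
    assume "A \<subseteq> soc"
    then obtain F where F: "fsum {\<zero>} F" "A \<subseteq> F" using prin_subset_soc[OF a(1)] a(2) by blast
    have "T \<subseteq> {\<zero>} \<boxplus> F" using F TA rsum_null(2)[OF fsum_ri[OF F(1) ri_null]] by blast
    moreover have "T \<inter> {\<zero>} = {\<zero>}" using ri_zero[OF T(1)] by blast
    then have "cpt {\<zero>} (T \<inter> {\<zero>})" using cpt_refl by simp
    ultimately show False
      using cpt_fsum_extension[OF ri_null ri_null order_refl F(1) T(1)] T(3) by blast
  qed
  then have "B \<subseteq> soc" using unsplit[OF A(1) B AB AB0] by blast
  then obtain F where F: "fsum {\<zero>} F" "B \<subseteq> F" using prin_subset_soc[OF bc] unfolding B_def by blast
  have zA: "{\<zero>} \<subseteq> A" using ri_zero A by blast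
  have "\<not> cpt T (K \<inter> A)"
  proof
    assume "cpt T (K \<inter> A)"
    moreover have "K \<subseteq> A \<boxplus> F" using K(3) AB rsum_mono[OF order_refl F(2), of A] by blast
    ultimately show False using cpt_fsum_extension[OF A(1) ri_null zA F(1) K(1)] K(4) by blast
  qed
  moreover have KA: "ri (K \<inter> A)" "T \<subseteq> K \<inter> A" using ri_Int K A TA by blast+
  ultimately have "\<not> noeth T A" using cpt_noeth[of T A "K \<inter> A"] by blast
  then have "cs T A" using A by blast
  then obtain D D' where D: "ri D" "ri D'" "D \<boxplus> D' = A" "D \<inter> D' = T" "ess T (K \<inter> A) D"
    using KA unfolding cs_def by blast
  have Da: "D \<boxplus> D' = prin a \<boxplus> T" using D(3) a rsum_absorb2[OF A(1) T(1) TA] by simp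
  obtain d d' where d: "d \<in> D" "d' \<in> D'" "D = prin d \<boxplus> T" "a = d \<oplus> d'"
    using summand_prin[OF T(1) D(1,2) a(1) Da D(4)] .
  have dA: "d \<in> A" using d D(3) rsum_upper1[OF D(1,2)] by blast
  have dc: "d \<in> carrier R" using dA A ri_carrier by blast
  obtain C where C: "ri C" "prin d \<boxplus> C = A" "prin d \<inter> C = {\<zero>}" using rel_compl[OF A(1) dA] by blast
  have CA: "C \<subseteq> A" "prin d \<subseteq> A" using C rsum_upper1[OF ri_prin[OF dc] C(1)]
      rsum_upper2[OF ri_prin[OF dc] C(1)] by auto
  have CB: "ri (C \<boxplus> B)" using ri_rsum C B by blast
  have sum: "prin d \<boxplus> (C \<boxplus> B) = prin e"
    using rsum_assoc[OF ri_prin[OF dc] C(1) B] C(2) AB by simp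
  have "(B \<boxplus> C) \<inter> prin d = {\<zero>}"
    using A B C CA AB0 ri_prin[OF dc] by (intro Int_rsum_null[of B C "prin d" A]) auto
  then have int: "prin d \<inter> (C \<boxplus> B) = {\<zero>}" using rsum_commute[OF B C(1)] by auto
  consider "prin d \<subseteq> soc" | "C \<boxplus> B \<subseteq> soc" using unsplit[OF ri_prin[OF dc] CB sum int] by blast
  then show False
  proof cases
    case 1
    then obtain G where G: "fsum {\<zero>} G" "prin d \<subseteq> G" using prin_subset_soc[OF dc] by blast
    have "K \<inter> A \<subseteq> D" using ess_subset[OF D(5)] .
    also have "D = T \<boxplus> prin d" using d(3) rsum_commute[OF T(1) ri_prin[OF dc]] by simp
    also have "\<dots> \<subseteq> T \<boxplus> G" using G rsum_mono[OF order_refl] by blast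
    finally have "K \<inter> A \<subseteq> T \<boxplus> G" .
    moreover have "K \<inter> A \<inter> T = T" using KA by blast
    ultimately have "cpt T (K \<inter> A)"
      using cpt_fsum_extension[OF T(1) ri_null _ G(1) KA(1)] cpt_refl ri_zero[OF T(1)] by simp
    then show False using \<open>\<not> cpt T (K \<inter> A)\<close> by blast
  next
    case 2
    have "(C \<boxplus> B) \<boxplus> prin d = prin e" "(C \<boxplus> B) \<inter> prin d = {\<zero>}"
      using sum int rsum_commute[OF CB ri_prin[OF dc]] by auto
    then obtain z where z: "z \<in> carrier R" "C \<boxplus> B = prin z"
      using summand_prin_null[OF CB ri_prin[OF dc] e(1)] by blast
    then obtain G where G: "fsum {\<zero>} G" "C \<boxplus> B \<subseteq> G" using prin_subset_soc[OF z(1)] 2 by auto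
    have dD: "prin d \<subseteq> D" using d prin_least[OF D(1)] by blast
    have "V \<subseteq> prin e" using V by blast
    also have "\<dots> \<subseteq> D \<boxplus> G" using sum rsum_mono[OF dD G(2)] by simp
    finally have "V \<subseteq> D \<boxplus> G" .
    \<comment> \<open>\<open>K \<inter> A\<close> is essential in \<open>D\<close> over
      \<open>T\<close>, and \<open>K\<close> meets \<open>V\<close> only in
      \<open>T\<close>.\<close>
    moreover have "V \<inter> D = T"
    proof
      show "T \<subseteq> V \<inter> D" using V D by blast
      show "V \<inter> D \<subseteq> T"
      proof (rule ccontr)
        assume "\<not> V \<inter> D \<subseteq> T"
        then obtain x where x: "x \<in> V" "x \<in> D" "x \<notin> T" by blast
        then obtain r where "r \<in> carrier R" "x \<otimes> r \<in> K" "x \<otimes> r \<notin> T" using essD[OF D(5)] by blast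
        then show False using KV ri_mult[OF V(1) x(1)] by blast
      qed
    qed
    ultimately have "cpt T V"
      using cpt_fsum_extension[OF D(1) ri_null _ G(1) V(1)] cpt_refl ri_zero[OF D(1)] by simp
    then show False using V by blast
  qed
qed

text \<open>Over an essential \<open>I\<close> the projective summand of the star condition vanishes, since a
  regular ring is nonsingular.\<close>

lemma fsum_whole:
  assumes reg: "\<And>a. a \<in> carrier R \<Longrightarrow> \<exists>x\<in>carrier R. a = a \<otimes> x \<otimes> a"
    and compl: "\<And>I T. ri I \<Longrightarrow> ess {\<zero>} I (carrier R) \<Longrightarrow> atom I T \<Longrightarrow>
      \<exists>C. ri C \<and> T \<boxplus> C = carrier R \<and> T \<inter> C = I"
    and star: "\<And>I x. ri I \<Longrightarrow> x \<in> carrier R \<Longrightarrow> \<exists>A b c. ri A \<and> b \<in> carrier R \<and> c \<in> carrier R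
      \<and> A \<boxplus> (prin b \<boxplus> I) = prin x \<boxplus> I \<and> A \<inter> (prin b \<boxplus> I) = I \<and> (cs I A \<or> noeth I A)
      \<and> b \<otimes> c \<ominus> b \<in> I \<and> (\<forall>r\<in>carrier R. b \<otimes> r \<in> I \<longrightarrow> c \<otimes> r = \<zero>)"
  shows "fsum {\<zero>} (carrier R)"
proof -
  have rcompl: "\<exists>C. ri C \<and> prin x \<boxplus> C = carrier R \<and> prin x \<inter> C = {\<zero>}" if x: "x \<in> carrier R" for x
  proof -
    obtain y where y: "y \<in> carrier R" "x = x \<otimes> y \<otimes> x" using reg x by blast
    \<comment> \<open>\<open>xy\<close> is an idempotent that generates \<open>xR\<close>, so
      \<open>1 - xy\<close> generates a complement.\<close>
    let ?f = "\<one> \<ominus> x \<otimes> y"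
    have f: "?f \<in> carrier R" using x y by simp
    have fx: "x \<otimes> y \<otimes> (x \<otimes> r) = x \<otimes> r" if "r \<in> carrier R" for r
      using x y that by (metis m_assoc m_closed)
    have xyxy: "x \<otimes> y \<otimes> (x \<otimes> y) = x \<otimes> y" using fx y by simp
    then have xyf: "x \<otimes> y \<otimes> ?f = \<zero>"
      using x y by (simp add: a_minus_def r_distr r_minus r_neg)
    have "prin x \<inter> prin ?f \<subseteq> {\<zero>}"
    proof
      fix z assume "z \<in> prin x \<inter> prin ?f"
      then obtain r t where rt: "r \<in> carrier R" "t \<in> carrier R" "z = x \<otimes> r" "z = ?f \<otimes> t"
        unfolding prin_def by blast
      have "z = x \<otimes> y \<otimes> z" using rt fx by simp
      also have "\<dots> = x \<otimes> y \<otimes> ?f \<otimes> t" using rt x y f by (simp add: m_assoc)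
      finally show "z \<in> {\<zero>}" using xyf rt by simp
    qed
    then have "prin x \<inter> prin ?f = {\<zero>}" using ri_zero ri_prin x f by blast
    moreover have "prin x \<boxplus> prin ?f = carrier R"
    proof
      have rr: "ri (prin x \<boxplus> prin ?f)" using ri_rsum ri_prin x f by blast
      then show "prin x \<boxplus> prin ?f \<subseteq> carrier R" using ri_carrier by blast
      have "x \<otimes> y \<oplus> ?f \<in> prin x \<boxplus> prin ?f"
        using y by (intro rsumI prin_self[OF f]) (auto simp: prin_def)
      then have "\<one> \<in> prin x \<boxplus> prin ?f" using add_minus_cancel x y by simp
      then show "carrier R \<subseteq> prin x \<boxplus> prin ?f" using prin_least[OF rr] prin_one by blast
    qed
    ultimately show ?thesis using ri_prin[OF f] by blast
  qed
  have alt: "cs E (prin x \<boxplus> E) \<or> noeth E (prin x \<boxplus> E)"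
    if E: "ri E" and ess: "ess {\<zero>} E (carrier R)" and x: "x \<in> carrier R" for E x
  proof -
    obtain A b c where A: "ri A" "b \<in> carrier R" "c \<in> carrier R" "A \<boxplus> (prin b \<boxplus> E) = prin x \<boxplus> E"
      "A \<inter> (prin b \<boxplus> E) = E" "cs E A \<or> noeth E A" "b \<otimes> c \<ominus> b \<in> E"
      "\<And>r. r \<in> carrier R \<Longrightarrow> b \<otimes> r \<in> E \<Longrightarrow> c \<otimes> r = \<zero>"
      using star[OF E x] by blast
    \<comment> \<open>Nonsingularity in terms of elements: \<open>u = yc\<close> satisfies
      \<open>cu = c\<close>, and \<open>cr = 0\<close> implies \<open>ur = 0\<close>. Essentiality
      of \<open>E\<close> provides a nonzero \<open>bur\<close> in \<open>E\<close>; then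
      \<open>cr = c(ur) = 0\<close>, so \<open>ur = 0\<close>, a contradiction.\<close>
    have "c = \<zero>"
    proof (rule ccontr)
      assume c0: "c \<noteq> \<zero>"
      obtain y where y: "y \<in> carrier R" "c = c \<otimes> y \<otimes> c" using reg[OF A(3)] by blast
      define u where "u = y \<otimes> c"
      have u: "u \<in> carrier R" "c \<otimes> u = c" using A y by (auto simp: u_def m_assoc)
      then have bu: "b \<otimes> u \<notin> E" using A(8) c0 by metis
      then have "b \<otimes> u \<in> carrier R" "b \<otimes> u \<notin> {\<zero>}" using u A ri_zero[OF E] by auto
      then obtain r where r: "r \<in> carrier R" "b \<otimes> u \<otimes> r \<in> E" "b \<otimes> u \<otimes> r \<noteq> \<zero>"
        using essD[OF ess, of "b \<otimes> u"] by auto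
      then have "c \<otimes> (u \<otimes> r) = \<zero>" using A u by (simp add: m_assoc)
      then have "c \<otimes> r = \<zero>" using u r A by (metis m_assoc)
      then have "u \<otimes> r = \<zero>" using y A r by (simp add: u_def m_assoc)
      then show False using r u A by (simp add: m_assoc)
    qed
    then have "\<ominus> b \<in> E" using A by (simp add: a_minus_def)
    then have "b \<in> E" using ri_uminus[OF E] A by (metis minus_minus)
    then have "prin b \<boxplus> E = E" using E A prin_least by (intro rsum_absorb1 ri_prin) auto
    then have "A \<boxplus> E = prin x \<boxplus> E" "E \<subseteq> A" using A by auto
    then have "A = prin x \<boxplus> E" using rsum_absorb2[OF A(1) E] by simp
    then show ?thesis using A by simp
  qed
  have "\<one> \<in> soc"
  proof (rule ccontr)
    assume one: "\<one> \<notin> soc"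
    have "\<exists>P Q. ri P \<and> ri Q \<and> P \<boxplus> Q = prin u \<and> P \<inter> Q = {\<zero>} \<and> \<not> P \<subseteq> soc \<and> \<not> Q \<subseteq> soc"
      if "u \<in> carrier R" "\<not> prin u \<subseteq> soc" for u
      using not_unsplittable[OF rcompl star that] by blast
    then show False using not_all_split[OF compl alt _ one] by blast
  qed
  then obtain F where F: "fsum {\<zero>} F" "\<one> \<in> F" unfolding soc_def by blast
  have rF: "ri F" using fsum_ri[OF F(1) ri_null] .
  then have "F = carrier R" using prin_least[OF rF F(2)] prin_one ri_carrier by blast
  then show ?thesis using F by simp
qed

end

subsection \<open>Quotients of the regular module\<close>

lemma (in right_module) rsmult_zero: "x \<in> carrier M \<Longrightarrow> x \<triangleleft>\<^bsub>M\<^esub> \<zero>\<^bsub>R\<^esub> = \<zero>\<^bsub>M\<^esub>"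
  using rsmult_r_distr[of x "\<zero>\<^bsub>R\<^esub>" "\<zero>\<^bsub>R\<^esub>"] rsmult_closed[of x "\<zero>\<^bsub>R\<^esub>"]
  by (metis M.add.r_cancel_one' R.l_zero R.zero_closed)

lemma (in right_module) rsmult_minus_one:
  assumes x: "x \<in> carrier M" shows "x \<triangleleft>\<^bsub>M\<^esub> (\<ominus>\<^bsub>R\<^esub> \<one>\<^bsub>R\<^esub>) = \<ominus>\<^bsub>M\<^esub> x"
proof -
  have "x \<triangleleft>\<^bsub>M\<^esub> (\<ominus>\<^bsub>R\<^esub> \<one>\<^bsub>R\<^esub> \<oplus>\<^bsub>R\<^esub> \<one>\<^bsub>R\<^esub>) = x \<triangleleft>\<^bsub>M\<^esub> (\<ominus>\<^bsub>R\<^esub> \<one>\<^bsub>R\<^esub>) \<oplus>\<^bsub>M\<^esub> x"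
    using rsmult_r_distr[OF x, of "\<ominus>\<^bsub>R\<^esub> \<one>\<^bsub>R\<^esub>" "\<one>\<^bsub>R\<^esub>"] rsmult_one[OF x] by simp
  then have "x \<triangleleft>\<^bsub>M\<^esub> (\<ominus>\<^bsub>R\<^esub> \<one>\<^bsub>R\<^esub>) \<oplus>\<^bsub>M\<^esub> x = \<zero>\<^bsub>M\<^esub>"
    using rsmult_zero[OF x] by (simp add: R.l_neg)
  then show ?thesis using x rsmult_closed by (simp add: M.minus_equality)
qed

lemma (in right_module) rsubmoduleI:
  assumes H: "H \<subseteq> carrier M" "\<zero>\<^bsub>M\<^esub> \<in> H" "\<And>x y. x \<in> H \<Longrightarrow> y \<in> H \<Longrightarrow> x \<oplus>\<^bsub>M\<^esub> y \<in> H"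
    "\<And>x r. x \<in> H \<Longrightarrow> r \<in> carrier R \<Longrightarrow> x \<triangleleft>\<^bsub>M\<^esub> r \<in> H"
  shows "rsubmodule R M H"
proof -
  have "subgroup H (add_monoid M)"
  proof (rule group.subgroupI)
    show "group (add_monoid M)" by (rule M.a_group)
    fix a assume a: "a \<in> H"
    then have "\<ominus>\<^bsub>M\<^esub> a \<in> H" using H(4)[OF a, of "\<ominus>\<^bsub>R\<^esub> \<one>\<^bsub>R\<^esub>"] H(1) rsmult_minus_one by auto
    then show "inv\<^bsub>add_monoid M\<^esub> a \<in> H" by (simp add: a_inv_def)
  qed (use H in auto)
  then show ?thesis using H by (simp add: rsubmodule_def additive_subgroup_def)
qed

lemma rsubmoduleD:
  assumes "rsubmodule R M H"
  shows "H \<subseteq> carrier M" "\<zero>\<^bsub>M\<^esub> \<in> H" "x \<in> H \<Longrightarrow> y \<in> H \<Longrightarrow> x \<oplus>\<^bsub>M\<^esub> y \<in> H"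
    "x \<in> H \<Longrightarrow> r \<in> carrier R \<Longrightarrow> x \<triangleleft>\<^bsub>M\<^esub> r \<in> H"
proof -
  from assms have "subgroup H (add_monoid M)" and m: "\<forall>x\<in>H. \<forall>r\<in>carrier R. x \<triangleleft>\<^bsub>M\<^esub> r \<in> H"
    by (auto simp: rsubmodule_def additive_subgroup_def)
  then interpret subgroup H "add_monoid M" by simp
  show "H \<subseteq> carrier M" "\<zero>\<^bsub>M\<^esub> \<in> H" using subset one_closed by auto
  show "x \<in> H \<Longrightarrow> y \<in> H \<Longrightarrow> x \<oplus>\<^bsub>M\<^esub> y \<in> H" using m_closed by simp
  show "x \<in> H \<Longrightarrow> r \<in> carrier R \<Longrightarrow> x \<triangleleft>\<^bsub>M\<^esub> r \<in> H" using m by blast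
qed

lemma rmod_homD:
  assumes "f \<in> rmod_hom R M N"
  shows "x \<in> carrier M \<Longrightarrow> f x \<in> carrier N"
    "x \<in> carrier M \<Longrightarrow> y \<in> carrier M \<Longrightarrow> f (x \<oplus>\<^bsub>M\<^esub> y) = f x \<oplus>\<^bsub>N\<^esub> f y"
    "x \<in> carrier M \<Longrightarrow> r \<in> carrier R \<Longrightarrow> f (x \<triangleleft>\<^bsub>M\<^esub> r) = f x \<triangleleft>\<^bsub>N\<^esub> r"
  using assms by (auto simp: rmod_hom_def)

text \<open>Transport of structure along \<open>f\<close>, which gives modules the element type that
  \<open>projective_rmod\<close> prescribes for its test modules.\<close>

definition copy_rmod ::
    "('b \<Rightarrow> 'c) \<Rightarrow> ('a, 'b, 'n) rmodule_scheme \<Rightarrow> ('a, 'c) rmodule" where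
  "copy_rmod f M = \<lparr>carrier = f ` carrier M, monoid.mult = undefined, monoid.one = undefined,
     ring.zero = f \<zero>\<^bsub>M\<^esub>,
     ring.add = (\<lambda>u v. f (inv_into (carrier M) f u \<oplus>\<^bsub>M\<^esub> inv_into (carrier M) f v)),
     rsmult = (\<lambda>u r. f (inv_into (carrier M) f u \<triangleleft>\<^bsub>M\<^esub> r))\<rparr>"

lemma copy_rmod_simps:
  "carrier (copy_rmod f M) = f ` carrier M" "\<zero>\<^bsub>copy_rmod f M\<^esub> = f \<zero>\<^bsub>M\<^esub>"
  "inj_on f (carrier M) \<Longrightarrow> x \<in> carrier M \<Longrightarrow> y \<in> carrier M \<Longrightarrow> f x \<oplus>\<^bsub>copy_rmod f M\<^esub> f y = f (x \<oplus>\<^bsub>M\<^esub> y)"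
  "inj_on f (carrier M) \<Longrightarrow> x \<in> carrier M \<Longrightarrow> f x \<triangleleft>\<^bsub>copy_rmod f M\<^esub> r = f (x \<triangleleft>\<^bsub>M\<^esub> r)"
  by (simp_all add: copy_rmod_def)

lemma right_module_copy:
  assumes "right_module R M" and inj: "inj_on f (carrier M)"
  shows "right_module R (copy_rmod f M)"
proof -
  interpret right_module R M by fact
  note s = copy_rmod_simps(1,2) copy_rmod_simps(3,4)[OF inj]
  show ?thesis
  proof (intro right_module.intro right_module_axioms.intro abelian_groupI)
    show "ring R" by (rule R.ring_axioms)
    fix x assume "x \<in> carrier (copy_rmod f M)"
    then obtain a where a: "a \<in> carrier M" "x = f a" by (auto simp: s)
    have "f (\<ominus>\<^bsub>M\<^esub> a) \<oplus>\<^bsub>copy_rmod f M\<^esub> x = \<zero>\<^bsub>copy_rmod f M\<^esub>" using a by (simp add: s M.l_neg)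
    then show "\<exists>y\<in>carrier (copy_rmod f M). y \<oplus>\<^bsub>copy_rmod f M\<^esub> x = \<zero>\<^bsub>copy_rmod f M\<^esub>"
      using a by (auto simp: s(1))
  qed (auto simp: s M.a_ac rsmult_l_distr rsmult_r_distr rsmult_assoc rsmult_one
      rsmult_closed)
qed

context ring
begin

definition coset :: "'a set \<Rightarrow> 'a \<Rightarrow> 'a set" where
  "coset I x = I +> x"

text \<open>\<open>J / I\<close> keeps the operations of \<open>R / I\<close> and only restricts the
  carrier, so submodules formed by updating the carrier have the same shape.\<close>

definition quo :: "'a set \<Rightarrow> 'a set \<Rightarrow> ('a, 'a set) rmodule" where
  "quo I J = (quot_rmod (regular_rmod R) I)\<lparr>carrier := coset I ` J\<rparr>"

lemma mem_coset: "z \<in> coset I x \<longleftrightarrow> (\<exists>i\<in>I. z = i \<oplus> x)"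
  by (auto simp: coset_def a_r_coset_def')

lemma coset_regular: "I +>\<^bsub>regular_rmod R\<^esub> x = coset I x"
  by (auto simp: coset_def a_r_coset_def' regular_rmod_def)

lemma coset_self: "ri I \<Longrightarrow> x \<in> carrier R \<Longrightarrow> x \<in> coset I x"
  unfolding mem_coset using ri_zero l_zero by metis

lemma coset_eq_iff:
  assumes I: "ri I" and xy: "x \<in> carrier R" "y \<in> carrier R"
  shows "coset I x = coset I y \<longleftrightarrow> x \<ominus> y \<in> I"
proof
  assume "coset I x = coset I y"
  then obtain i where "i \<in> I" "x = i \<oplus> y" using coset_self[OF I xy(1)] mem_coset by blast
  then show "x \<ominus> y \<in> I" using minus_add_cancel2 I xy ri_carrier by metis
next
  assume d: "x \<ominus> y \<in> I"
  have "coset I u \<subseteq> coset I v" if uv: "u \<ominus> v \<in> I" "u \<in> carrier R" "v \<in> carrier R" for u v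
  proof
    fix z assume "z \<in> coset I u"
    then obtain i where i: "i \<in> I" "z = i \<oplus> u" using mem_coset by blast
    have "z = (i \<oplus> (u \<ominus> v)) \<oplus> v"
      using i uv I ri_carrier add_minus_cancel2 by (metis a_assoc minus_closed)
    then show "z \<in> coset I v" using mem_coset ri_add[OF I i(1) uv(1)] by blast
  qed
  moreover have "y \<ominus> x \<in> I"
    using ri_uminus[OF I d] xy by (simp add: a_minus_def minus_add a_comm)
  ultimately show "coset I x = coset I y" using d xy by blast
qed

lemma coset_eq_base: "ri I \<Longrightarrow> x \<in> carrier R \<Longrightarrow> coset I x = I \<longleftrightarrow> x \<in> I"
proof -
  assume I: "ri I" and x: "x \<in> carrier R"
  have "coset I \<zero> = I" using I by (auto simp: mem_coset ri_carrier)
  then show ?thesis using coset_eq_iff[OF I x zero_closed] x by (simp add: a_minus_def)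
qed

lemma coset_zero: "ri I \<Longrightarrow> coset I \<zero> = I"
  by (simp add: coset_eq_base ri_zero)

lemma coset_add:
  assumes I: "ri I" and xy: "x \<in> carrier R" "y \<in> carrier R"
  shows "coset I x \<boxplus> coset I y = coset I (x \<oplus> y)"
proof
  show "coset I x \<boxplus> coset I y \<subseteq> coset I (x \<oplus> y)"
  proof
    fix z assume "z \<in> coset I x \<boxplus> coset I y"
    then obtain u v where uv: "u \<in> coset I x" "v \<in> coset I y" "z = u \<oplus> v"
      unfolding mem_rsum by blast
    then obtain i j where ij: "i \<in> I" "j \<in> I" "z = (i \<oplus> x) \<oplus> (j \<oplus> y)"
      unfolding mem_coset by blast
    then have "z = (i \<oplus> j) \<oplus> (x \<oplus> y)" using xy I by (simp add: a_ac ri_carrier)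
    then show "z \<in> coset I (x \<oplus> y)" using ij I ri_add mem_coset by blast
  qed
  show "coset I (x \<oplus> y) \<subseteq> coset I x \<boxplus> coset I y"
  proof
    fix z assume "z \<in> coset I (x \<oplus> y)"
    then obtain i where i: "i \<in> I" "z = i \<oplus> (x \<oplus> y)" using mem_coset by blast
    then have "z = (i \<oplus> x) \<oplus> y" using xy I ri_carrier by (simp add: a_assoc)
    moreover have "i \<oplus> x \<in> coset I x" using i(1) mem_coset by blast
    ultimately show "z \<in> coset I x \<boxplus> coset I y" using rsumI coset_self[OF I xy(2)] by simp
  qed
qed

text \<open>The action on a factor module is a union over representatives; its members coincide
  because \<open>ur - xr = ir\<close> for \<open>u = i + x\<close>.\<close>

lemma coset_smult:
  assumes I: "ri I" and x: "x \<in> carrier R" and r: "r \<in> carrier R"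
  shows "(\<Union>u\<in>coset I x. coset I (u \<otimes> r)) = coset I (x \<otimes> r)"
proof -
  have "coset I (u \<otimes> r) = coset I (x \<otimes> r)" if u: "u \<in> coset I x" for u
  proof -
    obtain i where i: "i \<in> I" "u = i \<oplus> x" using u mem_coset by blast
    have ic: "i \<in> carrier R" using I i ri_carrier by blast
    have "u \<otimes> r \<ominus> x \<otimes> r = i \<otimes> r" using i ic x r by (simp add: l_distr minus_add_cancel2)
    then show ?thesis using coset_eq_iff[OF I, of "u \<otimes> r" "x \<otimes> r"] i ic x r ri_mult[OF I] by simp
  qed
  then show ?thesis using coset_self[OF I x] by blast
qed

lemma quo_simps:
  assumes I: "ri I"
  shows "carrier (quo I J) = coset I ` J" "\<zero>\<^bsub>quo I J\<^esub> = I"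
    "x \<in> carrier R \<Longrightarrow> y \<in> carrier R \<Longrightarrow> coset I x \<oplus>\<^bsub>quo I J\<^esub> coset I y = coset I (x \<oplus> y)"
    "x \<in> carrier R \<Longrightarrow> r \<in> carrier R \<Longrightarrow> coset I x \<triangleleft>\<^bsub>quo I J\<^esub> r = coset I (x \<otimes> r)"
proof -
  have "set_add (regular_rmod R) A B = A \<boxplus> B" for A B
    by (simp add: set_add_def' regular_rmod_def)
  then show "x \<in> carrier R \<Longrightarrow> y \<in> carrier R \<Longrightarrow> coset I x \<oplus>\<^bsub>quo I J\<^esub> coset I y = coset I (x \<oplus> y)"
    by (simp add: quo_def quot_rmod_def coset_add[OF I])
  have "x \<triangleleft>\<^bsub>regular_rmod R\<^esub> r = x \<otimes> r" for x r by (simp add: regular_rmod_def)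
  then show "x \<in> carrier R \<Longrightarrow> r \<in> carrier R \<Longrightarrow> coset I x \<triangleleft>\<^bsub>quo I J\<^esub> r = coset I (x \<otimes> r)"
    by (simp add: quo_def quot_rmod_def coset_regular coset_smult[OF I])
qed (simp_all add: quo_def quot_rmod_def)

lemma quo_whole: "quot_rmod (regular_rmod R) I = quo I (carrier R)"
  by (auto simp: quo_def quot_rmod_def A_RCOSETS_def' coset_regular[symmetric] regular_rmod_def)

lemma quo_restrict: "(quo I J)\<lparr>carrier := coset I ` K\<rparr> = quo I K"
  by (simp add: quo_def)

lemma right_module_quo:
  assumes I: "ri I" and J: "ri J"
  shows "right_module R (quo I J)"
proof -
  note s = quo_simps[OF I, where J = J]
  have c: "x \<in> carrier R" if "x \<in> J" for x using J that ri_carrier by blast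
  show ?thesis
  proof (intro right_module.intro right_module_axioms.intro abelian_groupI)
    show "ring R" by (rule ring_axioms)
    fix X assume "X \<in> carrier (quo I J)"
    then obtain x where x: "x \<in> J" "X = coset I x" by (auto simp: s)
    have "coset I (\<ominus> x) \<oplus>\<^bsub>quo I J\<^esub> X = \<zero>\<^bsub>quo I J\<^esub>" using x c s by (simp add: l_neg coset_zero[OF I])
    then show "\<exists>Y\<in>carrier (quo I J). Y \<oplus>\<^bsub>quo I J\<^esub> X = \<zero>\<^bsub>quo I J\<^esub>"
      using ri_uminus[OF J x(1)] s(1) by blast
  next
    show "\<zero>\<^bsub>quo I J\<^esub> \<in> carrier (quo I J)"
      unfolding s using coset_zero[OF I] ri_zero[OF J] by (metis image_eqI)
    fix X assume "X \<in> carrier (quo I J)"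
    then show "\<zero>\<^bsub>quo I J\<^esub> \<oplus>\<^bsub>quo I J\<^esub> X = X"
      using s(3)[of \<zero>] c by (auto simp: s(1,2) coset_zero[OF I])
  qed (auto simp: s c a_ac l_distr r_distr m_assoc ri_add[OF J] ri_mult[OF J])
qed

lemma coset_image_mem:
  assumes "ri I" "ri K" "I \<subseteq> K" "x \<in> carrier R"
  shows "coset I x \<in> coset I ` K \<longleftrightarrow> x \<in> K"
proof
  assume "coset I x \<in> coset I ` K"
  then obtain k where k: "k \<in> K" "coset I x = coset I k" by blast
  then have "x \<ominus> k \<in> K" using coset_eq_iff assms ri_carrier by blast
  then show "x \<in> K" using ri_diff_swap[OF assms(2)] k assms ri_carrier by blast
qed auto

lemma coset_image_subset:
  assumes "ri I" "ri K" "I \<subseteq> K" "ri H" "coset I ` H \<subseteq> coset I ` K" shows "H \<subseteq> K"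
proof
  fix x assume x: "x \<in> H"
  then show "x \<in> K" using coset_image_mem[OF assms(1-3) ri_carrier[OF assms(4) x]] assms(5) by blast
qed

lemma rsubmodule_quo:
  assumes I: "ri I" and J: "ri J" and K: "ri K" "K \<subseteq> J" "I \<subseteq> K"
  shows "rsubmodule R (quo I J) (coset I ` K)"
proof -
  interpret right_module R "quo I J" using right_module_quo I J .
  note s = quo_simps[OF I, where J = J]
  have c: "x \<in> carrier R" if "x \<in> K" for x using K that ri_carrier by blast
  show ?thesis
  proof (rule rsubmoduleI)
    show "coset I ` K \<subseteq> carrier (quo I J)" using K s by auto
    show "\<zero>\<^bsub>quo I J\<^esub> \<in> coset I ` K" using coset_zero[OF I] ri_zero[OF K(1)] s(2) by (metis image_eqI)
  qed (auto simp: s c ri_add[OF K(1)] ri_mult[OF K(1)])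
qed

text \<open>Correspondence theorem: the witness is the preimage of \<open>H\<close> in
  \<open>J\<close>.\<close>

lemma rsubmodule_quoE:
  assumes I: "ri I" and J: "ri J" and IJ: "I \<subseteq> J" and H: "rsubmodule R (quo I J) H"
  obtains K where "ri K" "K \<subseteq> J" "I \<subseteq> K" "H = coset I ` K"
proof -
  note s = quo_simps[OF I, where J = J] and h = rsubmoduleD[OF H]
  let ?K = "{y \<in> J. coset I y \<in> H}"
  have c: "x \<in> carrier R" if "x \<in> J" for x using J that ri_carrier by blast
  have "ri ?K"
    unfolding ri_iff
  proof (intro conjI ballI)
    show "?K \<subseteq> carrier R" using c by blast
    show "\<zero> \<in> ?K" using ri_zero[OF J] h(2) s(2) coset_zero[OF I] by simp
    fix x y assume x: "x \<in> ?K" "y \<in> ?K"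
    then have "coset I (x \<oplus> y) \<in> H" using h(3)[of "coset I x" "coset I y"] s(3)[of x y] c by auto
    then show "x \<oplus> y \<in> ?K" using x ri_add[OF J] by blast
  next
    fix x r assume x: "x \<in> ?K" "r \<in> carrier R"
    then have "coset I (x \<otimes> r) \<in> H" using h(4)[of "coset I x" r] s(4)[of x r] c by auto
    then show "x \<otimes> r \<in> ?K" using x ri_mult[OF J] by blast
  qed
  moreover have "I \<subseteq> ?K"
  proof
    fix i assume i: "i \<in> I"
    then have "coset I i = I" using coset_eq_base[OF I ri_carrier[OF I i]] by blast
    then show "i \<in> ?K" using i IJ h(2) s(2) by auto
  qed
  moreover have "H \<subseteq> coset I ` J" using h(1) s(1) by simp
  then have "H = coset I ` ?K" by blast
  ultimately show ?thesis using that[of ?K] by blast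
qed

lemma internal_direct_sum_quo:
  assumes I: "ri I" and J: "ri J" "I \<subseteq> J" and sum: "internal_direct_sum R (quo I J) H H'"
  obtains A B where "ri A" "ri B" "H = coset I ` A" "H' = coset I ` B" "A \<boxplus> B = J" "A \<inter> B = I"
proof -
  note s = quo_simps[OF I, where J = J]
  from sum have sub: "rsubmodule R (quo I J) H" "rsubmodule R (quo I J) H'"
    and e: "H <+>\<^bsub>quo I J\<^esub> H' = carrier (quo I J)" and i: "H \<inter> H' = {I}"
    by (auto simp: internal_direct_sum_def s)
  obtain A where A: "ri A" "A \<subseteq> J" "I \<subseteq> A" "H = coset I ` A" using rsubmodule_quoE[OF I J sub(1)] .
  obtain B where B: "ri B" "B \<subseteq> J" "I \<subseteq> B" "H' = coset I ` B" using rsubmodule_quoE[OF I J sub(2)] .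
  have AB: "ri (A \<boxplus> B)" "A \<subseteq> A \<boxplus> B"
    using ri_rsum[OF A(1) B(1)] rsum_upper1[OF A(1) B(1)] .
  have "coset I ` J \<subseteq> coset I ` (A \<boxplus> B)"
  proof
    fix X assume "X \<in> coset I ` J"
    then have "X \<in> H <+>\<^bsub>quo I J\<^esub> H'" using e s(1) by simp
    then obtain a b where ab: "a \<in> A" "b \<in> B" "X = coset I a \<oplus>\<^bsub>quo I J\<^esub> coset I b"
      unfolding A B by (auto simp: set_add_def')
    then have "X = coset I (a \<oplus> b)" using s(3) ri_carrier[OF A(1)] ri_carrier[OF B(1)] by simp
    then show "X \<in> coset I ` (A \<boxplus> B)" using ab rsumI by blast
  qed
  then have "J \<subseteq> A \<boxplus> B" using coset_image_subset[OF I AB(1) _ J(1)] A(3) AB(2) by blast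
  moreover have "A \<boxplus> B \<subseteq> J" using rsum_least[OF J(1) A(2) B(2)] .
  moreover have "A \<inter> B \<subseteq> I"
  proof
    fix x assume x: "x \<in> A \<inter> B"
    then have "coset I x = I" using i A B by blast
    then show "x \<in> I" using coset_eq_base[OF I] x A(1) ri_carrier by blast
  qed
  ultimately show ?thesis using that[OF A(1) B(1) A(4) B(4)] A(3) B(3) by blast
qed

text \<open>Testing on the cyclic submodules \<open>(xR + I) / I\<close> suffices: a nonzero class
  in one of them is the class of some \<open>xr\<close>, and \<open>r\<close> is the multiplier
  sought.\<close>

lemma ess_quo:
  assumes I: "ri I" and J: "ri J" "I \<subseteq> J" and K: "ri K" "I \<subseteq> K" and D: "ri D" "I \<subseteq> D" "D \<subseteq> J"
    and e: "essential_in R (quo I J) (coset I ` K) (coset I ` D)"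
  shows "ess I K D"
  unfolding ess_def
proof (intro conjI ballI)
  note s = quo_simps[OF I, where J = J]
  from e have KD: "coset I ` K \<subseteq> coset I ` D"
    and L: "\<And>L. rsubmodule R (quo I J) L \<Longrightarrow> L \<subseteq> coset I ` D \<Longrightarrow> L \<noteq> {I} \<Longrightarrow> coset I ` K \<inter> L \<noteq> {I}"
    by (auto simp: essential_in_def s)
  show "K \<subseteq> D" using coset_image_subset[OF I D(1,2) K(1) KD] .
  fix x assume x: "x \<in> D - I"
  have xc: "x \<in> carrier R" using x D ri_carrier by blast
  let ?L = "prin x \<boxplus> I"
  have Lr: "ri ?L" "I \<subseteq> ?L" "x \<in> ?L" using prin_rsum[OF I xc] ri_rsum[OF ri_prin[OF xc] I] by auto
  have LD: "?L \<subseteq> D" using x D by (intro rsum_least prin_least) auto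
  have "coset I x \<noteq> I" using x coset_eq_base[OF I xc] by blast
  then have "coset I ` ?L \<noteq> {I}" using Lr by blast
  then have ne: "coset I ` K \<inter> coset I ` ?L \<noteq> {I}"
    using L[OF rsubmodule_quo[OF I J(1) Lr(1) _ Lr(2)] image_mono[OF LD]] LD D(3) by simp
  have "I = coset I \<zero>" using coset_zero[OF I] by simp
  then have "I \<in> coset I ` K \<inter> coset I ` ?L" using ri_zero[OF K(1)] ri_zero[OF Lr(1)] by blast
  then obtain y where y: "y \<in> ?L" "coset I y \<in> coset I ` K" "coset I y \<noteq> I" using ne by blast
  obtain r i where r: "r \<in> carrier R" "i \<in> I" "y = x \<otimes> r \<oplus> i" using y by (auto simp: mem_rsum prin_def)
  have yc: "y \<in> carrier R" "x \<otimes> r \<in> carrier R" using y Lr ri_carrier xc r by auto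
  have "y \<in> K" using coset_image_mem[OF I K yc(1)] y by blast
  then have "x \<otimes> r \<in> K" using ri_cancel2[OF K(1), of i "x \<otimes> r"] r K yc by blast
  moreover have "y \<notin> I" using y coset_eq_base[OF I yc(1)] by blast
  then have "x \<otimes> r \<notin> I" using r ri_add[OF I] by blast
  ultimately show "\<exists>r\<in>carrier R. x \<otimes> r \<in> K - I" using r by blast
qed

lemma cs_quo:
  assumes I: "ri I" and J: "ri J" "I \<subseteq> J" and c: "CS_rmod R (quo I J)"
  shows "cs I J"
  unfolding cs_def
proof (intro allI impI; elim conjE)
  fix K assume K: "ri K" "I \<subseteq> K" "K \<subseteq> J"
  obtain H H' where H: "internal_direct_sum R (quo I J) H H'" "essential_in R (quo I J) (coset I ` K) H"
    using c rsubmodule_quo[OF I J(1) K(1,3,2)] unfolding CS_rmod_def direct_summand_def by blast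
  obtain D D' where D: "ri D" "ri D'" "H = coset I ` D" "H' = coset I ` D'" "D \<boxplus> D' = J" "D \<inter> D' = I"
    using internal_direct_sum_quo[OF I J H(1)] .
  have "D \<subseteq> J" using D(5) rsum_upper1[OF D(1,2)] by blast
  then have "ess I K D" using ess_quo[OF I J K(1,2) D(1) _ _ H(2)[unfolded D(3)]] D(6) by blast
  then show "\<exists>D D'. ri D \<and> ri D' \<and> D \<boxplus> D' = J \<and> D \<inter> D' = I \<and> ess I K D" using D by blast
qed

lemma noeth_quo:
  assumes I: "ri I" and J: "ri J" "I \<subseteq> J" and n: "noetherian_rmod R (quo I J)"
  shows "noeth I J"
  unfolding noeth_def
proof (intro allI impI)
  fix H :: "nat \<Rightarrow> 'a set"
  assume H: "\<forall>n. ri (H n) \<and> I \<subseteq> H n \<and> H n \<subseteq> J \<and> H n \<subseteq> H (Suc n)"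
  have "\<forall>i. rsubmodule R (quo I J) (coset I ` H i)" using rsubmodule_quo[OF I J(1)] H by blast
  moreover have "\<forall>i. coset I ` H i \<subseteq> coset I ` H (Suc i)" using H by (simp add: image_mono)
  ultimately obtain n where n: "\<forall>i\<ge>n. coset I ` H i = coset I ` H n"
    using n unfolding noetherian_rmod_def by meson
  have "H i = H n" if "i \<ge> n" for i
    using n that H coset_image_subset[OF I] by (metis order_refl subset_antisym)
  then show "\<exists>n. \<forall>m\<ge>n. H m = H n" by blast
qed

lemma right_module_right_ideal:
  assumes S: "ri S" shows "right_module R ((regular_rmod R)\<lparr>carrier := S\<rparr>)"
  using S
  by (intro right_module.intro right_module_axioms.intro abelian_groupI ring_axioms)
    (auto simp: regular_rmod_def a_ac l_distr r_distr m_assoc r_neg ri_carrier ri_add ri_mult ri_zero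
      intro!: bexI[of _ "\<ominus> _"] ri_uminus)

lemma right_module_regular: "right_module R (regular_rmod R)"
  using right_module_right_ideal[OF ri_whole] by (simp add: regular_rmod_def)

section \<open>The module hypotheses as statements about right ideals\<close>

text \<open>Up to copies, the identity of \<open>(bR + I) / I\<close> is lifted along
  \<open>r \<mapsto> br + I\<close> to a splitting \<open>h\<close>, and \<open>c\<close> is the
  image of the class of \<open>b\<close>. The lifting property gives \<open>bc - b \<in> I\<close>;
  that \<open>h\<close> is well defined on the class of \<open>br\<close> gives
  \<open>cr = 0\<close> for \<open>br \<in> I\<close>.\<close>

lemma projective_quo:
  assumes I: "ri I" and b: "b \<in> carrier R" and p: "projective_rmod R (quo I (prin b \<boxplus> I))"
  shows "\<exists>c\<in>carrier R. b \<otimes> c \<ominus> b \<in> I \<and> (\<forall>r\<in>carrier R. b \<otimes> r \<in> I \<longrightarrow> c \<otimes> r = \<zero>)"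
proof -
  let ?B = "prin b \<boxplus> I"
  let ?k = "\<lambda>r (_::'a set). r"
  \<comment> \<open>the test modules have elements of type \<^typ>\<open>'a set \<Rightarrow> 'a\<close>, hence these embeddings\<close>
  let ?f = "\<lambda>X (_::'a set). SOME x. x \<in> X"
  have B: "ri ?B" "I \<subseteq> ?B" "b \<in> ?B" using prin_rsum[OF I b] ri_rsum[OF ri_prin[OF b] I] by auto
  note s = quo_simps[OF I, where J = "?B"]
  have rep: "coset I (?f (coset I x) Z) = coset I x \<and> ?f (coset I x) Z \<in> carrier R"
    if x: "x \<in> carrier R" for x and Z :: "'a set"
  proof -
    have "?f (coset I x) Z \<in> coset I x" using someI[of "\<lambda>z. z \<in> coset I x"] coset_self[OF I x] by simp
    then obtain i where i: "i \<in> I" "?f (coset I x) Z = i \<oplus> x" using mem_coset by blast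
    have ic: "i \<in> carrier R" using i I ri_carrier by blast
    have "i \<oplus> x \<ominus> x \<in> I" using i ic x by (simp add: minus_add_cancel2)
    then show ?thesis using coset_eq_iff[OF I _ x] i ic x by simp
  qed
  have fE: "X = Y" if e: "?f X = ?f Y" and X: "X \<in> coset I ` carrier R" and Y: "Y \<in> coset I ` carrier R"
    for X Y
  proof -
    have "X = coset I (?f X {})" "Y = coset I (?f Y {})" using X Y rep by auto
    moreover have "?f X {} = ?f Y {}" using e by (rule fun_cong)
    ultimately show ?thesis by simp
  qed
  have Bc: "x \<in> carrier R" if "x \<in> ?B" for x using B that ri_carrier by blast
  have injf: "inj_on ?f (carrier (quo I ?B))"
    unfolding s using fE Bc by (intro inj_onI) blast
  have injk: "inj_on ?k (carrier (regular_rmod R))" by (auto simp: inj_on_def fun_eq_iff)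
  let ?M = "copy_rmod ?k (regular_rmod R)" and ?N = "copy_rmod ?f (quo I ?B)"
  note sM = copy_rmod_simps(1,2)[of ?k "regular_rmod R"] copy_rmod_simps(3,4)[OF injk]
  note sN = copy_rmod_simps(1,2)[of ?f "quo I ?B"] copy_rmod_simps(3,4)[OF injf]
  have reg: "carrier (regular_rmod R) = carrier R" "\<zero>\<^bsub>regular_rmod R\<^esub> = \<zero>"
    "x \<oplus>\<^bsub>regular_rmod R\<^esub> y = x \<oplus> y" "x \<triangleleft>\<^bsub>regular_rmod R\<^esub> y = x \<otimes> y" for x y
    by (simp_all add: regular_rmod_def)
  have rmM: "right_module R ?M" using right_module_copy[OF right_module_regular injk] .
  have rmN: "right_module R ?N" using right_module_copy[OF right_module_quo[OF I B(1)] injf] .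
  let ?g = "\<lambda>u. ?f (coset I (b \<otimes> u {}))"
  have br: "b \<otimes> r \<in> ?B" if "r \<in> carrier R" for r using ri_mult[OF B(1,3)] that .
  have mem: "coset I x \<in> carrier (quo I ?B)" if "x \<in> ?B" for x using that s(1) by blast
  have g: "?g \<in> rmod_hom R ?M ?N"
    unfolding rmod_hom_def
  proof (intro CollectI conjI ballI)
    show "?g \<in> carrier ?M \<rightarrow> carrier ?N" using br mem by (auto simp: sM sN reg)
    fix u assume "u \<in> carrier ?M"
    then obtain x where x: "x \<in> carrier R" "u = ?k x" by (auto simp: sM reg)
    {
      fix v assume "v \<in> carrier ?M"
      then obtain y where y: "y \<in> carrier R" "v = ?k y" by (auto simp: sM reg)
      have "u \<oplus>\<^bsub>?M\<^esub> v = ?k (x \<oplus> y)" using x y sM(3)[of x y] reg by simp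
      moreover have "?g u \<oplus>\<^bsub>?N\<^esub> ?g v = ?f (coset I (b \<otimes> x) \<oplus>\<^bsub>quo I ?B\<^esub> coset I (b \<otimes> y))"
        using x y sN(3)[OF mem[OF br[OF x(1)]] mem[OF br[OF y(1)]]] by simp
      ultimately show "?g (u \<oplus>\<^bsub>?M\<^esub> v) = ?g u \<oplus>\<^bsub>?N\<^esub> ?g v"
        using s(3)[of "b \<otimes> x" "b \<otimes> y"] x y b by (simp add: r_distr)
    }
    fix r assume r: "r \<in> carrier R"
    have "u \<triangleleft>\<^bsub>?M\<^esub> r = ?k (x \<otimes> r)" using x r sM(4)[of x r] reg by simp
    moreover have "?g u \<triangleleft>\<^bsub>?N\<^esub> r = ?f (coset I (b \<otimes> x) \<triangleleft>\<^bsub>quo I ?B\<^esub> r)"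
      using x sN(4)[OF mem[OF br[OF x(1)]]] by simp
    ultimately show "?g (u \<triangleleft>\<^bsub>?M\<^esub> r) = ?g u \<triangleleft>\<^bsub>?N\<^esub> r"
      using s(4)[of "b \<otimes> x" r] x r b by (simp add: m_assoc)
  qed
  have gsurj: "?g ` carrier ?M = carrier ?N"
  proof
    show "?g ` carrier ?M \<subseteq> carrier ?N" using rmod_homD(1)[OF g] by blast
    show "carrier ?N \<subseteq> ?g ` carrier ?M"
    proof
      fix w assume "w \<in> carrier ?N"
      then obtain y where y: "y \<in> ?B" "w = ?f (coset I y)" by (auto simp: sN s)
      then obtain r i where r: "r \<in> carrier R" "i \<in> I" "y = b \<otimes> r \<oplus> i" by (auto simp: mem_rsum prin_def)
      have ic: "i \<in> carrier R" using r I ri_carrier by blast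
      have "y \<ominus> b \<otimes> r = i" using r b ic by (simp add: minus_add_cancel)
      then have "coset I y = coset I (b \<otimes> r)"
        using coset_eq_iff[OF I, of y "b \<otimes> r"] r Bc[OF y(1)] b by simp
      then have "w = ?g (?k r)" using y by simp
      moreover have "?k r \<in> carrier ?M" using r by (simp add: sM reg)
      ultimately show "w \<in> ?g ` carrier ?M" by (rule image_eqI)
    qed
  qed
  have f: "?f \<in> rmod_hom R (quo I ?B) ?N"
    unfolding rmod_hom_def by (auto simp: sN)
  have "\<exists>h\<in>rmod_hom R (quo I ?B) ?M. \<forall>x\<in>carrier (quo I ?B). ?g (h x) = ?f x"
    using p[unfolded projective_rmod_def, THEN conjunct2, rule_format, OF conjI[OF rmM rmN] g gsurj f] .
  then obtain h where h: "h \<in> rmod_hom R (quo I ?B) ?M"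
    and gh0: "\<forall>x\<in>carrier (quo I ?B). ?g (h x) = ?f x" by (rule bexE)
  note gh = gh0[rule_format]
  have mb: "coset I b \<in> carrier (quo I ?B)" using mem B by blast
  have "h (coset I b) \<in> carrier ?M" using rmod_homD(1)[OF h mb] .
  then obtain c where c: "c \<in> carrier R" "h (coset I b) = ?k c" by (auto simp: sM reg)
  have "?f (coset I (b \<otimes> c)) = ?f (coset I b)" using gh[OF mb] c by simp
  moreover have "coset I (b \<otimes> c) \<in> coset I ` carrier R" "coset I b \<in> coset I ` carrier R"
    using b c(1) by simp_all
  ultimately have "coset I (b \<otimes> c) = coset I b" by (rule fE)
  then have 1: "b \<otimes> c \<ominus> b \<in> I" using coset_eq_iff[OF I] b c by simp
  have hr: "h (coset I (b \<otimes> r)) = ?k (c \<otimes> r)" if "r \<in> carrier R" for r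
    using rmod_homD(3)[OF h mb that] s(4)[OF b that] c sM(4)[of c r] reg by simp
  have "c \<otimes> r = \<zero>" if r: "r \<in> carrier R" "b \<otimes> r \<in> I" for r
  proof -
    have "coset I (b \<otimes> r) = I" using coset_eq_base[OF I] r b by simp
    then have "coset I (b \<otimes> r) = coset I (b \<otimes> \<zero>)" using coset_zero[OF I] b by simp
    then have "?k (c \<otimes> r) = ?k (c \<otimes> \<zero>)" using hr r by (metis zero_closed)
    then show ?thesis using c by (simp add: fun_eq_iff)
  qed
  then show ?thesis using c 1 by blast
qed

lemma star_quo:
  assumes star: "\<And>N :: ('a, 'a set) rmodule. cyclic_rmod R N \<Longrightarrow> star_condition R N"
    and I: "ri I" and x: "x \<in> carrier R"
  shows "\<exists>A b c. ri A \<and> b \<in> carrier R \<and> c \<in> carrier R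
      \<and> A \<boxplus> (prin b \<boxplus> I) = prin x \<boxplus> I \<and> A \<inter> (prin b \<boxplus> I) = I \<and> (cs I A \<or> noeth I A)
      \<and> b \<otimes> c \<ominus> b \<in> I \<and> (\<forall>r\<in>carrier R. b \<otimes> r \<in> I \<longrightarrow> c \<otimes> r = \<zero>)"
proof -
  let ?J = "prin x \<boxplus> I"
  have J: "ri ?J" "I \<subseteq> ?J" "x \<in> ?J" using prin_rsum[OF I x] ri_rsum[OF ri_prin[OF x] I] by auto
  note s = quo_simps[OF I, where J = "?J"]
  have "cyclic_rmod R (quo I ?J)"
    unfolding cyclic_rmod_def
  proof (intro conjI bexI)
    show "right_module R (quo I ?J)" using right_module_quo[OF I J(1)] .
    show "coset I x \<in> carrier (quo I ?J)" using J s(1) by blast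
    have "coset I ` ?J = (\<lambda>r. coset I (x \<otimes> r)) ` carrier R"
    proof
      show "(\<lambda>r. coset I (x \<otimes> r)) ` carrier R \<subseteq> coset I ` ?J" using ri_mult[OF J(1,3)] by blast
      show "coset I ` ?J \<subseteq> (\<lambda>r. coset I (x \<otimes> r)) ` carrier R"
      proof
        fix X assume "X \<in> coset I ` ?J"
        then obtain r i where r: "r \<in> carrier R" "i \<in> I" "X = coset I (x \<otimes> r \<oplus> i)"
          by (auto simp: mem_rsum prin_def)
        have ic: "i \<in> carrier R" using r I ri_carrier by blast
        have "(x \<otimes> r \<oplus> i) \<ominus> x \<otimes> r = i" using r x ic by (simp add: minus_add_cancel)
        then have "X = coset I (x \<otimes> r)"
          using coset_eq_iff[OF I, of "x \<otimes> r \<oplus> i" "x \<otimes> r"] r x ic by simp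
        then show "X \<in> (\<lambda>r. coset I (x \<otimes> r)) ` carrier R" using r by blast
      qed
    qed
    then show "carrier (quo I ?J) = (\<lambda>r. coset I x \<triangleleft>\<^bsub>quo I ?J\<^esub> r) ` carrier R"
      using s x by (simp cong: image_cong)
  qed
  then obtain H H' where H: "internal_direct_sum R (quo I ?J) H H'"
    "CS_rmod R ((quo I ?J)\<lparr>carrier := H\<rparr>) \<or> noetherian_rmod R ((quo I ?J)\<lparr>carrier := H\<rparr>)"
    "projective_rmod R ((quo I ?J)\<lparr>carrier := H'\<rparr>)"
    using star unfolding star_condition_def by blast
  obtain A B where A: "ri A" "ri B" "H = coset I ` A" "H' = coset I ` B" "A \<boxplus> B = ?J" "A \<inter> B = I"
    using internal_direct_sum_quo[OF I J(1,2) H(1)] .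
  \<comment> \<open>The summands are exchanged so that \<open>b\<close> generates the projective one
    modulo \<open>I\<close>.\<close>
  have BA: "B \<boxplus> A = ?J" "B \<inter> A = I" using A rsum_commute by auto
  obtain b a where b: "b \<in> B" "a \<in> A" "B = prin b \<boxplus> I" "x = b \<oplus> a"
    using summand_prin[OF I A(2,1) x BA] .
  have bc: "b \<in> carrier R" using b(1) A(2) ri_carrier by blast
  have "cs I A \<or> noeth I A"
    using H(2) cs_quo[OF I A(1)] noeth_quo[OF I A(1)] A(6) unfolding A(3) quo_restrict by blast
  moreover have "projective_rmod R (quo I (prin b \<boxplus> I))"
    using H(3) b(3) unfolding A(4) quo_restrict by simp
  then obtain c where "c \<in> carrier R" "b \<otimes> c \<ominus> b \<in> I" "\<forall>r\<in>carrier R. b \<otimes> r \<in> I \<longrightarrow> c \<otimes> r = \<zero>"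
    using projective_quo[OF I bc] by blast
  ultimately show ?thesis using A(1,5,6) bc unfolding b(3) by metis
qed

text \<open>Essentiality of \<open>I\<close> excludes an isomorphism from \<open>R / I\<close> to
  \<open>R\<close>: the class of \<open>x\<close> sent to \<open>1\<close> would have zero
  annihilator, yet some nonzero \<open>r\<close> has \<open>xr \<in> I\<close>. So
  \<open>T / I\<close> is injective relative to \<open>R / I\<close>, its identity extends to a
  retraction \<open>g\<close>, and the complement is the kernel of \<open>g\<close>.\<close>

lemma WV_complement:
  assumes WV: "right_WV_ring R" and I: "ri I" and ess: "ess {\<zero>} I (carrier R)" and T: "atom I T"
  shows "\<exists>C. ri C \<and> T \<boxplus> C = carrier R \<and> T \<inter> C = I"
proof -
  have rT: "ri T" "I \<subseteq> T" "T \<noteq> I" using T by (auto simp: atom_def)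
  note s = quo_simps[OF I]
  \<comment> \<open>This covers \<open>x = \<zero>\<close> below, where \<open>r = \<one>\<close>
    serves; over the zero ring there is no atom.\<close>
  have one: "\<one> \<noteq> \<zero>"
  proof
    assume "\<one> = \<zero>"
    then have "carrier R = {\<zero>}" by (rule one_zeroD)
    then have "T \<subseteq> {\<zero>}" using ri_carrier[OF rT(1)] by auto
    then show False using rT(2,3) ri_zero[OF I] by auto
  qed
  have "\<not> rmod_iso R (quo I (carrier R)) (regular_rmod R)"
  proof
    assume "rmod_iso R (quo I (carrier R)) (regular_rmod R)"
    then obtain f where f: "f \<in> rmod_hom R (quo I (carrier R)) (regular_rmod R)"
      and bij: "bij_betw f (carrier (quo I (carrier R))) (carrier (regular_rmod R))"
      unfolding rmod_iso_def by blast
    have "\<one> \<in> f ` coset I ` carrier R"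
      using bij by (simp add: bij_betw_def s regular_rmod_def)
    then obtain x where x: "x \<in> carrier R" "f (coset I x) = \<one>" by auto
    have fr: "f (coset I (x \<otimes> r)) = r" if "r \<in> carrier R" for r
      using rmod_homD(3)[OF f _ that, of "coset I x"] x s that by (simp add: regular_rmod_def)
    obtain r where r: "r \<in> carrier R" "r \<noteq> \<zero>" "x \<otimes> r \<in> I"
    proof (cases "x = \<zero>")
      case True
      then show ?thesis using that[of \<one>] one ri_zero[OF I] by simp
    next
      case False
      then obtain r where r: "r \<in> carrier R" "x \<otimes> r \<in> I" "x \<otimes> r \<noteq> \<zero>" using essD[OF ess x(1)] by blast
      then have "r \<noteq> \<zero>" using x(1) by auto
      then show ?thesis using that r by blast
    qed
    have "coset I (x \<otimes> r) = I" using coset_eq_base[OF I] r x by simp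
    then have "coset I (x \<otimes> r) = coset I (x \<otimes> \<zero>)" using coset_zero[OF I] x by simp
    then have "f (coset I (x \<otimes> r)) = f (coset I (x \<otimes> \<zero>))" by (rule arg_cong)
    then have "r = \<zero>" unfolding fr[OF r(1)] fr[OF zero_closed] .
    then show False using r by blast
  qed
  moreover have "simple_rmod R (quo I T)"
    unfolding simple_rmod_def
  proof (intro conjI allI impI)
    show "right_module R (quo I T)" using right_module_quo[OF I rT(1)] .
    obtain t where t: "t \<in> T" "t \<notin> I" using rT by blast
    have "coset I t \<noteq> I" using coset_eq_base[OF I ri_carrier[OF rT(1) t(1)]] t(2) by blast
    then show "carrier (quo I T) \<noteq> {\<zero>\<^bsub>quo I T\<^esub>}"
      unfolding s(1,2) using imageI[OF t(1), of "coset I"] by auto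
    fix H assume "rsubmodule R (quo I T) H"
    then obtain K where K: "ri K" "K \<subseteq> T" "I \<subseteq> K" "H = coset I ` K"
      by (rule rsubmodule_quoE[OF I rT(1,2)])
    show "H = {\<zero>\<^bsub>quo I T\<^esub>} \<or> H = carrier (quo I T)"
    proof (cases "K = I")
      case True
      have "coset I ` I = {I}"
        using coset_eq_base[OF I] ri_carrier[OF I] ri_zero[OF I] by (auto simp: image_iff)
      then show ?thesis using True K s by simp
    next
      case False
      then obtain y where y: "y \<in> K" "y \<notin> I" using K by blast
      then have "T \<subseteq> prin y \<boxplus> I" using T K unfolding atom_def by blast
      also have "\<dots> \<subseteq> K" using y K by (intro rsum_least prin_least) auto
      finally show ?thesis using K s by auto
    qed
  qed
  ultimately have inj: "rel_injective R (quo I (carrier R)) (quo I T)"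
    using WV I unfolding right_WV_ring_def quo_whole by blast
  have Tc: "T \<subseteq> carrier R" using rT(1) ri_carrier by blast
  have "(\<lambda>X. X) \<in> rmod_hom R ((quo I (carrier R))\<lparr>carrier := coset I ` T\<rparr>) (quo I T)"
    unfolding quo_restrict rmod_hom_def by auto
  then have "\<exists>g\<in>rmod_hom R (quo I (carrier R)) (quo I T). \<forall>X\<in>coset I ` T. g X = X"
    using inj[unfolded rel_injective_def, rule_format, OF rsubmodule_quo[OF I ri_whole rT(1) Tc rT(2)]]
    by simp
  then obtain g where g: "g \<in> rmod_hom R (quo I (carrier R)) (quo I T)" "\<forall>X\<in>coset I ` T. g X = X"
    by (rule bexE)
  have m: "coset I y \<in> carrier (quo I (carrier R))" if "y \<in> carrier R" for y
    unfolding s(1) using that by (rule imageI)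
  have gI: "g I = I"
    using g(2) coset_zero[OF I] ri_zero[OF rT(1)] by (metis image_eqI)
  let ?C = "{y \<in> carrier R. g (coset I y) = I}"
  have addI: "I \<oplus>\<^bsub>quo I T\<^esub> I = I" using s(3)[of \<zero> \<zero> T] coset_zero[OF I] by simp
  have C: "ri ?C"
    unfolding ri_iff
  proof (intro conjI ballI)
    show "\<zero> \<in> ?C" using gI coset_zero[OF I] by simp
    fix x y assume xy: "x \<in> ?C" "y \<in> ?C"
    then have "g (coset I (x \<oplus> y)) = I"
      using rmod_homD(2)[OF g(1) m m, of x y] s(3)[of x y "carrier R"] addI by simp
    then show "x \<oplus> y \<in> ?C" using xy by simp
  next
    fix x r assume x: "x \<in> ?C" and r: "r \<in> carrier R"
    have "g (coset I (x \<otimes> r)) = I \<triangleleft>\<^bsub>quo I T\<^esub> r"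
      using rmod_homD(3)[OF g(1) m r, of x] s(4)[of x r "carrier R"] x r by simp
    also have "\<dots> = I" using s(4)[of \<zero> r T] coset_zero[OF I] r by simp
    finally show "x \<otimes> r \<in> ?C" using x r by simp
  qed blast
  have IC: "I \<subseteq> ?C"
  proof
    fix i assume i: "i \<in> I"
    then have "i \<in> carrier R" "coset I i = I" using ri_carrier[OF I] coset_eq_base[OF I] by auto
    then show "i \<in> ?C" using gI by simp
  qed
  have "T \<inter> ?C \<subseteq> I"
  proof
    fix x assume x: "x \<in> T \<inter> ?C"
    then have "coset I x = I" using g(2) by auto
    then show "x \<in> I" using coset_eq_base[OF I] x by blast
  qed
  moreover have "carrier R \<subseteq> T \<boxplus> ?C"
  proof
    fix y assume y: "y \<in> carrier R"
    obtain t where t: "t \<in> T" "g (coset I y) = coset I t" using rmod_homD(1)[OF g(1) m[OF y]] s by auto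
    have tc: "t \<in> carrier R" using t Tc by blast
    let ?d = "y \<ominus> t"
    have dc: "?d \<in> carrier R" using y tc by simp
    obtain u where u: "u \<in> T" "g (coset I ?d) = coset I u" using rmod_homD(1)[OF g(1) m[OF dc]] s by auto
    have uc: "u \<in> carrier R" using u Tc by blast
    have yd: "y = t \<oplus> ?d" using add_minus_cancel[OF tc y] by simp
    \<comment> \<open>\<open>g\<close> fixes the class of \<open>t\<close> and sends that of
      \<open>y\<close> to it, so \<open>y - t\<close> falls into the kernel.\<close>
    have "g (coset I t \<oplus>\<^bsub>quo I (carrier R)\<^esub> coset I ?d) = coset I t \<oplus>\<^bsub>quo I T\<^esub> coset I u"
      using rmod_homD(2)[OF g(1) m[OF tc] m[OF dc]] g(2) t(1) u(2) by simp
    then have "coset I t = coset I (t \<oplus> u)"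
      using s(3)[OF tc dc, of "carrier R"] s(3)[OF tc uc, of T] t(2) yd by simp
    then have "(t \<oplus> u) \<ominus> t \<in> I" using coset_eq_iff[OF I, of "t \<oplus> u" t] tc uc by simp
    then have "u \<in> I" using minus_add_cancel[OF tc uc] by simp
    then have "coset I u = I" using coset_eq_base[OF I uc] by blast
    then have "?d \<in> ?C" using u dc by simp
    then show "y \<in> T \<boxplus> ?C" using yd t rsumI by metis
  qed
  moreover have "T \<boxplus> ?C \<subseteq> carrier R" using ri_rsum[OF rT(1) C] ri_carrier by blast
  ultimately show ?thesis using C IC rT by (intro exI[of _ ?C]) blast
qed

subsection \<open>Semisimplicity\<close>

lemma rsubmodule_regular_iff:
  "rsubmodule R ((regular_rmod R)\<lparr>carrier := S\<rparr>) H \<longleftrightarrow> ri H \<and> H \<subseteq> S" if S: "ri S"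
proof
  assume H: "rsubmodule R ((regular_rmod R)\<lparr>carrier := S\<rparr>) H"
  show "ri H \<and> H \<subseteq> S"
    unfolding ri_iff using rsubmoduleD[OF H] S
    by (auto simp: regular_rmod_def ri_carrier)
next
  assume H: "ri H \<and> H \<subseteq> S"
  interpret right_module R "(regular_rmod R)\<lparr>carrier := S\<rparr>" using right_module_right_ideal[OF S] .
  show "rsubmodule R ((regular_rmod R)\<lparr>carrier := S\<rparr>) H"
    using H by (intro rsubmoduleI) (auto simp: regular_rmod_def ri_add ri_mult ri_zero)
qed

lemma simple_atom:
  assumes T: "atom {\<zero>} T" shows "simple_rmod R ((regular_rmod R)\<lparr>carrier := T\<rparr>)"
  unfolding simple_rmod_def
proof (intro conjI allI impI)
  have rT: "ri T" "T \<noteq> {\<zero>}" using T by (auto simp: atom_def)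
  show "right_module R ((regular_rmod R)\<lparr>carrier := T\<rparr>)" using right_module_right_ideal rT by blast
  have z: "\<zero>\<^bsub>(regular_rmod R)\<lparr>carrier := T\<rparr>\<^esub> = \<zero>" by (simp add: regular_rmod_def)
  show "carrier ((regular_rmod R)\<lparr>carrier := T\<rparr>) \<noteq> {\<zero>\<^bsub>(regular_rmod R)\<lparr>carrier := T\<rparr>\<^esub>}" using rT z by simp
  fix H assume "rsubmodule R ((regular_rmod R)\<lparr>carrier := T\<rparr>) H"
  then have H: "ri H" "H \<subseteq> T" using rsubmodule_regular_iff[OF rT(1)] by auto
  show "H = {\<zero>\<^bsub>(regular_rmod R)\<lparr>carrier := T\<rparr>\<^esub>} \<or> H = carrier ((regular_rmod R)\<lparr>carrier := T\<rparr>)"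
  proof (cases "H = {\<zero>}")
    case False
    then obtain y where y: "y \<in> H" "y \<noteq> \<zero>" using ri_zero[OF H(1)] by blast
    then have "T \<subseteq> prin y \<boxplus> {\<zero>}" using T H unfolding atom_def by blast
    also have "\<dots> \<subseteq> H" using y H ri_zero[OF H(1)] by (intro rsum_least prin_least) auto
    finally show ?thesis using H by auto
  qed (simp add: z)
qed

lemma rspan_regular: "rspan R (regular_rmod R) X = \<Inter>{H. ri H \<and> X \<subseteq> H}"
  by (simp add: rspan_def right_ideal_def)

lemma ri_rspan:
  assumes "X \<subseteq> carrier R" shows "ri (rspan R (regular_rmod R) X)"
  unfolding rspan_regular
proof (rule ri_iff[THEN iffD2], intro conjI ballI)
  show "\<Inter>{H. ri H \<and> X \<subseteq> H} \<subseteq> carrier R" using assms ri_whole by blast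
qed (auto simp: ri_zero ri_add ri_mult)

lemma rspan_superset: "X \<subseteq> rspan R (regular_rmod R) X"
  by (auto simp: rspan_regular)

lemma rspan_least: "ri H \<Longrightarrow> X \<subseteq> H \<Longrightarrow> rspan R (regular_rmod R) X \<subseteq> H"
  by (auto simp: rspan_regular)

lemma rspan_Un:
  assumes X: "X \<subseteq> carrier R" and T: "ri T"
  shows "rspan R (regular_rmod R) (X \<union> T) = rspan R (regular_rmod R) X \<boxplus> T" (is "?l = ?s \<boxplus> T")
proof
  have s: "ri ?s" using ri_rspan[OF X] .
  have "T \<subseteq> carrier R" using T ri_carrier by blast
  then have l: "ri ?l" using ri_rspan X by blast
  have "X \<union> T \<subseteq> ?s \<boxplus> T"
    using rspan_superset[of X] rsum_upper1[OF s T] rsum_upper2[OF s T] by blast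
  then show "?l \<subseteq> ?s \<boxplus> T" using rspan_least[OF ri_rsum[OF s T]] by blast
  have "X \<subseteq> ?l" "T \<subseteq> ?l" using rspan_superset[of "X \<union> T"] by auto
  then show "?s \<boxplus> T \<subseteq> ?l" using rsum_least[OF l] rspan_least[OF l] by blast
qed

text \<open>A simple right ideal meets \<open>F\<close> in zero or is contained in it. Dropping
  those of the second kind turns the sum into a direct one.\<close>

lemma fsum_independent:
  assumes "fsum {\<zero>} F"
  shows "\<exists>\<S>. (\<forall>S\<in>\<S>. atom {\<zero>} S) \<and> rspan R (regular_rmod R) (\<Union>\<S>) = F
    \<and> (\<forall>S\<in>\<S>. S \<inter> rspan R (regular_rmod R) (\<Union>(\<S> - {S})) = {\<zero>})"
  using assms
proof (induction rule: fsum.induct)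
  case fsum_base
  have "rspan R (regular_rmod R) {} \<subseteq> {\<zero>}" using rspan_least[OF ri_null] by blast
  moreover have "\<zero> \<in> rspan R (regular_rmod R) {}" using ri_rspan ri_zero by blast
  ultimately show ?case by (intro exI[of _ "{}"]) auto
next
  case (fsum_step F T)
  let ?span = "rspan R (regular_rmod R)"
  obtain \<S> where S: "\<And>S. S \<in> \<S> \<Longrightarrow> atom {\<zero>} S" "?span (\<Union>\<S>) = F"
    "\<And>S. S \<in> \<S> \<Longrightarrow> S \<inter> ?span (\<Union>(\<S> - {S})) = {\<zero>}" using fsum_step.IH by metis
  have F: "ri F" and T: "ri T" using fsum_ri[OF fsum_step.hyps(1) ri_null] atom_ri[OF fsum_step.hyps(2)] .
  have SF: "S \<subseteq> F" if "S \<in> \<S>" for S using rspan_superset[of "\<Union>\<S>"] that unfolding S(2) by blast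
  have Fc: "F \<subseteq> carrier R" using F ri_carrier by blast
  show ?case
  proof (cases "T \<subseteq> F")
    case True
    then have "F \<boxplus> T = F" using rsum_absorb2[OF F T] by simp
    then show ?thesis using S by metis
  next
    case False
    have TF: "T \<inter> F = {\<zero>}"
    proof (rule ccontr)
      assume "T \<inter> F \<noteq> {\<zero>}"
      then obtain y where y: "y \<in> T" "y \<in> F" "y \<noteq> \<zero>" using ri_zero[OF F] ri_zero[OF T] by blast
      then have "T \<subseteq> prin y \<boxplus> {\<zero>}" using fsum_step.hyps(2) unfolding atom_def by blast
      also have "\<dots> \<subseteq> F" using y F ri_zero[OF F] by (intro rsum_least prin_least) auto
      finally show False using False by blast
    qed
    have TS: "T \<notin> \<S>" using SF False by blast
    let ?S = "insert T \<S>"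
    have Sc: "\<Union>(\<S> - X) \<subseteq> carrier R" for X using SF Fc by blast
    have "\<forall>S\<in>?S. atom {\<zero>} S" using S(1) fsum_step.hyps(2) by blast
    moreover have "?span (\<Union>?S) = F \<boxplus> T"
      using rspan_Un[OF Sc[of "{}"] T] S(2) by (simp add: Un_commute)
    moreover have "U \<inter> ?span (\<Union>(?S - {U})) = {\<zero>}" if U: "U \<in> ?S" for U
    proof (cases "U = T")
      case True
      then have "?S - {U} = \<S>" using TS by blast
      then show ?thesis using True TF S(2) by simp
    next
      case False
      then have US: "U \<in> \<S>" using U by blast
      let ?G = "?span (\<Union>(\<S> - {U}))"
      have G: "ri ?G" using ri_rspan[OF Sc] .
      have "\<Union>(\<S> - {U}) \<subseteq> F" using SF by blast
      then have GF: "?G \<subseteq> F" by (rule rspan_least[OF F])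
      have "?S - {U} = insert T (\<S> - {U})" using False by blast
      then have "?span (\<Union>(?S - {U})) = ?G \<boxplus> T"
        using rspan_Un[OF Sc T, of "{U}"] by (simp add: Un_commute)
      also have "\<dots> = T \<boxplus> ?G" using rsum_commute[OF G T] .
      finally have e: "?span (\<Union>(?S - {U})) = T \<boxplus> ?G" .
      have "(T \<boxplus> ?G) \<inter> U = {\<zero>}"
        using TF GF SF[OF US] S(3)[OF US]
        by (intro Int_rsum_null[OF T G atom_ri[OF S(1)[OF US]] F]) auto
      then show ?thesis using e by blast
    qed
    ultimately show ?thesis by (intro exI[of _ ?S]) blast
  qed
qed

text \<open>The traces \<open>H m \<inter> F\<close> become stationary by induction. If some
  \<open>H k\<close> lies in \<open>F\<close>, this settles the sequence. Otherwise each
  \<open>H m\<close> contains an element that generates \<open>F \<boxplus> T\<close> modulo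
  \<open>F\<close>, so late members with equal traces are equal.\<close>

lemma fsum_dcc:
  fixes H :: "nat \<Rightarrow> 'a set"
  assumes "fsum {\<zero>} F" "\<And>n. ri (H n)" "\<And>n. H n \<subseteq> F" "\<And>n. H (Suc n) \<subseteq> H n"
  shows "\<exists>n. \<forall>m\<ge>n. H m = H n"
  using assms
proof (induction arbitrary: H rule: fsum.induct)
  case fsum_base
  then have "H m = {\<zero>}" for m using ri_zero by blast
  then show ?case by simp
next
  case (fsum_step F T)
  have F: "ri F" and T: "ri T" using fsum_ri[OF fsum_step.hyps(1) ri_null] atom_ri[OF fsum_step.hyps(2)] .
  note H = fsum_step.prems
  have mono: "H m \<subseteq> H n" if "n \<le> m" for m n
    using that by (induction rule: dec_induct) (use H(3) in blast)+
  obtain n where n: "\<And>m. m \<ge> n \<Longrightarrow> H m \<inter> F = H n \<inter> F"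
    using fsum_step.IH[of "\<lambda>n. H n \<inter> F"] H(1,3) ri_Int[OF _ F] by (metis Int_lower2 Int_mono order_refl)
  show ?case
  proof (cases "\<exists>k. H k \<subseteq> F")
    case True
    then obtain k where k: "H k \<subseteq> F" by blast
    have "H m = H n \<inter> F" if "m \<ge> max n k" for m
      using n[of m] mono[of k m] k that by auto
    then have "\<forall>m\<ge>max n k. H m = H (max n k)" by simp
    then show ?thesis by blast
  next
    case False
    have "H n \<subseteq> H m" if m: "m \<ge> n" for m
    proof
      fix x assume x: "x \<in> H n"
      obtain y where y: "y \<in> H m" "y \<notin> F" using False by blast
      have yc: "y \<in> carrier R" using y(1) H(1) ri_carrier by blast
      have zF: "{\<zero>} \<subseteq> F" using ri_zero[OF F] by blast
      have "y \<in> F \<boxplus> T" using y H(2) by blast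
      then have "F \<boxplus> T \<subseteq> F \<boxplus> prin y"
        using atom_exchange[OF F fsum_step.hyps(2) zF _ y(2)] by blast
      then have "x \<in> F \<boxplus> prin y" using x H(2) by blast
      then obtain f v where fv: "f \<in> F" "v \<in> prin y" "x = f \<oplus> v" by (auto simp: mem_rsum)
      have c: "f \<in> carrier R" "v \<in> carrier R"
        using ri_carrier[OF F fv(1)] ri_carrier[OF ri_prin[OF yc] fv(2)] .
      have v: "v \<in> H m" using fv(2) prin_least[OF H(1) y(1)] by blast
      then have "v \<in> H n" using mono[OF m] by blast
      then have "f \<in> H n" using ri_cancel2[OF H(1), of v n f] fv(3) x c by blast
      then have "f \<in> H m" using n[OF m] fv(1) by blast
      then show "x \<in> H m" using fv(3) v ri_add[OF H(1)] by blast
    qed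
    then show ?thesis using mono by (intro exI[of _ n]) blast
  qed
qed

lemma fsum_semisimple_artinian:
  assumes "fsum {\<zero>} (carrier R)" shows "semisimple_artinian_ring R"
proof -
  have z: "\<zero>\<^bsub>regular_rmod R\<^esub> = \<zero>" "carrier (regular_rmod R) = carrier R" by (simp_all add: regular_rmod_def)
  obtain \<S> where S: "\<And>S. S \<in> \<S> \<Longrightarrow> atom {\<zero>} S" "rspan R (regular_rmod R) (\<Union>\<S>) = carrier R"
    "\<And>S. S \<in> \<S> \<Longrightarrow> S \<inter> rspan R (regular_rmod R) (\<Union>(\<S> - {S})) = {\<zero>}"
    using fsum_independent[OF assms] by metis
  have "rsubmodule R (regular_rmod R) S" if "S \<in> \<S>" for S
    using atom_ri[OF S(1)[OF that]] unfolding right_ideal_def .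
  then have "semisimple_rmod R (regular_rmod R)"
    unfolding semisimple_rmod_def z
    using right_module_regular S simple_atom by (intro conjI exI[of _ \<S>]) blast+
  moreover have "artinian_rmod R (regular_rmod R)"
    unfolding artinian_rmod_def right_ideal_def[symmetric]
    using right_module_regular fsum_dcc[OF assms] ri_carrier by blast
  ultimately show ?thesis by (simp add: semisimple_artinian_ring_def ring_axioms)
qed

end

theorem theorem17:
  fixes R :: "('a, 'm) ring_scheme"
  assumes "ring R"
    and "von_neumann_regular R"
    and "right_WV_ring R"
    and "\<And>N :: ('a, 'a set) rmodule. cyclic_rmod R N \<Longrightarrow> star_condition R N"
  shows "semisimple_artinian_ring R"
proof -
  interpret ring R by fact
  have "\<exists>x\<in>carrier R. a = a \<otimes>\<^bsub>R\<^esub> x \<otimes>\<^bsub>R\<^esub> a" if "a \<in> carrier R" for a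
    using assms(2) that by (simp add: von_neumann_regular_def)
  then have "fsum {\<zero>\<^bsub>R\<^esub>} (carrier R)"
    using WV_complement[OF assms(3)] star_quo[OF assms(4)] by (rule fsum_whole)
  then show ?thesis by (rule fsum_semisimple_artinian)
qed

end
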